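(* Let $n\ge2$ and let $X$ be the Poisson hyperplane process in $\mathbb{R}^n$ with intensity $\gamma>0$ and distance exponent $r\in(0,\infty)$, with zero cell $Z_0$. Then \[ \mathbb{E}[V_n(Z_0)^2] = \frac{8\pi b_{n,2}}{r} \,\Gamma\left(\frac{2n}{r}\right) \left(\frac{n\kappa_n r}{2\gamma c(n,r)}\right)^{\frac{2n}{r}}\int_0^\pi \int_0^1 \frac{t^{n-1}}{F_r(t,\varphi)^{\frac{2n}{r}}} (\sin \varphi)^{n-2}\,dt\,d\varphi \] and \[ \operatorname{Var}[V_n(Z_0)] = \frac{8\pi b_{n,2}}{r}\, \Gamma\left(\frac{2n}{r}\right) \left(\frac{n\kappa_n r}{2\gamma c(n,r)}\right)^{\frac{2n}{r}} \int_0^\pi \int_0^1 \left(\frac{1}{F_r(t,\varphi)^{\frac{2n}{r}}} - \frac{1}{(t^r+1)^{\frac{2n}{r}}}\right) t^{n-1}(\sin \varphi)^{n-2}\,dt\,d\varphi. \]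
   Context: $V_n$ denotes $n$-dimensional volume, $S^{n-1}$ the unit sphere of $\mathbb{R}^n$, $\mathcal{H}^{n-1}$ the $(n-1)$-dimensional Hausdorff measure, $\kappa_n=\pi^{n/2}/\Gamma(\frac n2+1)$ the volume of the unit ball of $\mathbb{R}^n$, and $\omega_k=k\kappa_k=2\pi^{k/2}/\Gamma(\frac k2)$ for $k\in\mathbb{N}$. For $u\in S^{n-1}$, $t\ge 0$ let $H(u,t)=\{x\in\mathbb{R}^n:\langle x,u\rangle=t\}$. $A(n,n-1)$ is the space of affine hyperplanes of $\mathbb{R}^n$ with its standard topology and Borel $\sigma$-algebra. The Poisson hyperplane process $X$ in $\mathbb{R}^n$ with intensity $\gamma>0$ and distance exponent $r>0$ is the Poisson point process on $A(n,n-1)$ whose intensity measure $\Theta(\cdot)=\mathbb{E}X(\cdot)$ is \[ \Theta(\cdot)=\frac{2\gamma}{n\kappa_n}\int_{S^{n-1}}\int_0^\infty \mathbf{1}\{H(u,t)\in\cdot\}\,t^{r-1}\,dt\,\mathcal{H}^{n-1}(du). \] The zero cell is $Z_0=\bigcap_{H\in X}H^-$, where $H^-$ is the (almost surely unique) closed half-space bounded by $H$ that contains the origin. For $m\ge2$ and any unit vector $e\in S^{m-1}$, \[ c(m,r)=\int_{S^{m-1}}\langle e,u\rangle_+^r\,\mathcal{H}^{m-1}(du)=\pi^{\frac{m-1}{2}}\frac{\Gamma(\frac{r+1}{2})}{\Gamma(\frac{r+m}{2})}, \] which does not depend on $e$, where $x_+=\max\{x,0\}$. Moreover $b_{n,2}=\frac{\omega_{n-1}\omega_n}{4\pi}$,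 and for $(t,\varphi)\in[0,1]\times(0,\pi)$, \[ \alpha(t,\varphi)=\arctan\left(\frac{t-\cos\varphi}{\sin\varphi}\right)\in\left(-\frac\pi2,\frac\pi2\right), \] \[ F_r(t,\varphi)=\frac{1}{c(2,r)}\left(t^r\int_{-\frac\pi2}^{\alpha(t,\varphi)}(\cos\theta)^r\,d\theta+\int_{\alpha(t,\varphi)-\varphi}^{\frac\pi2}(\cos\theta)^r\,d\theta\right). \] *)

theory Defs
  imports "HOL-Probability.Probability"
begin

subsection \<open>Hausdorff measure\<close>

text \<open>
  The normalisation by the volume \<open>\<kappa>\<^sub>k\<close> of the \<open>k\<close>-dimensional unit ball is the one for which the
  \<open>k\<close>-dimensional Hausdorff measure on \<open>k\<close>-dimensional Euclidean space is Lebesgue measure.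
  Unbounded covering sets are excluded because \<^const>\<open>diameter\<close> is meaningful only for bounded sets;
  the case distinction on the empty set matters only for \<open>k = 0\<close>.
\<close>

definition hausdorff_content :: "nat \<Rightarrow> real \<Rightarrow> 'a::metric_space set \<Rightarrow> ennreal" where
  "hausdorff_content k \<delta> A =
     (INF U\<in>{U :: nat \<Rightarrow> 'a set. A \<subseteq> (\<Union>i. U i) \<and> (\<forall>i. bounded (U i) \<and> diameter (U i) \<le> \<delta>)}.
        \<Sum>i. if U i = {} then 0
            else ennreal (unit_ball_vol (real k) * (diameter (U i) / 2) ^ k))"

definition hausdorff_outer :: "nat \<Rightarrow> 'a::metric_space set \<Rightarrow> ennreal" where
  "hausdorff_outer k A = (SUP \<delta>\<in>{0<..}. hausdorff_content k \<delta> A)"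

definition hausdorff_measure :: "nat \<Rightarrow> 'a::metric_space measure" where
  "hausdorff_measure k = measure_of UNIV (sets borel) (hausdorff_outer k)"


subsection \<open>The space of affine hyperplanes\<close>

definition hyperplane :: "'a::euclidean_space \<Rightarrow> real \<Rightarrow> 'a set" where
  "hyperplane u t = {x. x \<bullet> u = t}"

definition hyperplanes :: "'a::euclidean_space set set" where
  "hyperplanes = {hyperplane u t | u t. norm u = 1}"

text \<open>
  The standard topology on the affine hyperplanes is the final topology with respect to the
  parametrisation of hyperplanes by unit normal vector and signed distance from the origin.
\<close>

definition hyperplane_topology :: "'a::euclidean_space set topology" where
  "hyperplane_topology = topology (\<lambda>\<U>. \<U> \<subseteq> hyperplanes \<and>
     openin (top_of_set (sphere 0 1 \<times> UNIV))
       {(u, t). u \<in> sphere 0 1 \<and> hyperplane u t \<in> \<U>})"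

lemma openin_hyperplane_topology:
  "openin hyperplane_topology \<U> \<longleftrightarrow> \<U> \<subseteq> hyperplanes \<and>
     openin (top_of_set (sphere 0 1 \<times> UNIV))
       {(u, t). u \<in> sphere (0 :: 'a::euclidean_space) 1 \<and> hyperplane u t \<in> \<U>}"
proof -
  let ?T = "top_of_set (sphere (0 :: 'a) 1 \<times> (UNIV :: real set))"
  let ?p = "\<lambda>\<U>. {(u, t). u \<in> sphere (0 :: 'a) 1 \<and> hyperplane u t \<in> \<U>}"
  have int: "?p (S \<inter> T) = ?p S \<inter> ?p T" for S T by auto
  have un: "?p (\<Union>\<K>) = \<Union>(?p ` \<K>)" for \<K> by auto
  have "istopology (\<lambda>\<U>. \<U> \<subseteq> hyperplanes \<and> openin ?T (?p \<U>))"
    unfolding istopology_def int un by (auto intro!: openin_Int openin_Union)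
  from topology_inverse'[OF this] show ?thesis
    unfolding hyperplane_topology_def by simp
qed

definition hyperplane_borel :: "'a::euclidean_space set measure" where
  "hyperplane_borel = sigma hyperplanes {\<U>. openin hyperplane_topology \<U>}"


subsection \<open>Poisson processes of hyperplanes\<close>

text \<open>
  A point process is a random locally finite counting measure, i.e. one whose values lie in
  \<open>{0, 1, 2, \<dots>, \<infinity>}\<close> and are finite on compact sets.
\<close>

definition hyperplane_process :: "'w measure \<Rightarrow> ('w \<Rightarrow> 'a::euclidean_space set measure) \<Rightarrow> bool" where
  "hyperplane_process M X \<longleftrightarrow>
     (\<forall>\<omega>\<in>space M. sets (X \<omega>) = sets hyperplane_borel \<and>
        (\<forall>B\<in>sets hyperplane_borel. emeasure (X \<omega>) B \<in> range ennreal_of_enat) \<and>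
        (\<forall>K. compactin hyperplane_topology K \<longrightarrow> emeasure (X \<omega>) K < \<infinity>)) \<and>
     (\<forall>B\<in>sets hyperplane_borel. (\<lambda>\<omega>. emeasure (X \<omega>) B) \<in> borel_measurable M)"

definition poisson_hyperplane_process ::
    "'w measure \<Rightarrow> ('w \<Rightarrow> 'a::euclidean_space set measure) \<Rightarrow> ('a set set \<Rightarrow> ennreal) \<Rightarrow> bool" where
  "poisson_hyperplane_process M X \<Theta> \<longleftrightarrow>
     prob_space M \<and> hyperplane_process M X \<and>
     (\<forall>B\<in>sets hyperplane_borel. (\<integral>\<^sup>+\<omega>. emeasure (X \<omega>) B \<partial>M) = \<Theta> B) \<and>
     (\<forall>B\<in>sets hyperplane_borel. \<Theta> B < \<infinity> \<longrightarrow>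
        (\<forall>k::nat. measure M {\<omega>\<in>space M. emeasure (X \<omega>) B = of_nat k} =
           enn2real (\<Theta> B) ^ k / fact k * exp (- enn2real (\<Theta> B)))) \<and>
     (\<forall>(m::nat) B. B ` {..<m} \<subseteq> sets hyperplane_borel \<and> disjoint_family_on B {..<m} \<longrightarrow>
        prob_space.indep_vars M (\<lambda>_. borel) (\<lambda>i \<omega>. emeasure (X \<omega>) (B i)) {..<m})"

definition hyperplane_intensity :: "real \<Rightarrow> real \<Rightarrow> 'a::euclidean_space set set \<Rightarrow> ennreal" where
  "hyperplane_intensity \<gamma> r B =
     ennreal (2 * \<gamma> / (real DIM('a) * unit_ball_vol (real DIM('a)))) *
     (\<integral>\<^sup>+ u\<in>sphere (0 :: 'a) 1.
        (\<integral>\<^sup>+ t\<in>{0..}. indicator B (hyperplane u t) * ennreal (t powr (r - 1)) \<partial>lborel)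
      \<partial>hausdorff_measure (DIM('a) - 1))"


subsection \<open>The zero cell\<close>

text \<open>
  The closed half-spaces containing the origin and bounded by a given hyperplane: this set is a
  singleton unless the hyperplane passes through the origin, in which case (almost surely
  irrelevant for the processes considered) it has two elements, and the zero cell uses both.
\<close>

definition zero_halfspaces :: "'a::euclidean_space set \<Rightarrow> 'a set set" where
  "zero_halfspaces H = {{x. x \<bullet> u \<le> t} | u t. norm u = 1 \<and> H = hyperplane u t \<and> 0 \<le> t}"

definition zero_cell :: "'a::euclidean_space set measure \<Rightarrow> 'a set" where
  "zero_cell \<xi> = \<Inter>(\<Union>H\<in>{H \<in> hyperplanes. emeasure \<xi> {H} > 0}. zero_halfspaces H)"


subsection \<open>Constants and auxiliary functions\<close>

definition sphere_area :: "nat \<Rightarrow> real" where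
  "sphere_area k = real k * unit_ball_vol (real k)"

definition b2 :: "nat \<Rightarrow> real" where
  "b2 n = sphere_area (n - 1) * sphere_area n / (4 * pi)"

text \<open>
  \<open>c(m,r)\<close> for \<open>m\<close> the dimension of the type \<open>'a\<close>. By rotation invariance, the integral does not
  depend on the unit vector \<open>e\<close>.
\<close>

definition c_const :: "'a::euclidean_space itself \<Rightarrow> real \<Rightarrow> real" where
  "c_const _ r = (let e = (SOME e :: 'a. norm e = 1) in
     LINT u:sphere 0 1|hausdorff_measure (DIM('a) - 1). (max (e \<bullet> u) 0) powr r)"

definition alpha :: "real \<Rightarrow> real \<Rightarrow> real" where
  "alpha t \<phi> = arctan ((t - cos \<phi>) / sin \<phi>)"

definition F :: "real \<Rightarrow> real \<Rightarrow> real \<Rightarrow> real" where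
  "F r t \<phi> = 1 / c_const TYPE(real^2) r *
     (t powr r * (LBINT \<theta>:{- (pi / 2)..alpha t \<phi>}. cos \<theta> powr r) +
      (LBINT \<theta>:{alpha t \<phi> - \<phi>..pi / 2}. cos \<theta> powr r))"

end

theory Submission
  imports Defs
begin

text \<open>
  By Fubini, the second moment of the volume of the zero cell \<open>Z\<close> is the integral over all pairs
  \<open>(x, y)\<close> of the probability that both points lie in \<open>Z\<close>. This is the probability that no hyperplane
  of the process separates the origin from \<open>x\<close> or from \<open>y\<close>, hence \<open>exp (- \<Theta>)\<close>, where \<open>\<Theta>\<close> is a constant
  times the integral of \<open>max (max (x \<bullet> u) (y \<bullet> u)) 0 powr r\<close> over the unit sphere. The integrand depends only
  on the projection of \<open>u\<close> to the plane spanned by \<open>x\<close> and \<open>y\<close>, so averaging over the rotations of that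
  plane turns the integral into one over a circle, and this one is \<open>norm y powr r * F\<close> up to the
  normalisation. In polar coordinates, with \<open>y\<close> as the longer vector and \<open>norm x = t * norm y\<close>, the
  integration over \<open>norm y\<close> is a Gamma integral. The square of the mean volume is a pair integral of
  the same shape with \<open>t powr r + 1\<close> in place of \<open>F\<close>.
\<close>

text \<open>Two facts make the Hausdorff measure a subject of its own. \<open>measure_of\<close>
  returns the given set function only where it is a measure, so Borel sets must be shown
  Caratheodory measurable before an integral over the sphere has content. And F is normalised by
  c(2,r), an integral over the circle in the plane, so the length 2*pi of the circle has to be
  computed exactly. In dimension n the sphere measure enters through rotation invariance, finiteness
  and positivity: averaging over the rotations of a plane leaves an unevaluated radial factor, which
  occurs in c(n,r) as well and thereby cancels. Polar coordinates come from ball volumes and the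
  distance to an axis, which produces sphere areas in the form in which \<open>sphere_area\<close>
  defines them. A process is an integer-valued random measure, whereas the zero cell is cut out by
  its atoms. Since every set of finite nonzero mass contains an atom, membership in the cell becomes
  a counting event. The bound F >= 1 keeps the iterated integrals finite, so that the variance is a
  genuine difference of real numbers.\<close>

subsection \<open>Hausdorff measure on Borel sets\<close>

text \<open>
  Giving inadmissible covering sets the weight \<open>\<top>\<close> makes the Hausdorff content an instance of
  \<^const>\<open>outer_measure\<close>.
\<close>

definition hausdorff_gauge :: "nat \<Rightarrow> real \<Rightarrow> 'a::metric_space set \<Rightarrow> ennreal" where
  "hausdorff_gauge k \<delta> U = (if U = {} then 0
     else if bounded U \<and> diameter U \<le> \<delta> then ennreal (unit_ball_vol (real k) * (diameter U / 2) ^ k)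
     else \<top>)"

lemma positive_hausdorff_gauge: "positive (Pow UNIV) (hausdorff_gauge k \<delta>)"
  by (simp add: positive_def hausdorff_gauge_def)

lemma increasing_hausdorff_gauge: "increasing (Pow UNIV) (hausdorff_gauge k \<delta>)"
  unfolding increasing_def
proof (intro ballI impI)
  fix A B :: "'a set" assume AB: "A \<subseteq> B"
  show "hausdorff_gauge k \<delta> A \<le> hausdorff_gauge k \<delta> B"
  proof (cases "A = {} \<or> \<not> (bounded B \<and> diameter B \<le> \<delta>)")
    case True
    then show ?thesis using AB by (auto simp: hausdorff_gauge_def)
  next
    case False
    have bA: "bounded A" using False AB bounded_subset by blast
    have d: "diameter A \<le> diameter B" using False AB by (intro diameter_subset) auto
    show ?thesis using False AB bA d diameter_ge_0[OF bA]
      by (auto simp: hausdorff_gauge_def intro!: ennreal_leI mult_left_mono power_mono unit_ball_vol_nonneg)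
  qed
qed

text \<open>\<open>outer_measure\<close> is an infimum over disjoint covers. As the gauge is
  increasing, arbitrary covers still bound it from above; conversely a disjoint cover is either
  admissible or contains a piece of weight \<top>, which makes the bound trivial. Positivity of
  \<delta> makes empty pieces admissible, their diameter being 0.\<close>

lemma hausdorff_content_eq:
  assumes "\<delta> > 0"
  shows "hausdorff_content k \<delta> A = outer_measure (Pow UNIV) (hausdorff_gauge k \<delta>) A"
proof (rule antisym)
  interpret algebra "UNIV :: 'a set" "Pow UNIV" by (rule algebra_Pow)
  show "outer_measure (Pow UNIV) (hausdorff_gauge k \<delta>) A \<le> hausdorff_content k \<delta> A"
    unfolding hausdorff_content_def
  proof (rule INF_greatest)
    fix U :: "nat \<Rightarrow> 'a set"
    assume U: "U \<in> {U. A \<subseteq> (\<Union>i. U i) \<and> (\<forall>i. bounded (U i) \<and> diameter (U i) \<le> \<delta>)}"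
    have "outer_measure (Pow UNIV) (hausdorff_gauge k \<delta>) A \<le> (\<Sum>i. hausdorff_gauge k \<delta> (U i))"
      using U by (intro outer_measure_le positive_hausdorff_gauge increasing_hausdorff_gauge) auto
    also have "\<dots> = (\<Sum>i. if U i = {} then 0 else ennreal (unit_ball_vol (real k) * (diameter (U i) / 2) ^ k))"
      using U by (auto simp: hausdorff_gauge_def cong: if_cong)
    finally show "outer_measure (Pow UNIV) (hausdorff_gauge k \<delta>) A
      \<le> (\<Sum>i. if U i = {} then 0 else ennreal (unit_ball_vol (real k) * (diameter (U i) / 2) ^ k))" .
  qed
  show "hausdorff_content k \<delta> A \<le> outer_measure (Pow UNIV) (hausdorff_gauge k \<delta>) A"
    unfolding outer_measure_def
  proof (rule INF_greatest)
    fix U :: "nat \<Rightarrow> 'a set"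
    assume U: "U \<in> {U. range U \<subseteq> Pow UNIV \<and> disjoint_family U \<and> A \<subseteq> (\<Union>i. U i)}"
    show "hausdorff_content k \<delta> A \<le> (\<Sum>i. hausdorff_gauge k \<delta> (U i))"
    proof (cases "\<exists>i. hausdorff_gauge k \<delta> (U i) = \<top>")
      case True
      then obtain i where "hausdorff_gauge k \<delta> (U i) = \<top>" by blast
      then have "(\<Sum>i. hausdorff_gauge k \<delta> (U i)) = \<top>"
        using sum_le_suminf[of "\<lambda>i. hausdorff_gauge k \<delta> (U i)" "{i}"] by (simp add: top_unique)
      then show ?thesis by simp
    next
      case False
      have ok: "bounded (U i) \<and> diameter (U i) \<le> \<delta>" for i
        using False assms by (cases "U i = {}") (auto simp: hausdorff_gauge_def split: if_splits)
      have "hausdorff_content k \<delta> A \<le> (\<Sum>i. if U i = {} then 0 else ennreal (unit_ball_vol (real k) * (diameter (U i) / 2) ^ k))"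
        unfolding hausdorff_content_def using ok U by (intro INF_lower) auto
      also have "\<dots> = (\<Sum>i. hausdorff_gauge k \<delta> (U i))"
        using ok by (intro suminf_cong) (auto simp: hausdorff_gauge_def)
      finally show ?thesis .
    qed
  qed
qed

lemma hausdorff_outer_eq:
  "hausdorff_outer k A = (SUP \<delta>\<in>{0<..}. outer_measure (Pow UNIV) (hausdorff_gauge k \<delta>) A)"
  unfolding hausdorff_outer_def by (intro SUP_cong refl hausdorff_content_eq) auto

text \<open>The three axioms hold at each scale \<delta> and pass to the supremum: for
  subadditivity, the right-hand side at scale \<delta> is already bounded termwise by the
  supremum.\<close>

lemma outer_measure_space_hausdorff: "outer_measure_space (Pow UNIV) (hausdorff_outer k)"
proof -
  interpret algebra "UNIV :: 'a set" "Pow UNIV" by (rule algebra_Pow)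
  let ?o = "\<lambda>\<delta>. outer_measure (Pow (UNIV :: 'a set)) (hausdorff_gauge k \<delta>)"
  have o: "outer_measure_space (Pow UNIV) (?o \<delta>)" for \<delta>
    by (intro outer_measure_space_outer_measure positive_hausdorff_gauge increasing_hausdorff_gauge)
  have 1: "positive (Pow UNIV) (hausdorff_outer k :: 'a set \<Rightarrow> _)"
    using o unfolding outer_measure_space_def positive_def hausdorff_outer_eq by auto
  have 2: "increasing (Pow UNIV) (hausdorff_outer k :: 'a set \<Rightarrow> _)"
    using o unfolding outer_measure_space_def increasing_def hausdorff_outer_eq
    by (auto intro!: SUP_mono')
  have 3: "countably_subadditive (Pow UNIV) (hausdorff_outer k :: 'a set \<Rightarrow> _)"
    unfolding countably_subadditive_def
  proof (intro allI impI)
    fix A :: "nat \<Rightarrow> 'a set" assume A: "range A \<subseteq> Pow UNIV" "disjoint_family A" "\<Union>(range A) \<in> Pow UNIV"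
    show "hausdorff_outer k (\<Union>i. A i) \<le> (\<Sum>i. hausdorff_outer k (A i))"
      unfolding hausdorff_outer_eq[of k "\<Union>i. A i"]
    proof (rule SUP_least)
      fix \<delta> :: real assume d: "\<delta> \<in> {0<..}"
      have "?o \<delta> (\<Union>i. A i) \<le> (\<Sum>i. ?o \<delta> (A i))"
        using o[of \<delta>] A unfolding outer_measure_space_def countably_subadditive_def by blast
      also have "\<dots> \<le> (\<Sum>i. hausdorff_outer k (A i))"
        using d by (intro suminf_le) (auto simp: hausdorff_outer_eq intro: SUP_upper)
      finally show "?o \<delta> (\<Union>i. A i) \<le> (\<Sum>i. hausdorff_outer k (A i))" .
    qed
  qed
  show ?thesis using 1 2 3 by (simp add: outer_measure_space_def)
qed

lemma hausdorff_outer_mono: "A \<subseteq> B \<Longrightarrow> hausdorff_outer k A \<le> hausdorff_outer k B"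
  using outer_measure_space_hausdorff[of k] by (auto simp: outer_measure_space_def increasing_def)

lemma hausdorff_outer_empty [simp]: "hausdorff_outer k {} = 0"
  using outer_measure_space_hausdorff[of k] by (auto simp: outer_measure_space_def positive_def)

text \<open>\<open>countably_subadditive\<close> speaks of disjoint families only;
  \<open>disjointed\<close> and monotonicity remove that restriction.\<close>

lemma hausdorff_outer_UN_le: "hausdorff_outer k (\<Union>i. A i) \<le> (\<Sum>i. hausdorff_outer k (A i))"
  for A :: "nat \<Rightarrow> 'a::metric_space set"
proof -
  have "hausdorff_outer k (\<Union>i. A i) = hausdorff_outer k (\<Union>i. disjointed A i)"
    by (simp add: UN_disjointed_eq)
  also have "\<dots> \<le> (\<Sum>i. hausdorff_outer k (disjointed A i))"
    using outer_measure_space_hausdorff[of k, where 'a='a] disjoint_family_disjointed[of A]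
    unfolding outer_measure_space_def countably_subadditive_def by blast
  also have "\<dots> \<le> (\<Sum>i. hausdorff_outer k (A i))"
    by (intro suminf_le hausdorff_outer_mono disjointed_subset) auto
  finally show ?thesis .
qed

lemma hausdorff_outer_Un_le: "hausdorff_outer k (A \<union> B) \<le> hausdorff_outer k A + hausdorff_outer k B"
proof -
  have "subadditive (Pow UNIV) (hausdorff_outer k :: 'a set \<Rightarrow> _)"
    using outer_measure_space_hausdorff[of k, where 'a='a] algebra.axioms(1)[OF algebra_Pow]
    by (metis outer_measure_space_def ring_of_sets.countably_subadditive_subadditive)
  then have "hausdorff_outer k (A \<union> (B - A)) \<le> hausdorff_outer k A + hausdorff_outer k (B - A)"
    unfolding subadditive_def by (metis Diff_disjoint Pow_UNIV UNIV_I)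
  also have "\<dots> \<le> hausdorff_outer k A + hausdorff_outer k B"
    by (intro add_mono hausdorff_outer_mono) auto
  finally show ?thesis by simp
qed

section \<open>Additivity on separated sets and Caratheodory measurability\<close>

lemma hausdorff_content_antimono:
  "0 < \<delta> \<Longrightarrow> \<delta> \<le> \<delta>' \<Longrightarrow> hausdorff_content k \<delta>' A \<le> hausdorff_content k \<delta> A"
  unfolding hausdorff_content_def by (intro INF_superset_mono) (auto intro: order_trans)

text \<open>A set of diameter below \<open>d\<close> cannot meet both \<open>A\<close> and
  \<open>B\<close>, so a cover of the union splits into a cover of \<open>A\<close> and one of
  \<open>B\<close> without using any set twice.\<close>

lemma hausdorff_content_separated:
  assumes d: "0 < \<delta>" "\<delta> < d" and sep: "\<And>x y. x \<in> A \<Longrightarrow> y \<in> B \<Longrightarrow> d \<le> dist x y"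
  shows "hausdorff_content k \<delta> A + hausdorff_content k \<delta> B \<le> hausdorff_content k \<delta> (A \<union> B)"
  unfolding hausdorff_content_def[of k \<delta> "A \<union> B"]
proof (rule INF_greatest)
  fix U :: "nat \<Rightarrow> 'a set"
  assume "U \<in> {U. A \<union> B \<subseteq> (\<Union>i. U i) \<and> (\<forall>i. bounded (U i) \<and> diameter (U i) \<le> \<delta>)}"
  then have U: "A \<subseteq> (\<Union>i. U i)" "B \<subseteq> (\<Union>i. U i)" "\<And>i. bounded (U i)" "\<And>i. diameter (U i) \<le> \<delta>" by auto
  define g where "g V = (if V = {} then 0 else ennreal (unit_ball_vol (real k) * (diameter V / 2) ^ k))" for V :: "'a set"
  \<comment> \<open>Sets that miss \<open>C\<close> are replaced by the empty set, which has weight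
    0, so that the index set stays the natural numbers.\<close>
  define P where "P C i = (if U i \<inter> C = {} then {} else U i)" for C i
  have P: "hausdorff_content k \<delta> C \<le> (\<Sum>i. g (P C i))" if "C \<subseteq> (\<Union>i. U i)" for C
    unfolding hausdorff_content_def g_def
  proof (rule INF_lower)
    show "P C \<in> {U. C \<subseteq> (\<Union>i. U i) \<and> (\<forall>i. bounded (U i) \<and> diameter (U i) \<le> \<delta>)}"
      using that U d by (auto simp: P_def) blast
  qed
  have "g (P A i) + g (P B i) \<le> g (U i)" for i
  proof (cases "U i \<inter> A = {} \<or> U i \<inter> B = {}")
    case True then show ?thesis by (auto simp: P_def g_def)
  next
    case False
    then obtain x y where "x \<in> U i" "y \<in> U i" "x \<in> A" "y \<in> B" by blast
    then have "d \<le> \<delta>" using sep diameter_bounded_bound[OF U(3)] U(4)[of i] by (meson order_trans)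
    then show ?thesis using d by simp
  qed
  then have "(\<Sum>i. g (P A i)) + (\<Sum>i. g (P B i)) \<le> (\<Sum>i. g (U i))"
    by (subst suminf_add) (auto intro!: suminf_le)
  with P[OF U(1)] P[OF U(2)] show "hausdorff_content k \<delta> A + hausdorff_content k \<delta> B
      \<le> (\<Sum>i. if U i = {} then 0 else ennreal (unit_ball_vol (real k) * (diameter (U i) / 2) ^ k))"
    unfolding g_def by (meson add_mono order_trans)
qed

text \<open>The defining property of a metric outer measure. Given scales \<delta> and \<delta>' for
  the two sets, a common scale below both and below \<open>d\<close> increases both contents, so the
  suprema can be taken one after the other.\<close>

lemma hausdorff_outer_separated:
  assumes d: "0 < d" and sep: "\<And>x y. x \<in> A \<Longrightarrow> y \<in> B \<Longrightarrow> d \<le> dist x y"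
  shows "hausdorff_outer k A + hausdorff_outer k B \<le> hausdorff_outer k (A \<union> B)"
proof -
  have *: "hausdorff_content k \<delta> A + hausdorff_content k \<delta>' B \<le> hausdorff_outer k (A \<union> B)"
    if "\<delta> > 0" "\<delta>' > 0" for \<delta> \<delta>'
  proof -
    define e where "e = min (min \<delta> \<delta>') (d / 2)"
    have e: "0 < e" "e \<le> \<delta>" "e \<le> \<delta>'" "e < d" using that d by (auto simp: e_def)
    have "hausdorff_content k \<delta> A + hausdorff_content k \<delta>' B \<le> hausdorff_content k e A + hausdorff_content k e B"
      using e by (intro add_mono hausdorff_content_antimono)
    also have "\<dots> \<le> hausdorff_content k e (A \<union> B)"
      using e sep by (intro hausdorff_content_separated)
    also have "\<dots> \<le> hausdorff_outer k (A \<union> B)"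
      unfolding hausdorff_outer_def using e by (intro SUP_upper) auto
    finally show ?thesis .
  qed
  have "hausdorff_outer k A + hausdorff_content k \<delta>' B \<le> hausdorff_outer k (A \<union> B)" if "\<delta>' > 0" for \<delta>'
    unfolding hausdorff_outer_def[of k A]
    by (subst ennreal_SUP_add_left[symmetric]) (auto intro!: SUP_least * that)
  then show ?thesis
    unfolding hausdorff_outer_def[of k B]
    by (subst ennreal_SUP_add_right) (auto intro!: SUP_least)
qed

lemma closed_hausdorff_measurable:
  assumes C: "closed C"
  shows "hausdorff_outer k (A \<inter> C) + hausdorff_outer k (A - C) \<le> hausdorff_outer k A"
proof (cases "C = {} \<or> hausdorff_outer k A = \<top>")
  case True then show ?thesis by auto
next
  case False
  then have ne: "C \<noteq> {}" and fin: "hausdorff_outer k A \<noteq> \<top>" by auto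
  let ?h = "hausdorff_outer k"
  txt \<open>
    The sets \<open>S n\<close> exhaust \<open>A - C\<close> and have positive distance from \<open>C\<close>. The layers \<open>R n\<close> between
    them have positive distance from each other as soon as their indices differ by two, so both the
    even and the odd ones have summable measure.
  \<close>
  define S where "S n = {x \<in> A. infdist x C \<ge> 1 / real (Suc n)}" for n
  define R where "R n = S (Suc n) - S n" for n
  have dist: "dist x y \<ge> infdist x C - infdist y C" for x y
    using infdist_triangle[of x C y] by (simp add: dist_commute)
  have mainn: "?h (A \<inter> C) + ?h (S n) \<le> ?h A" for n
  proof -
    have "?h (A \<inter> C) + ?h (S n) \<le> ?h ((A \<inter> C) \<union> S n)"
    proof (rule hausdorff_outer_separated[of "1 / real (Suc n)"])
      fix x y assume "x \<in> A \<inter> C" "y \<in> S n"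
      then have "infdist x C = 0" "infdist y C \<ge> 1 / real (Suc n)" by (auto simp: S_def)
      then show "1 / real (Suc n) \<le> dist x y" using dist[of y x] by (simp add: dist_commute)
    qed auto
    also have "\<dots> \<le> ?h A" by (intro hausdorff_outer_mono) (auto simp: S_def)
    finally show ?thesis .
  qed
  have par: "(\<Sum>j<N. ?h (R (2 * j + p))) \<le> ?h (\<Union>j<N. R (2 * j + p))" for N p
  proof (induction N)
    case (Suc N)
    define d where "d = (if N = 0 then 1 else 1 / real (2 * N + p) - 1 / real (Suc (2 * N + p)))"
    have "1 / real (Suc (2 * N + p)) < 1 / real (2 * N + p)" if "N > 0"
      using that by (intro divide_strict_left_mono) auto
    then have d: "d > 0" unfolding d_def by (cases "N = 0") auto
    have "(\<Sum>j<Suc N. ?h (R (2 * j + p))) \<le> ?h (\<Union>j<N. R (2 * j + p)) + ?h (R (2 * N + p))"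
      using Suc by (auto intro: add_right_mono)
    also have "\<dots> \<le> ?h ((\<Union>j<N. R (2 * j + p)) \<union> R (2 * N + p))"
    proof (rule hausdorff_outer_separated[OF d])
      fix x y assume x: "x \<in> (\<Union>j<N. R (2 * j + p))" and y: "y \<in> R (2 * N + p)"
      obtain j where j: "j < N" "x \<in> R (2 * j + p)" using x by auto
      have "infdist x C \<ge> 1 / real (Suc (Suc (2 * j + p)))" using j by (auto simp: R_def S_def)
      moreover have "1 / real (Suc (Suc (2 * j + p))) \<ge> 1 / real (2 * N + p)"
        using j by (intro divide_left_mono) auto
      moreover have "infdist y C < 1 / real (Suc (2 * N + p))" using y by (auto simp: R_def S_def)
      ultimately show "d \<le> dist x y" using dist[of x y] j by (auto simp: d_def)
    qed
    also have "(\<Union>j<N. R (2 * j + p)) \<union> R (2 * N + p) = (\<Union>j<Suc N. R (2 * j + p))"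
      by (auto simp: less_Suc_eq)
    finally show ?case .
  qed auto
  have par': "(\<Sum>j<N. ?h (R (2 * j + p))) \<le> ?h A" for N p
    by (rule order_trans[OF par hausdorff_outer_mono]) (auto simp: R_def S_def)
  have part: "(\<Sum>j<N. ?h (R j)) \<le> ?h A + ?h A" for N
  proof -
    have "(\<Sum>j<N. ?h (R j)) \<le> (\<Sum>j<2 * N. ?h (R j))" by (intro sum_mono2) auto
    also have "\<dots> = (\<Sum>j<N. ?h (R (2 * j + 0))) + (\<Sum>j<N. ?h (R (2 * j + 1)))"
      by (induction N) (auto simp: algebra_simps)
    also have "\<dots> \<le> ?h A + ?h A" by (intro add_mono par')
    finally show ?thesis .
  qed
  have sumfin: "(\<Sum>j. ?h (R j)) < \<top>"
  proof -
    have "(\<Sum>j. ?h (R j)) \<le> ?h A + ?h A" using part by (intro suminf_le_const) auto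
    also have "\<dots> < \<top>" using fin by (simp add: less_top)
    finally show ?thesis .
  qed
  define a where "a j = enn2real (?h (R j))" for j
  have hR: "?h (R j) = ennreal (a j)" for j
    using ennreal_suminf_lessD[OF sumfin, of j] by (simp add: a_def)
  have a0: "a j \<ge> 0" for j by (simp add: a_def)
  have suma: "summable a"
    using sumfin by (intro summable_suminf_not_top) (auto simp: hR a0)
  \<comment> \<open>The layers beyond \<open>n\<close> contribute only the tail of a convergent
    series, so the loss in replacing \<open>A - C\<close> by \<open>S n\<close> is arbitrarily
    small.\<close>
  have cover: "?h (A - C) \<le> ?h (S n) + ennreal (\<Sum>j. a (j + n))" for n
  proof -
    have "A - C \<subseteq> S n \<union> (\<Union>j. R (j + n))"
    proof
      fix x assume x: "x \<in> A - C"
      \<comment> \<open>Closedness of \<open>C\<close> enters here: a point outside has positive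
        distance from it and hence lies in some \<open>S m\<close>.\<close>
      then have pos: "infdist x C > 0" using C ne
        by (metis DiffD2 in_closed_iff_infdist_zero infdist_nonneg less_eq_real_def)
      then obtain m where m: "1 / real (Suc m) < infdist x C"
        using nat_approx_posE by blast
      have ex: "\<exists>m. x \<in> S m" using m x by (auto simp: S_def intro!: exI[of _ m])
      define m0 where "m0 = (LEAST m. x \<in> S m)"
      have m0: "x \<in> S m0" "\<And>i. i < m0 \<Longrightarrow> x \<notin> S i"
        using ex unfolding m0_def by (auto intro: LeastI dest: not_less_Least)
      have mono: "S i \<subseteq> S j" if "i \<le> j" for i j
      proof -
        have "1 / real (Suc j) \<le> 1 / real (Suc i)" using that by (intro divide_left_mono) auto
        then show ?thesis unfolding S_def by auto
      qed
      show "x \<in> S n \<union> (\<Union>j. R (j + n))"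
      proof (cases "m0 \<le> n")
        case True then show ?thesis using m0 mono by auto
      next
        case False
        \<comment> \<open>As \<open>m0\<close> is the least index with \<open>x\<close> in
          \<open>S m0\<close> and exceeds \<open>n\<close>, the point lies in layer
          \<open>m0 - 1\<close>, written in the shifted form \<open>j + n\<close>.\<close>
        then have "x \<in> R ((m0 - 1 - n) + n)" using m0 by (auto simp: R_def)
        then show ?thesis by blast
      qed
    qed
    then have "?h (A - C) \<le> ?h (S n \<union> (\<Union>j. R (j + n)))" by (rule hausdorff_outer_mono)
    also have "\<dots> \<le> ?h (S n) + (\<Sum>j. ?h (R (j + n)))"
      by (rule order_trans[OF hausdorff_outer_Un_le add_left_mono[OF hausdorff_outer_UN_le]])
    also have "(\<Sum>j. ?h (R (j + n))) = ennreal (\<Sum>j. a (j + n))"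
      unfolding hR using suma a0 by (intro suminf_ennreal2) (auto intro: summable_ignore_initial_segment)
    finally show ?thesis .
  qed
  show ?thesis
  proof (rule ennreal_le_epsilon)
    fix e :: real assume "0 < e"
    from suminf_exist_split[OF this suma] obtain N where "norm (\<Sum>i. a (i + N)) < e" by blast
    then have N: "(\<Sum>i. a (i + N)) \<le> e" by simp
    have "?h (A \<inter> C) + ?h (A - C) \<le> ?h (A \<inter> C) + (?h (S N) + ennreal (\<Sum>j. a (j + N)))"
      by (intro add_left_mono cover)
    also have "\<dots> = (?h (A \<inter> C) + ?h (S N)) + ennreal (\<Sum>j. a (j + N))" by (simp add: add.assoc)
    also have "\<dots> \<le> ?h A + ennreal e" using N by (intro add_mono mainn ennreal_leI)
    finally show "?h (A \<inter> C) + ?h (A - C) \<le> ?h A + ennreal e" .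
  qed
qed

lemma sets_hausdorff_measure [simp, measurable_cong]: "sets (hausdorff_measure k) = sets borel"
  by (simp add: hausdorff_measure_def sets.sigma_sets_eq[of borel, simplified])

lemma space_hausdorff_measure [simp]: "space (hausdorff_measure k) = UNIV"
  by (simp add: hausdorff_measure_def)

text \<open>\<open>measure_of\<close> yields the outer measure only after countable additivity on
  Borel sets is known. Caratheodory's theorem gives it on the lambda system, which contains the
  closed sets and hence the sigma-algebra they generate.\<close>

proposition emeasure_hausdorff_measure:
  assumes "A \<in> sets borel"
  shows "emeasure (hausdorff_measure k) A = hausdorff_outer k A"
proof -
  interpret P: sigma_algebra "UNIV :: 'a set" "Pow UNIV" by (rule sigma_algebra_Pow)
  let ?L = "lambda_system (UNIV :: 'a set) (Pow UNIV) (hausdorff_outer k)"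
  have ms: "measure_space UNIV ?L (hausdorff_outer k)"
    by (rule P.caratheodory_lemma[OF outer_measure_space_hausdorff])
  then have sa: "sigma_algebra UNIV ?L" by (simp add: measure_space_def)
  have cl: "C \<in> ?L" if "closed C" for C
    unfolding P.lambda_system_eq
  proof (intro CollectI conjI ballI)
    fix A :: "'a set"
    show "hausdorff_outer k (A \<inter> C) + hausdorff_outer k (A - C) = hausdorff_outer k A"
      using closed_hausdorff_measurable[OF that, of k A] hausdorff_outer_Un_le[of k "A \<inter> C" "A - C"]
      by (simp add: Int_Diff_Un antisym)
  qed auto
  have bor: "sets (borel :: 'a measure) = sigma_sets UNIV (Collect closed)"
    by (subst borel_eq_closed) simp
  have sub: "sets borel \<subseteq> ?L"
    unfolding bor by (rule sigma_algebra.sigma_sets_subset[OF sa]) (use cl in blast)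
  have "measure_space UNIV (sets borel) (hausdorff_outer k :: 'a set \<Rightarrow> _)"
    by (rule measure_down[OF ms _ sub]) (metis sets.sigma_algebra_axioms space_borel)
  then have "emeasure (measure_of UNIV (sets borel) (hausdorff_outer k)) A = hausdorff_outer k A"
    using assms by (intro emeasure_measure_of_sigma) (auto simp: measure_space_def)
  then show ?thesis by (simp add: hausdorff_measure_def)
qed

subsection \<open>Hausdorff measure of the sphere\<close>

lemma ennreal_le_mult_INF:
  fixes f :: "'b \<Rightarrow> ennreal"
  assumes c: "c > 0" and le: "\<And>x. x \<in> S \<Longrightarrow> a \<le> ennreal c * f x"
  shows "a \<le> ennreal c * (INF x\<in>S. f x)"
proof -
  have inv: "ennreal (1 / c) * (ennreal c * y) = y" "ennreal c * (ennreal (1 / c) * y) = y" for y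
    using c by (simp_all add: mult.assoc[symmetric] ennreal_mult[symmetric])
  have "ennreal (1 / c) * a \<le> f x" if "x \<in> S" for x
    using mult_left_mono[OF le[OF that], of "ennreal (1 / c)"] by (simp add: inv)
  then have "ennreal (1 / c) * a \<le> (INF x\<in>S. f x)" by (intro INF_greatest)
  from mult_left_mono[OF this, of "ennreal c"] show ?thesis by (simp add: inv)
qed

lemma diameter_image_le:
  assumes "\<And>x y. x \<in> U \<Longrightarrow> y \<in> U \<Longrightarrow> dist (f x) (f y) \<le> L * dist x y" "L \<ge> 0" "bounded U"
  shows "diameter (f ` U) \<le> L * diameter U" "bounded (f ` U)"
proof -
  have *: "dist (f x) (f y) \<le> L * diameter U" if "x \<in> U" "y \<in> U" for x y
    using assms(1)[OF that] mult_left_mono[OF diameter_bounded_bound[OF assms(3) that] assms(2)] by linarith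
  show "bounded (f ` U)"
  proof (cases "U = {}")
    case False
    then obtain x where "x \<in> U" by blast
    then show ?thesis unfolding bounded_def using * by (intro exI[of _ "f x"] exI[of _ "L * diameter U"]) auto
  qed auto
  show "diameter (f ` U) \<le> L * diameter U"
  proof (cases "U = {}")
    case False
    then show ?thesis unfolding diameter_def[of "f ` U"] using * by (auto intro!: cSUP_least)
  qed auto
qed

text \<open>The images of a cover at scale \<open>\<delta> / L\<close> form a cover at scale
  \<delta>, and each weight grows by at most \<open>L ^ k\<close>. Letting \<delta> tend to 0
  absorbs the change of scale.\<close>

lemma hausdorff_outer_lipschitz_image:
  fixes f :: "'a::metric_space \<Rightarrow> 'b::metric_space"
  assumes L: "L > 0" and lip: "\<And>x y. x \<in> A \<Longrightarrow> y \<in> A \<Longrightarrow> dist (f x) (f y) \<le> L * dist x y"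
  shows "hausdorff_outer k (f ` A) \<le> ennreal (L ^ k) * hausdorff_outer k A"
proof -
  let ?g = "\<lambda>V. if V = {} then 0 else ennreal (unit_ball_vol (real k) * (diameter V / 2) ^ k)"
  have content: "hausdorff_content k \<delta> (f ` A) \<le> ennreal (L ^ k) * hausdorff_content k (\<delta> / L) A" if "\<delta> > 0" for \<delta>
    unfolding hausdorff_content_def[of k "\<delta> / L" A]
  proof (rule ennreal_le_mult_INF)
    fix U :: "nat \<Rightarrow> 'a set"
    assume "U \<in> {U. A \<subseteq> (\<Union>i. U i) \<and> (\<forall>i. bounded (U i) \<and> diameter (U i) \<le> \<delta> / L)}"
    then have U: "A \<subseteq> (\<Union>i. U i)" "\<And>i. bounded (U i)" "\<And>i. diameter (U i) \<le> \<delta> / L" by auto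
    \<comment> \<open>The Lipschitz condition holds on \<open>A\<close> only, so each covering set
      is cut down to \<open>A\<close> before it is mapped.\<close>
    define V where "V i = f ` (U i \<inter> A)" for i
    have bd: "bounded (U i \<inter> A)" for i using U(2) bounded_subset by blast
    have V: "bounded (V i)" "diameter (V i) \<le> L * diameter (U i \<inter> A)" for i
      unfolding V_def using diameter_image_le[of "U i \<inter> A" f L] lip L bd by auto
    have dU: "diameter (U i \<inter> A) \<le> diameter (U i)" for i by (intro diameter_subset U) auto
    have dV: "diameter (V i) \<le> L * diameter (U i)" for i
      using V(2)[of i] mult_left_mono[OF dU[of i], of L] L by linarith
    have "hausdorff_content k \<delta> (f ` A) \<le> (\<Sum>i. ?g (V i))"
      unfolding hausdorff_content_def
    proof (rule INF_lower, intro CollectI conjI allI)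
      show "f ` A \<subseteq> (\<Union>i. V i)" using U(1) unfolding V_def by blast
      show "diameter (V i) \<le> \<delta>" for i
        using dV[of i] mult_left_mono[OF U(3)[of i], of L] L by simp
    qed (rule V)
    also have "\<dots> \<le> (\<Sum>i. ennreal (L ^ k) * ?g (U i))"
    proof (intro suminf_le)
      fix i
      have "(diameter (V i) / 2) ^ k \<le> (L * diameter (U i) / 2) ^ k"
        using dV[of i] diameter_ge_0[OF V(1)] by (intro power_mono) auto
      then have "unit_ball_vol (real k) * (diameter (V i) / 2) ^ k \<le> unit_ball_vol (real k) * (L * diameter (U i) / 2) ^ k"
        by (rule mult_left_mono) simp
      also have "\<dots> = L ^ k * (unit_ball_vol (real k) * (diameter (U i) / 2) ^ k)"
        by (simp add: power_divide power_mult_distrib)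
      finally have *: "ennreal (unit_ball_vol (real k) * (diameter (V i) / 2) ^ k)
          \<le> ennreal (L ^ k) * ennreal (unit_ball_vol (real k) * (diameter (U i) / 2) ^ k)"
        using L diameter_ge_0[OF U(2)[of i]] by (subst ennreal_mult[symmetric]) (auto intro: ennreal_leI)
      have "U i \<noteq> {}" if "V i \<noteq> {}" using that by (auto simp: V_def)
      then show "?g (V i) \<le> ennreal (L ^ k) * ?g (U i)" using * by (cases "V i = {}") auto
    qed auto
    finally show "hausdorff_content k \<delta> (f ` A) \<le> ennreal (L ^ k) * (\<Sum>i. ?g (U i))" by simp
  qed (use L in auto)
  show ?thesis
    unfolding hausdorff_outer_def[of k "f ` A"]
  proof (rule SUP_least)
    fix \<delta> :: real assume "\<delta> \<in> {0<..}"
    then have d: "\<delta> > 0" "\<delta> / L > 0" using L by auto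
    have "hausdorff_content k (\<delta> / L) A \<le> hausdorff_outer k A"
      unfolding hausdorff_outer_def using d by (intro SUP_upper) auto
    with content[OF d(1)] show "hausdorff_content k \<delta> (f ` A) \<le> ennreal (L ^ k) * hausdorff_outer k A"
      by (meson mult_left_mono order_trans zero_le)
  qed
qed

text \<open>The map and its inverse are both Lipschitz with constant 1, which gives the two
  inequalities between the measures of a set and of its preimage.\<close>

lemma hausdorff_measure_distr_isometry:
  fixes f :: "'a::metric_space \<Rightarrow> 'a"
  assumes iso: "\<And>x y. dist (f x) (f y) = dist x y" and surj: "surj f"
  shows "distr (hausdorff_measure k) borel f = hausdorff_measure k"
proof (rule measure_eqI)
  have "continuous_on UNIV f"
    unfolding continuous_on_iff by (metis iso)
  then have [measurable]: "f \<in> borel_measurable borel" by (rule borel_measurable_continuous_onI)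
  fix A assume "A \<in> sets (distr (hausdorff_measure k) borel f)"
  then have A [measurable]: "A \<in> sets borel" by simp
  have fA: "f ` (f -` A) = A" using surj by auto
  have pre: "f -` A \<in> sets borel" using measurable_sets[of f borel borel A] by simp
  have inj: "inj f" by (rule injI) (metis iso dist_eq_0_iff)
  have inv: "inv f ` A = f -` A" using inj surj fA by (metis image_inv_f_f)
  have "hausdorff_outer k (f -` A) \<le> ennreal (1 ^ k) * hausdorff_outer k A"
    unfolding inv[symmetric]
    by (rule hausdorff_outer_lipschitz_image) (auto, metis iso surj surj_f_inv_f order_refl)
  moreover have "hausdorff_outer k (f ` (f -` A)) \<le> ennreal (1 ^ k) * hausdorff_outer k (f -` A)"
    by (rule hausdorff_outer_lipschitz_image) (auto simp: iso)
  ultimately have eq: "hausdorff_outer k (f -` A) = hausdorff_outer k A" unfolding fA by (auto intro: antisym)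
  show "emeasure (distr (hausdorff_measure k) borel f) A = emeasure (hausdorff_measure k) A"
    using pre by (simp add: emeasure_distr emeasure_hausdorff_measure eq)
qed simp

lemma hausdorff_content_le_finite_cover:
  assumes "finite C" "A \<subseteq> (\<Union>x\<in>C. V x)" "\<And>x. x \<in> C \<Longrightarrow> bounded (V x)" "\<And>x. x \<in> C \<Longrightarrow> diameter (V x) \<le> \<delta>" "\<delta> > 0"
  shows "hausdorff_content k \<delta> A \<le> (\<Sum>x\<in>C. ennreal (unit_ball_vol (real k) * (diameter (V x) / 2) ^ k))"
proof -
  obtain h where h: "bij_betw h {0..<card C} C" using ex_bij_betw_nat_finite[OF assms(1)] by blast
  define U where "U i = (if i < card C then V (h i) else {})" for i
  have hC: "h i \<in> C" if "i < card C" for i using h that by (auto simp: bij_betw_def)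
  have "hausdorff_content k \<delta> A \<le> (\<Sum>i. if U i = {} then 0 else ennreal (unit_ball_vol (real k) * (diameter (U i) / 2) ^ k))"
    unfolding hausdorff_content_def
  proof (rule INF_lower, intro CollectI conjI allI)
    show "A \<subseteq> (\<Union>i. U i)"
    proof
      fix x assume "x \<in> A"
      then obtain y where y: "y \<in> C" "x \<in> V y" using assms(2) by blast
      have "y \<in> h ` {0..<card C}" using y(1) h by (simp add: bij_betw_def)
      then obtain i where "i < card C" "y = h i" by auto
      then show "x \<in> (\<Union>i. U i)" using y by (auto simp: U_def intro!: exI[of _ i])
    qed
    show "bounded (U i)" "diameter (U i) \<le> \<delta>" for i using assms hC by (auto simp: U_def)
  qed
  also have "\<dots> = (\<Sum>i\<in>{0..<card C}. if U i = {} then 0 else ennreal (unit_ball_vol (real k) * (diameter (U i) / 2) ^ k))"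
    by (intro suminf_finite) (auto simp: U_def)
  also have "\<dots> \<le> (\<Sum>i\<in>{0..<card C}. ennreal (unit_ball_vol (real k) * (diameter (V (h i)) / 2) ^ k))"
    by (intro sum_mono) (auto simp: U_def)
  also have "\<dots> = (\<Sum>x\<in>C. ennreal (unit_ball_vol (real k) * (diameter (V x) / 2) ^ k))"
    by (rule sum.reindex_bij_betw[OF h])
  finally show ?thesis .
qed

section \<open>Finiteness and positivity of the measure of the sphere\<close>

lemma power_diff_le:
  fixes a b :: real assumes "0 \<le> a" "a \<le> b"
  shows "b ^ n - a ^ n \<le> real n * (b - a) * b ^ (n - 1)"
proof (cases n)
  case (Suc m)
  show ?thesis unfolding Suc
  proof (induction m)
    case (Suc m)
    have "b ^ Suc (Suc m) - a ^ Suc (Suc m) = b * (b ^ Suc m - a ^ Suc m) + a ^ Suc m * (b - a)"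
      by (simp add: algebra_simps)
    also have "\<dots> \<le> b * (real (Suc m) * (b - a) * b ^ (Suc m - 1)) + b ^ Suc m * (b - a)"
      using Suc assms by (intro add_mono mult_left_mono mult_right_mono power_mono) auto
    also have "\<dots> = real (Suc (Suc m)) * (b - a) * b ^ (Suc (Suc m) - 1)"
      by (simp add: algebra_simps)
    finally show ?case .
  qed auto
qed auto

lemma card_separated_sphere:
  fixes C :: "'a::euclidean_space set"
  assumes C: "finite C" "C \<subseteq> sphere 0 1" and d: "0 < \<delta>" "\<delta> \<le> 1"
    and sep: "\<And>x y. x \<in> C \<Longrightarrow> y \<in> C \<Longrightarrow> x \<noteq> y \<Longrightarrow> \<delta> \<le> dist x y"
  shows "real (card C) * \<delta> ^ (DIM('a) - 1) \<le> real DIM('a) * 4 ^ DIM('a)"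
proof -
  let ?n = "DIM('a)"
  let ?k = "unit_ball_vol (real ?n)"
  txt \<open>The balls of radius \<open>\<delta> / 2\<close> around the points are disjoint and lie in a shell of width \<open>\<delta>\<close>.\<close>
  have fin: "emeasure lborel (ball (x::'a) e) \<noteq> \<top>" for x e
    using emeasure_lborel_ball_finite[of x e] by auto
  have k: "?k > 0" by simp
  have disj: "disjoint_family_on (\<lambda>x. ball x (\<delta> / 2)) C"
    unfolding disjoint_family_on_def
  proof (intro ballI impI)
    fix x y assume xy: "x \<in> C" "y \<in> C" "x \<noteq> y"
    show "ball x (\<delta> / 2) \<inter> ball y (\<delta> / 2) = {}"
      using sep[OF xy] by (intro disjoint_ballI) auto
  qed
  have sub: "(\<Union>x\<in>C. ball x (\<delta> / 2)) \<subseteq> ball 0 (1 + \<delta> / 2) - ball 0 (1 - \<delta> / 2)"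
  proof
    fix z assume "z \<in> (\<Union>x\<in>C. ball x (\<delta> / 2))"
    then obtain x where x: "norm x = 1" "dist x z < \<delta> / 2" using C by auto
    have "\<bar>norm x - norm z\<bar> \<le> dist x z" unfolding dist_norm by (rule norm_triangle_ineq3)
    then show "z \<in> ball 0 (1 + \<delta> / 2) - ball 0 (1 - \<delta> / 2)" using x by (auto simp: dist_norm)
  qed
  have "real (card C) * (?k * (\<delta> / 2) ^ ?n) = (\<Sum>x\<in>C. measure lborel (ball x (\<delta> / 2)))"
    using d by (simp add: content_ball)
  also have "\<dots> = measure lborel (\<Union>x\<in>C. ball x (\<delta> / 2))"
    using C disj by (intro measure_finite_Union[symmetric]) (auto simp: fin)
  also have "\<dots> \<le> measure lborel (ball 0 (1 + \<delta> / 2) - ball (0::'a) (1 - \<delta> / 2))"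
    using sub by (intro measure_mono_fmeasurable fmeasurable_Diff)
       (auto simp: fin less_top[symmetric] intro!: fmeasurableI borel_open)
  also have "\<dots> = measure lborel (ball (0::'a) (1 + \<delta> / 2)) - measure lborel (ball (0::'a) (1 - \<delta> / 2))"
    using d by (intro measure_Diff) (auto simp: fin)
  also have "\<dots> = ?k * ((1 + \<delta> / 2) ^ ?n - (1 - \<delta> / 2) ^ ?n)"
    using d by (simp add: content_ball algebra_simps)
  also have "\<dots> \<le> ?k * (real ?n * ((1 + \<delta> / 2) - (1 - \<delta> / 2)) * (1 + \<delta> / 2) ^ (?n - 1))"
    using d k by (intro mult_left_mono power_diff_le) auto
  also have "\<dots> \<le> ?k * (real ?n * \<delta> * 2 ^ (?n - 1))"
    using d k by (intro mult_left_mono) (auto intro!: mult_left_mono power_mono)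
  finally have "real (card C) * (\<delta> / 2) ^ ?n \<le> real ?n * \<delta> * 2 ^ (?n - 1)"
    using k by (simp add: mult.left_commute[of _ ?k])
  then have *: "real (card C) * (\<delta> ^ (?n - 1) * \<delta>) / 2 ^ ?n \<le> real ?n * \<delta> * 2 ^ (?n - 1)"
    using power_minus_mult[of ?n \<delta>] by (simp add: power_divide)
  \<comment> \<open>One power of 2 comes from the radius \<open>\<delta> / 2\<close> of the small
    balls, the other from \<open>1 + \<delta> / 2 \<le> 2\<close> in the volume of the
    shell.\<close>
  have "(2::real) ^ (?n - 1) * 2 ^ ?n \<le> 2 ^ ?n * 2 ^ ?n" by (intro mult_right_mono power_increasing) auto
  also have "\<dots> = (4::real) ^ ?n" by (simp add: power_mult_distrib[symmetric])
  finally have 4: "(2::real) ^ (?n - 1) * 2 ^ ?n \<le> 4 ^ ?n" .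
  from * have "real (card C) * (\<delta> ^ (?n - 1) * \<delta>) \<le> real ?n * \<delta> * 2 ^ (?n - 1) * 2 ^ ?n"
    by (simp add: divide_le_eq)
  then have "(real (card C) * \<delta> ^ (?n - 1)) * \<delta> \<le> (real ?n * (2 ^ (?n - 1) * 2 ^ ?n)) * \<delta>"
    by (simp add: mult_ac)
  then have "real (card C) * \<delta> ^ (?n - 1) \<le> real ?n * (2 ^ (?n - 1) * 2 ^ ?n)"
    using d by simp
  also have "\<dots> \<le> real ?n * 4 ^ ?n" using 4 by (intro mult_left_mono) auto
  finally show ?thesis .
qed

text \<open>A maximal \<delta>-separated subset of the sphere is a \<delta>-net. Its cardinality is
  of order \<open>\<delta> ^ (1 - n)\<close>, so the balls around it form a cover whose total weight
  is bounded independently of \<delta>.\<close>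

lemma hausdorff_outer_sphere_finite:
  "hausdorff_outer (DIM('a) - 1) (sphere (0::'a::euclidean_space) 1) < \<top>"
proof -
  let ?n = "DIM('a)" and ?S = "sphere (0::'a) 1"
  let ?B = "ennreal (unit_ball_vol (real (?n - 1)) * (real ?n * 4 ^ ?n))"
  have *: "hausdorff_content (?n - 1) (2 * \<delta>) ?S \<le> ?B" if d: "0 < \<delta>" "\<delta> \<le> 1" for \<delta>
  proof -
    define P where "P C \<longleftrightarrow> finite C \<and> C \<subseteq> ?S \<and> (\<forall>x\<in>C. \<forall>y\<in>C. x \<noteq> y \<longrightarrow> \<delta> \<le> dist x y)" for C
    have cP: "real (card C) * \<delta> ^ (?n - 1) \<le> real ?n * 4 ^ ?n" if "P C" for C
      using that d by (intro card_separated_sphere) (auto simp: P_def)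
    \<comment> \<open>A uniform bound on the cardinality of separated sets guarantees that one of
      maximal cardinality exists.\<close>
    obtain b :: nat where b: "real ?n * 4 ^ ?n / \<delta> ^ (?n - 1) < real b" using reals_Archimedean2 by blast
    have "card C < b" if "P C" for C
    proof -
      have "real (card C) \<le> real ?n * 4 ^ ?n / \<delta> ^ (?n - 1)"
        using cP[OF that] d by (simp add: le_divide_eq)
      then show ?thesis using b by linarith
    qed
    then obtain C where C: "P C" and mx: "\<And>C'. P C' \<Longrightarrow> card C' \<le> card C"
      using ex_has_greatest_nat[of P "{}" card b] by (auto simp: P_def)
    have cov: "?S \<subseteq> (\<Union>x\<in>C. cball x \<delta>)"
    proof (rule ccontr)
      assume "\<not> ?thesis"
      then obtain z where z0: "z \<in> ?S" "z \<notin> (\<Union>x\<in>C. cball x \<delta>)" by blast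
      then have z: "z \<in> ?S" "\<And>x. x \<in> C \<Longrightarrow> dist x z > \<delta>" by (auto simp: not_le)
      then have "P (insert z C)" using C unfolding P_def by (auto simp: dist_commute less_imp_le)
      moreover have "z \<notin> C" using z(2)[of z] d by auto
      ultimately show False using mx[of "insert z C"] C by (auto simp: P_def)
    qed
    have "hausdorff_content (?n - 1) (2 * \<delta>) ?S \<le>
        (\<Sum>x\<in>C. ennreal (unit_ball_vol (real (?n - 1)) * (diameter (cball x \<delta>) / 2) ^ (?n - 1)))"
      using C cov d by (intro hausdorff_content_le_finite_cover) (auto simp: P_def)
    also have "\<dots> = ennreal (unit_ball_vol (real (?n - 1)) * (real (card C) * \<delta> ^ (?n - 1)))"
      using d by (subst sum_ennreal) (simp_all add: mult_ac)
    also have "\<dots> \<le> ?B" using cP[OF C] by (intro ennreal_leI mult_left_mono) auto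
    finally show ?thesis .
  qed
  have "hausdorff_outer (?n - 1) ?S \<le> ?B"
    unfolding hausdorff_outer_def
  proof (rule SUP_least)
    fix \<delta> :: real assume "\<delta> \<in> {0<..}"
    \<comment> \<open>The cardinality bound is available for scales up to 1, and a ball of radius
      \<delta> has diameter \<open>2 * \<delta>\<close>; both are respected by this choice.\<close>
    then have d: "0 < min 1 (\<delta> / 2)" "2 * min 1 (\<delta> / 2) \<le> \<delta>" by auto
    have "hausdorff_content (?n - 1) \<delta> ?S \<le> hausdorff_content (?n - 1) (2 * min 1 (\<delta> / 2)) ?S"
      using d by (intro hausdorff_content_antimono) auto
    also have "\<dots> \<le> ?B" using d by (intro *) auto
    finally show "hausdorff_content (?n - 1) \<delta> ?S \<le> ?B" .
  qed
  also have "\<dots> < \<top>" by simp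
  finally show ?thesis .
qed

text \<open>
  The cone over a part of the sphere of diameter \<open>d\<close> has volume at most a constant times \<open>d ^ (n - 1)\<close>;
  since the cones over a cover fill the unit ball, the sphere has positive measure.
\<close>

lemma cone_cover:
  fixes U :: "'a::euclidean_space set"
  assumes n: "2 \<le> DIM('a)" and U: "bounded U" "diameter U \<le> 1"
  obtains W where "W \<in> sets borel" "\<And>s u. u \<in> U \<Longrightarrow> norm u = 1 \<Longrightarrow> 0 \<le> s \<Longrightarrow> s \<le> 1 \<Longrightarrow> s *\<^sub>R u \<in> W"
    "emeasure lborel W \<le> ennreal (3 * 2 ^ DIM('a) * unit_ball_vol DIM('a) * diameter U ^ (DIM('a) - 1))"
proof (cases "\<exists>u\<in>U. norm u = 1")
  case False
  then show ?thesis by (intro that[of "{}"]) auto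
next
  case True
  then obtain v where v: "v \<in> U" "norm v = 1" by blast
  let ?n = "DIM('a)"
  define d where "d = diameter U"
  have d: "0 \<le> d" "d \<le> 1" using U diameter_ge_0[OF U(1)] by (auto simp: d_def)
  have close: "norm (u - v) \<le> d" if "u \<in> U" for u
    using diameter_bounded_bound[OF U(1) that v(1)] by (simp add: d_def dist_norm)
  show ?thesis
  proof (cases "d = 0")
    case True
    \<comment> \<open>When the diameter is 0, all points of \<open>U\<close> equal \<open>v\<close>,
      and balls of radius 0 on the axis would not cover the segment. The line through
      \<open>v\<close> does, and it is a null set in dimension at least 2.\<close>
    have "negligible (span {v})"
      using n by (intro negligible_lowdim) (simp add: dim_le_card' le_less_trans[OF dim_le_card'] dim_singleton)
    then have "span {v} \<in> null_sets lborel"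
      by (simp add: negligible_iff_null_sets null_sets_completion_iff closed_span)
    then have W: "emeasure lborel (span {v}) = 0" by (rule null_setsD1)
    show ?thesis
    proof (rule that[of "span {v}"])
      show "span {v} \<in> sets borel" by (intro borel_closed closed_span)
      show "emeasure lborel (span {v}) \<le> ennreal (3 * 2 ^ DIM('a) * unit_ball_vol DIM('a) * diameter U ^ (DIM('a) - 1))"
        by (simp add: W)
      fix s u assume "u \<in> U" "norm u = 1"
      then have "u = v" using close[of u] True by simp
      then show "s *\<^sub>R u \<in> span {v}" by (intro span_mul span_base) simp
    qed
  next
    case False
    then have d0: "d > 0" using d by auto
    \<comment> \<open>Equidistant centres on the segment from 0 to \<open>v\<close> with spacing at
      most \<open>d\<close>; their number is of order \<open>1 / d\<close>, which turns
      \<open>d ^ n\<close> into \<open>d ^ (n - 1)\<close>.\<close>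
    define N where "N = nat \<lceil>1 / d\<rceil>"
    have N: "1 / d \<le> real N" "real N < 1 / d + 1" "N > 0"
      unfolding N_def using d0 by (auto, linarith+)
    have N1: "1 / real N \<le> d" using N d0 by (simp add: field_simps)
    \<comment> \<open>The radius \<open>2 * d\<close> allows \<open>d\<close> for the distance to
      the next centre along the axis and \<open>d\<close> for the deviation of \<open>u\<close> from
      \<open>v\<close>.\<close>
    define W where "W = (\<Union>j\<in>{..N}. cball ((real j / real N) *\<^sub>R v) (2 * d))"
    show ?thesis
    proof (rule that[of W])
      show "W \<in> sets borel" by (auto simp: W_def)
    next
      fix s u assume u: "u \<in> U" "norm u = 1" and s: "0 \<le> s" "s \<le> (1::real)"
      define j where "j = nat \<lfloor>s * real N\<rfloor>"
      have "real j = of_int \<lfloor>s * real N\<rfloor>" using s by (simp add: j_def)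
      then have j: "real j \<le> s * real N" "s * real N < real j + 1"
        using floor_correct[of "s * real N"] by auto
      have "s * real N \<le> real N" using s by (simp add: mult_left_le_one_le)
      then have jN: "j \<le> N" using j(1) by linarith
      have "\<bar>real j / real N - s\<bar> = \<bar>real j - s * real N\<bar> / real N" using N(3) by (simp add: field_simps)
      also have "\<dots> \<le> 1 / real N" using j by (intro divide_right_mono) auto
      finally have "\<bar>real j / real N - s\<bar> \<le> 1 / real N" .
      then have js: "\<bar>real j / real N - s\<bar> \<le> d" using N1 by linarith
      have "(real j / real N) *\<^sub>R v - s *\<^sub>R u = (real j / real N - s) *\<^sub>R v - s *\<^sub>R (u - v)"
        by (simp add: algebra_simps)
      then have "norm ((real j / real N) *\<^sub>R v - s *\<^sub>R u) \<le> \<bar>real j / real N - s\<bar> * norm v + \<bar>s\<bar> * norm (u - v)"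
        by (metis norm_triangle_ineq4 norm_scaleR)
      also have "\<dots> \<le> d * 1 + 1 * d"
        using js v s close[OF u(1)] d by (intro add_mono mult_mono) auto
      finally show "s *\<^sub>R u \<in> W" using jN by (auto simp: W_def dist_norm intro!: bexI[of _ j])
    next
      have "emeasure lborel W \<le> (\<Sum>j\<in>{..N}. emeasure lborel (cball ((real j / real N) *\<^sub>R v) (2 * d)))"
        unfolding W_def by (intro emeasure_subadditive_finite) auto
      also have "\<dots> = ennreal (real (Suc N) * (unit_ball_vol ?n * (2 * d) ^ ?n))"
        using d0 by (subst sum.cong[OF refl emeasure_cball]) (simp_all add: sum_ennreal del: of_nat_Suc sum_constant, simp)
      also have "\<dots> \<le> ennreal (3 / d * (unit_ball_vol ?n * (2 * d) ^ ?n))"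
      proof (intro ennreal_leI mult_right_mono)
        have "1 \<le> 1 / d" using d d0 by simp
        then have "1 / d + 2 \<le> 3 / d" by (simp add: field_simps)
        then show "real (Suc N) \<le> 3 / d" using N(2) by simp
      qed (use d0 in auto)
      also have "3 / d * (unit_ball_vol ?n * (2 * d) ^ ?n) = 3 * 2 ^ ?n * unit_ball_vol ?n * d ^ (?n - 1)"
        using d0 power_minus_mult[of ?n d] by (simp add: power_mult_distrib field_simps)
      finally show "emeasure lborel W \<le> ennreal (3 * 2 ^ ?n * unit_ball_vol ?n * diameter U ^ (?n - 1))"
        by (simp add: d_def)
    qed
  qed
qed

lemma hausdorff_outer_sphere_pos:
  assumes n: "2 \<le> DIM('a)"
  shows "hausdorff_outer (DIM('a) - 1) (sphere (0::'a::euclidean_space) 1) > 0"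
proof -
  let ?n = "DIM('a)" and ?S = "sphere (0::'a) 1"
  \<comment> \<open>The volume constant of the cone, times the factor that converts the power of a
    diameter into the weight used by the Hausdorff content.\<close>
  define c where "c = 3 * 2 ^ ?n * unit_ball_vol ?n * 2 ^ (?n - 1) / unit_ball_vol (real (?n - 1))"
  have c: "c > 0" by (simp add: c_def)
  have "emeasure lborel (cball (0::'a) 1) \<le> ennreal c * hausdorff_content (?n - 1) 1 ?S"
    unfolding hausdorff_content_def
  proof (rule ennreal_le_mult_INF[OF c])
    fix U :: "nat \<Rightarrow> 'a set"
    assume "U \<in> {U. ?S \<subseteq> (\<Union>i. U i) \<and> (\<forall>i. bounded (U i) \<and> diameter (U i) \<le> 1)}"
    then have U: "?S \<subseteq> (\<Union>i. U i)" "\<And>i. bounded (U i)" "\<And>i. diameter (U i) \<le> 1" by auto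
    have "\<exists>W. W \<in> sets borel \<and> (\<forall>s u. u \<in> U i \<longrightarrow> norm u = 1 \<longrightarrow> 0 \<le> s \<longrightarrow> s \<le> 1 \<longrightarrow> s *\<^sub>R u \<in> W) \<and>
       emeasure lborel W \<le> ennreal (3 * 2 ^ DIM('a) * unit_ball_vol DIM('a) * diameter (U i) ^ (DIM('a) - 1))" for i
      using cone_cover[OF n U(2)[of i] U(3)[of i]] by metis
    then obtain W where W: "\<And>i. W i \<in> sets borel" "\<And>i s u. u \<in> U i \<Longrightarrow> norm u = 1 \<Longrightarrow> 0 \<le> s \<Longrightarrow> s \<le> 1 \<Longrightarrow> s *\<^sub>R u \<in> W i"
      "\<And>i. emeasure lborel (W i) \<le> ennreal (3 * 2 ^ DIM('a) * unit_ball_vol DIM('a) * diameter (U i) ^ (DIM('a) - 1))"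
      by metis
    let ?g = "\<lambda>V::'a set. if V = {} then 0 else ennreal (unit_ball_vol (real (?n - 1)) * (diameter V / 2) ^ (?n - 1))"
    have "cball 0 1 \<subseteq> {0} \<union> (\<Union>i. W i)"
    proof
      fix x :: 'a assume x: "x \<in> cball 0 1"
      show "x \<in> {0} \<union> (\<Union>i. W i)"
      proof (cases "x = 0")
        case False
        define u where "u = x /\<^sub>R norm x"
        have u: "norm u = 1" "x = norm x *\<^sub>R u" using False by (auto simp: u_def)
        then obtain i where "u \<in> U i" using U(1) by auto
        then show ?thesis using W(2)[of u i "norm x"] u x by auto
      qed auto
    qed
    then have "emeasure lborel (cball (0::'a) 1) \<le> emeasure lborel ({0} \<union> (\<Union>i. W i))"
      using W(1) by (intro emeasure_mono) auto
    also have "\<dots> \<le> emeasure lborel {0::'a} + emeasure lborel (\<Union>i. W i)"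
      using W(1) by (intro emeasure_subadditive) auto
    also have "\<dots> = emeasure lborel (\<Union>i. W i)" by simp
    also have "\<dots> \<le> (\<Sum>i. emeasure lborel (W i))"
      using W(1) by (intro emeasure_subadditive_countably) auto
    also have "\<dots> \<le> (\<Sum>i. ennreal c * ?g (U i))"
    proof (intro suminf_le)
      fix i
      show "emeasure lborel (W i) \<le> ennreal c * ?g (U i)"
      proof (cases "U i = {}")
        case True
        \<comment> \<open>The weight of an empty set is 0. The volume bound vanishes too, because
          the diameter is 0 and the exponent is positive in dimension at least 2.\<close>
        have "?n - 1 \<noteq> 0" using n by auto
        then show ?thesis using W(3)[of i] True by (auto simp: power_0_left)
      next
        case False
        have "3 * 2 ^ DIM('a) * unit_ball_vol DIM('a) * diameter (U i) ^ (DIM('a) - 1) =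
          c * (unit_ball_vol (real (?n - 1)) * (diameter (U i) / 2) ^ (?n - 1))"
          by (simp add: c_def power_divide less_imp_neq[symmetric])
        then show ?thesis using W(3)[of i] False c diameter_ge_0[OF U(2)[of i]]
          by (simp add: ennreal_mult[symmetric])
      qed
    qed auto
    finally show "emeasure lborel (cball (0::'a) 1) \<le> ennreal c * (\<Sum>i. ?g (U i))" by simp
  qed
  also have "\<dots> \<le> ennreal c * hausdorff_outer (?n - 1) ?S"
    unfolding hausdorff_outer_def by (intro mult_left_mono SUP_upper) auto
  finally have "emeasure lborel (cball (0::'a) 1) \<le> ennreal c * hausdorff_outer (?n - 1) ?S" .
  moreover have "emeasure lborel (cball (0::'a) 1) > 0" by (simp add: emeasure_cball)
  ultimately show ?thesis by (metis mult_zero_right not_gr_zero not_le)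
qed

section \<open>Length of the unit circle\<close>

lemma emeasure_lborel_le_hausdorff_outer:
  fixes A :: "real set"
  assumes A: "A \<in> sets borel"
  shows "emeasure lborel A \<le> hausdorff_outer 1 A"
proof -
  have "emeasure lborel A \<le> hausdorff_content 1 1 A"
    unfolding hausdorff_content_def
  proof (rule INF_greatest)
    fix U :: "nat \<Rightarrow> real set"
    assume "U \<in> {U. A \<subseteq> (\<Union>i. U i) \<and> (\<forall>i. bounded (U i) \<and> diameter (U i) \<le> 1)}"
    then have U: "A \<subseteq> (\<Union>i. U i)" "\<And>i. bounded (U i)" by auto
    \<comment> \<open>Each covering set lies in the interval between its infimum and its supremum,
      whose length is its diameter. As the unit ball of the line has length 2, the weight for
      \<open>k = 1\<close> is exactly the diameter.\<close>
    define V where "V i = (if U i = {} then {} else {Inf (U i)..Sup (U i)})" for i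
    have b: "bdd_above (U i)" "bdd_below (U i)" for i
      using U(2) bounded_imp_bdd_above bounded_imp_bdd_below by auto
    have UV: "U i \<subseteq> V i" for i using b[of i] by (auto simp: V_def intro: cInf_lower cSup_upper)
    have "emeasure lborel A \<le> emeasure lborel (\<Union>i. V i)"
    proof (rule emeasure_mono)
      show "A \<subseteq> (\<Union>i. V i)" using U(1) UV by blast
      show "(\<Union>i. V i) \<in> sets lborel" by (auto simp: V_def)
    qed
    also have "\<dots> \<le> (\<Sum>i. emeasure lborel (V i))"
      by (intro emeasure_subadditive_countably) (auto simp: V_def)
    also have "\<dots> \<le> (\<Sum>i. if U i = {} then 0 else ennreal (unit_ball_vol (real 1) * (diameter (U i) / 2) ^ 1))"
    proof (intro suminf_le)
      fix i
      have "Sup (U i) - Inf (U i) \<le> diameter (U i)" if ne: "U i \<noteq> {}"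
      proof -
        have "Sup (U i) \<le> Inf (U i) + diameter (U i)"
        proof (rule cSup_least[OF ne])
          fix x assume x: "x \<in> U i"
          have "x - diameter (U i) \<le> Inf (U i)"
          proof (rule cInf_greatest[OF ne])
            fix y assume "y \<in> U i"
            from diameter_bounded_bound[OF U(2) x this] show "x - diameter (U i) \<le> y" by (simp add: dist_real_def)
          qed
          then show "x \<le> Inf (U i) + diameter (U i)" by simp
        qed
        then show ?thesis by simp
      qed
      moreover have "Inf (U i) \<le> Sup (U i)" if "U i \<noteq> {}" using that b cInf_le_cSup by auto
      ultimately show "emeasure lborel (V i) \<le> (if U i = {} then 0 else ennreal (unit_ball_vol (real 1) * (diameter (U i) / 2) ^ 1))"
        by (auto simp: V_def intro!: ennreal_leI)
    qed auto
    finally show "emeasure lborel A \<le> (\<Sum>i. if U i = {} then 0 else ennreal (unit_ball_vol (real 1) * (diameter (U i) / 2) ^ 1))" .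
  qed
  also have "\<dots> \<le> hausdorff_outer 1 A"
    unfolding hausdorff_outer_def by (intro SUP_upper) auto
  finally show ?thesis .
qed

text \<open>Division into \<open>N\<close> pieces of length \<open>h\<close>; one further piece
  takes care of the right endpoint and costs \<open>h\<close>. Choosing \<open>h\<close> below both
  \<delta> and \<open>e\<close> makes the cover admissible and the surplus negligible.\<close>

lemma hausdorff_outer_Icc_le:
  fixes a b :: real
  assumes ab: "a \<le> b"
  shows "hausdorff_outer 1 {a..b} \<le> ennreal (b - a)"
  unfolding hausdorff_outer_def
proof (rule SUP_least, rule ennreal_le_epsilon)
  fix \<delta> e :: real assume "\<delta> \<in> {0<..}" and e: "e > 0"
  then have d: "\<delta> > 0" by auto
  obtain N0 :: nat where "(b - a) / min \<delta> e < real N0" using reals_Archimedean2 by blast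
  then have N0: "b - a < real N0 * min \<delta> e" using d e by (simp add: divide_less_eq)
  define N where "N = Suc N0"
  have "real N0 * min \<delta> e \<le> real N * min \<delta> e" using d e by (intro mult_right_mono) (auto simp: N_def)
  then have N: "b - a \<le> real N * min \<delta> e" "N > 0" using N0 by (auto simp: N_def)
  define h where "h = (b - a) / real N"
  have "real N * min \<delta> e \<le> real N * \<delta>" "real N * min \<delta> e \<le> real N * e" by (auto intro: mult_left_mono)
  then have "b - a \<le> real N * \<delta>" "b - a \<le> real N * e" using N(1) by linarith+
  then have h: "h \<le> \<delta>" "h \<le> e" "0 \<le> h" "real N * h = b - a" using N ab by (auto simp: h_def divide_le_eq mult_ac)
  let ?V = "\<lambda>j. cball (a + (real j + 1 / 2) * h) (h / 2)"
  have "hausdorff_content 1 \<delta> {a..b} \<le> (\<Sum>j\<in>{..N}. ennreal (unit_ball_vol (real 1) * (diameter (?V j) / 2) ^ 1))"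
  proof (intro hausdorff_content_le_finite_cover)
    show "{a..b} \<subseteq> (\<Union>j\<in>{..N}. ?V j)"
    proof
      fix x assume x: "x \<in> {a..b}"
      show "x \<in> (\<Union>j\<in>{..N}. ?V j)"
      proof (cases "h = 0")
        case True
        then show ?thesis using x h by (auto intro!: bexI[of _ 0])
      next
        case False
        then have h0: "h > 0" using h by auto
        define j where "j = nat \<lfloor>(x - a) / h\<rfloor>"
        have "real j = of_int \<lfloor>(x - a) / h\<rfloor>" using x h0 by (simp add: j_def)
        then have "real j \<le> (x - a) / h" "(x - a) / h < real j + 1"
          using floor_correct[of "(x - a) / h"] by auto
        then have j: "real j * h \<le> x - a" "x - a < (real j + 1) * h"
          using h0 by (auto simp: le_divide_eq divide_less_eq)
        have "real j * h \<le> real N * h" using j x h by auto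
        then have "j \<le> N" using h0 by simp
        moreover have "x \<in> ?V j"
        proof -
          have "(real j + 1 / 2) * h = real j * h + h / 2" "(real j + 1) * h = real j * h + h"
            by (simp_all add: algebra_simps)
          then have "\<bar>a + (real j + 1 / 2) * h - x\<bar> \<le> h / 2"
            using j by (intro abs_leI) linarith+
          then show ?thesis by (simp add: dist_real_def)
        qed
        ultimately show ?thesis by blast
      qed
    qed
  qed (use h d in auto)
  also have "\<dots> = ennreal (real (Suc N) * h)"
    using h by (subst sum_ennreal) auto
  also have "real (Suc N) * h = (b - a) + h" using h by (simp add: algebra_simps)
  also have "ennreal ((b - a) + h) \<le> ennreal (b - a) + ennreal e"
    using h ab e by (subst ennreal_plus[symmetric]) (auto intro!: ennreal_leI)
  finally show "hausdorff_content 1 \<delta> {a..b} \<le> ennreal (b - a) + ennreal e" .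
qed

definition circ :: "real \<Rightarrow> real^2" where "circ s = vector [cos s, sin s]"

lemma circ_nth [simp]: "circ s $ 1 = cos s" "circ s $ 2 = sin s"
  by (simp_all add: circ_def vector_2)

lemma norm_vec2: "norm (v :: real^2) = sqrt ((v $ 1)\<^sup>2 + (v $ 2)\<^sup>2)"
  by (simp add: norm_vec_def L2_set_def sum_2)

lemma norm_circ [simp]: "norm (circ s) = 1"
  by (simp add: norm_vec2)

text \<open>The chord length. It shows that \<open>circ\<close> is Lipschitz with constant 1 and, on
  short arcs, that its inverse is almost so.\<close>

lemma dist_circ: "dist (circ s) (circ t) = 2 * \<bar>sin ((s - t) / 2)\<bar>"
proof -
  have 1: "cos (s - t) = 1 - 2 * (sin ((s - t) / 2))\<^sup>2"
    by (metis cos_double_sin field_sum_of_halves mult_2)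
  have 2: "(cos s)\<^sup>2 + (sin s)\<^sup>2 = 1" "(cos t)\<^sup>2 + (sin t)\<^sup>2 = 1" by simp_all
  have "(cos s - cos t)\<^sup>2 + (sin s - sin t)\<^sup>2 = ((cos s)\<^sup>2 + (sin s)\<^sup>2) + ((cos t)\<^sup>2 + (sin t)\<^sup>2) - 2 * cos (s - t)"
    by (simp add: cos_diff power2_eq_square algebra_simps)
  also have "\<dots> = (2 * sin ((s - t) / 2))\<^sup>2" unfolding 1 2 by (simp add: power_mult_distrib)
  finally show ?thesis
    unfolding dist_norm norm_vec2 vector_minus_component circ_nth by (simp only: real_sqrt_abs abs_mult abs_numeral)
qed

lemma dist_circ_le: "dist (circ s) (circ t) \<le> dist s t"
  using abs_sin_x_le_abs_x[of "(s - t) / 2"] by (simp add: dist_circ dist_real_def)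

lemma continuous_on_circ: "continuous_on S circ"
  unfolding continuous_on_iff by (meson dist_circ_le le_less_trans)

lemma sphere_eq_circ_image: "sphere (0 :: real^2) 1 = circ ` {0..2 * pi}" "sphere (0 :: real^2) 1 = circ ` {0..<2 * pi}"
proof -
  have "\<exists>s\<in>{0..<2 * pi}. v = circ s" if "norm v = 1" for v :: "real^2"
  proof -
    have "(v $ 1)\<^sup>2 + (v $ 2)\<^sup>2 = 1" using that by (simp add: norm_vec2)
    then obtain t where "0 \<le> t" "t < 2 * pi" "v $ 1 = cos t" "v $ 2 = sin t" by (rule sincos_total_2pi)
    then show ?thesis by (intro bexI[of _ t]) (auto simp: vec_eq_iff forall_2)
  qed
  then have "sphere (0 :: real^2) 1 \<subseteq> circ ` {0..<2 * pi}" unfolding sphere_def by (force simp: image_iff)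
  moreover have "circ ` {0..<2 * pi} \<subseteq> circ ` {0..2 * pi}" "circ ` {0..2 * pi} \<subseteq> sphere 0 1" by auto
  ultimately show "sphere (0 :: real^2) 1 = circ ` {0..2 * pi}" "sphere (0 :: real^2) 1 = circ ` {0..<2 * pi}" by blast+
qed

lemma sin_ge_cos_mult:
  fixes x h :: real
  assumes "0 \<le> x" "x \<le> h" "h \<le> pi"
  shows "cos h * x \<le> sin x"
proof -
  have "sin 0 - cos h * 0 \<le> sin x - cos h * x"
  proof (rule DERIV_nonneg_imp_nondecreasing[OF assms(1)])
    fix y assume "0 \<le> y" "y \<le> x"
    then have "cos h \<le> cos y" using assms by (intro cos_monotone_0_pi_le) auto
    then show "\<exists>z. ((\<lambda>a. sin a - cos h * a) has_real_derivative z) (at y) \<and> 0 \<le> z"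
      by (intro exI[of _ "cos y - cos h"]) (auto intro!: derivative_eq_intros)
  qed
  then show ?thesis by simp
qed

text \<open>On an arc of half-length at most \<open>h\<close> a chord is at least
  \<open>cos h\<close> times the arc, so the inverse of \<open>circ\<close> is Lipschitz with
  constant \<open>1 / cos h\<close> and maps the arc onto an interval of known length.\<close>

lemma hausdorff_outer_arc_ge:
  assumes ab: "a \<le> b" "(b - a) / 2 \<le> h" "0 < h" "h < pi / 2"
  shows "ennreal (cos h * (b - a)) \<le> hausdorff_outer 1 (circ ` {a..<b})"
proof -
  have c: "cos h > 0" using assms by (intro cos_gt_zero) auto
  have ex: "cos h * \<bar>s - t\<bar> \<le> dist (circ s) (circ t)" if "s \<in> {a..<b}" "t \<in> {a..<b}" for s t
  proof -
    have "cos h * (\<bar>s - t\<bar> / 2) \<le> sin (\<bar>s - t\<bar> / 2)" using that assms by (intro sin_ge_cos_mult) (auto simp: abs_if)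
    also have "\<dots> \<le> \<bar>sin ((s - t) / 2)\<bar>"
    proof -
      have "sin ((t - s) / 2) = - sin ((s - t) / 2)"
        using sin_minus[of "(s - t) / 2"] by (simp add: minus_divide_left)
      then show ?thesis by (cases "s < t") (auto simp: abs_if)
    qed
    finally show ?thesis by (simp add: dist_circ)
  qed
  have inj: "inj_on circ {a..<b}"
  proof (rule inj_onI)
    fix s t assume st: "s \<in> {a..<b}" "t \<in> {a..<b}" "circ s = circ t"
    have "cos h * \<bar>s - t\<bar> \<le> 0" using ex[OF st(1,2)] st(3) by simp
    then show "s = t" using c by (simp add: mult_le_0_iff)
  qed
  let ?g = "the_inv_into {a..<b} circ"
  have "hausdorff_outer 1 (?g ` (circ ` {a..<b})) \<le> ennreal ((1 / cos h) ^ 1) * hausdorff_outer 1 (circ ` {a..<b})"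
  proof (rule hausdorff_outer_lipschitz_image)
    fix x y assume "x \<in> circ ` {a..<b}" "y \<in> circ ` {a..<b}"
    then obtain s t where "s \<in> {a..<b}" "t \<in> {a..<b}" "x = circ s" "y = circ t" by blast
    then show "dist (?g x) (?g y) \<le> 1 / cos h * dist x y"
      using ex[of s t] c by (simp add: the_inv_into_f_f[OF inj] dist_real_def field_simps)
  qed (use c in auto)
  moreover have "?g ` (circ ` {a..<b}) = {a..<b}"
    using the_inv_into_f_f[OF inj] by (force simp: image_image)
  moreover have "ennreal (b - a) \<le> hausdorff_outer 1 {a..<b}"
    using emeasure_lborel_le_hausdorff_outer[of "{a..<b}"] ab by simp
  ultimately have "ennreal (b - a) \<le> ennreal (1 / cos h) * hausdorff_outer 1 (circ ` {a..<b})" by simp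
  then have "ennreal (cos h) * ennreal (b - a) \<le> ennreal (cos h) * (ennreal (1 / cos h) * hausdorff_outer 1 (circ ` {a..<b}))"
    by (rule mult_left_mono) simp
  then show ?thesis using c ab by (simp add: mult.assoc[symmetric] ennreal_mult[symmetric])
qed

text \<open>The upper bound holds because \<open>circ\<close> does not increase distances. For the
  lower bound the circle is cut into \<open>N\<close> disjoint arcs, each of which loses only the
  factor \<open>cos (pi / N)\<close>, and this tends to 1.\<close>

lemma hausdorff_outer_circle: "hausdorff_outer 1 (sphere (0 :: real^2) 1) = ennreal (2 * pi)"
proof (rule antisym)
  have "hausdorff_outer 1 (circ ` {0..2 * pi}) \<le> ennreal (1 ^ 1) * hausdorff_outer 1 {0..2 * pi}"
  proof (rule hausdorff_outer_lipschitz_image)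
    fix s t
    show "dist (circ s) (circ t) \<le> 1 * dist s t" using dist_circ_le by simp
  qed auto
  also have "\<dots> \<le> ennreal (2 * pi)" using hausdorff_outer_Icc_le[of 0 "2 * pi"] by simp
  finally show "hausdorff_outer 1 (sphere (0 :: real^2) 1) \<le> ennreal (2 * pi)"
    by (simp add: sphere_eq_circ_image(1))
next
  have inj: "inj_on circ {0..<2 * pi}"
  proof (rule inj_onI)
    fix s t assume st: "s \<in> {0..<2 * pi}" "t \<in> {0..<2 * pi}" "circ s = circ t"
    then have "sin ((s - t) / 2) = 0" using dist_circ[of s t] by simp
    then have "(s - t) / 2 = 0" using st sin_eq_0_pi[of "(s - t) / 2"] by auto
    then show "s = t" by simp
  qed
  \<comment> \<open>Additivity over the arcs requires them to be Borel. A half-open arc is a compact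
    arc minus an endpoint, except for the full turn, where the endpoint is already attained at the
    start.\<close>
  have arc: "circ ` {a..<b} \<in> sets borel" if "0 \<le> a" "a < b" "b \<le> 2 * pi" for a b
  proof -
    have "circ ` {a..<b} = circ ` {a..b} - circ ` {b} \<or> circ ` {a..<b} = circ ` {a..b}"
    proof (cases "circ b \<in> circ ` {a..<b}")
      case True
      then have "circ ` {a..<b} = circ ` {a..b}" using that by (auto simp: image_iff) (metis atLeastLessThan_iff le_less)
      then show ?thesis by simp
    next
      case False
      have "{a..b} = insert b {a..<b}" using that by auto
      then have "circ ` {a..b} - circ ` {b} = circ ` {a..<b}" using False by auto
      then show ?thesis by simp
    qed
    moreover have "circ ` {a..b} \<in> sets borel" "circ ` {b} \<in> sets borel"
      by (auto intro!: borel_compact compact_continuous_image continuous_on_circ)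
    ultimately show ?thesis by (metis sets.Diff)
  qed
  have low: "ennreal (cos (pi / real N) * (2 * pi)) \<le> hausdorff_outer 1 (sphere (0 :: real^2) 1)" if N: "N > 2" for N :: nat
  proof -
    define I where "I j = {2 * pi * real j / real N..<2 * pi * real (Suc j) / real N}" for j
    have Isub: "I j \<subseteq> {0..<2 * pi}" if "j < N" for j
    proof -
      have "2 * pi * real (Suc j) \<le> 2 * pi * real N" using that by (intro mult_left_mono) auto
      then have "2 * pi * real (Suc j) / real N \<le> 2 * pi" using N by (simp add: divide_le_eq)
      then show ?thesis by (auto simp: I_def intro: order_trans[rotated])
    qed
    have Idisj: "I i \<inter> I j = {}" if "i < j" for i j
    proof -
      have "2 * pi * real (Suc i) / real N \<le> 2 * pi * real j / real N"
        using that by (intro divide_right_mono mult_left_mono) auto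
      then show ?thesis by (auto simp: I_def)
    qed
    have disj: "disjoint_family_on (\<lambda>j. circ ` I j) {..<N}"
      unfolding disjoint_family_on_def
    proof (intro ballI impI)
      fix i j assume ij: "i \<in> {..<N}" "j \<in> {..<N}" "i \<noteq> j"
      have "I i \<inter> I j = {}" using ij Idisj[of i j] Idisj[of j i] by (auto simp: neq_iff)
      then show "circ ` I i \<inter> circ ` I j = {}"
        using inj_on_image_Int[OF inj, of "I i" "I j"] Isub[of i] Isub[of j] ij by auto
    qed
    have meas: "circ ` I j \<in> sets borel" if "j < N" for j
    proof -
      have "2 * pi * real (Suc j) \<le> 2 * pi * real N" using that by (intro mult_left_mono) auto
      then have "2 * pi * real (Suc j) / real N \<le> 2 * pi" using N by (simp add: divide_le_eq)
      moreover have "2 * pi * real j / real N < 2 * pi * real (Suc j) / real N"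
        using N by (intro divide_strict_right_mono mult_strict_left_mono) auto
      ultimately show ?thesis unfolding I_def by (intro arc) auto
    qed
    \<comment> \<open>Here \<open>h\<close> is \<open>pi / N\<close>, half the length of an arc;
      \<open>N > 2\<close> keeps it below a right angle.\<close>
    have each: "ennreal (cos (pi / real N) * (2 * pi / real N)) \<le> hausdorff_outer 1 (circ ` I j)" for j
    proof -
      have eq: "2 * pi * real (Suc j) / real N - 2 * pi * real j / real N = 2 * pi / real N"
        by (simp add: diff_divide_distrib[symmetric] algebra_simps)
      have "2 * pi * real j / real N \<le> 2 * pi * real (Suc j) / real N"
        by (intro divide_right_mono mult_left_mono) auto
      then have "ennreal (cos (pi / real N) * (2 * pi * real (Suc j) / real N - 2 * pi * real j / real N)) \<le> hausdorff_outer 1 (circ ` I j)"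
        unfolding I_def by (intro hausdorff_outer_arc_ge) (use N eq in \<open>auto simp: field_simps\<close>)
      then show ?thesis by (simp only: eq)
    qed
    have "pi / real N \<le> pi / 2" using N by (intro frac_le) auto
    moreover have "0 \<le> pi / real N" by simp
    ultimately have cp: "cos (pi / real N) \<ge> 0" using pi_gt_zero by (intro cos_ge_zero) linarith+
    have "ennreal (cos (pi / real N) * (2 * pi)) = (\<Sum>j<N. ennreal (cos (pi / real N) * (2 * pi / real N)))"
      using N cp by (subst sum_ennreal) auto
    also have "\<dots> \<le> (\<Sum>j<N. hausdorff_outer 1 (circ ` I j))" by (intro sum_mono each)
    also have "\<dots> = (\<Sum>j<N. emeasure (hausdorff_measure 1) (circ ` I j))"
      by (intro sum.cong refl emeasure_hausdorff_measure[symmetric] meas) auto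
    also have "\<dots> = emeasure (hausdorff_measure 1) (\<Union>j<N. circ ` I j)"
      using meas disj by (intro sum_emeasure) auto
    also have "\<dots> = hausdorff_outer 1 (\<Union>j<N. circ ` I j)"
      using meas by (intro emeasure_hausdorff_measure) auto
    also have "\<dots> \<le> hausdorff_outer 1 (sphere (0 :: real^2) 1)" by (intro hausdorff_outer_mono) auto
    finally show ?thesis .
  qed
  show "ennreal (2 * pi) \<le> hausdorff_outer 1 (sphere (0 :: real^2) 1)"
  proof (rule LIMSEQ_le_const2)
    have "(\<lambda>N. cos (pi / real N) * (2 * pi)) \<longlonglongrightarrow> cos 0 * (2 * pi)"
      by (intro tendsto_intros lim_const_over_n)
    then show "(\<lambda>N. ennreal (cos (pi / real N) * (2 * pi))) \<longlonglongrightarrow> ennreal (2 * pi)"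
      by (intro tendsto_ennrealI) simp
    show "\<exists>N. \<forall>n\<ge>N. ennreal (cos (pi / real n) * (2 * pi)) \<le> hausdorff_outer 1 (sphere (0 :: real^2) 1)"
      by (intro exI[of _ 3] allI impI low) simp
  qed
qed

subsection \<open>Spherical integrals and the function F\<close>

text \<open>A density keeps the whole space as carrier, so that linear maps act on it by
  \<open>distr\<close> without restricting them to the sphere.\<close>

definition sphere_measure :: "'a::euclidean_space measure" where
  "sphere_measure = density (hausdorff_measure (DIM('a) - 1)) (\<lambda>u. ennreal (indicator (sphere 0 1) u))"

lemma sphere_borel [measurable]: "sphere (a :: 'a::euclidean_space) e \<in> sets borel"
  by (intro borel_closed closed_sphere)

lemma sets_sphere_measure [simp, measurable_cong]: "sets sphere_measure = sets borel"
  by (simp add: sphere_measure_def)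

lemma space_sphere_measure [simp]: "space sphere_measure = UNIV"
  by (simp add: sphere_measure_def)

lemma nn_integral_sphere_measure:
  assumes [measurable]: "f \<in> borel_measurable borel"
  shows "(\<integral>\<^sup>+u\<in>sphere (0::'a::euclidean_space) 1. f u \<partial>hausdorff_measure (DIM('a) - 1)) = (\<integral>\<^sup>+u. f u \<partial>sphere_measure)"
  unfolding sphere_measure_def
  by (subst nn_integral_density) (auto simp: mult.commute ennreal_indicator intro!: nn_integral_cong)

lemma integral_sphere_measure:
  fixes f :: "'a::euclidean_space \<Rightarrow> real"
  assumes [measurable]: "f \<in> borel_measurable borel"
  shows "(LINT u:sphere (0::'a) 1|hausdorff_measure (DIM('a) - 1). f u) = (\<integral>u. f u \<partial>sphere_measure)"
  unfolding sphere_measure_def set_lebesgue_integral_def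
  by (subst integral_density) auto

lemma emeasure_sphere_measure_UNIV:
  "emeasure sphere_measure (UNIV :: 'a::euclidean_space set) = hausdorff_outer (DIM('a) - 1) (sphere (0::'a) 1)"
  unfolding sphere_measure_def
  by (subst emeasure_density) (auto simp: ennreal_indicator emeasure_hausdorff_measure)

lemma finite_measure_sphere_measure: "finite_measure (sphere_measure :: 'a::euclidean_space measure)"
proof (rule finite_measureI)
  show "emeasure sphere_measure (space (sphere_measure :: 'a measure)) \<noteq> \<infinity>"
    using hausdorff_outer_sphere_finite[where 'a='a]
    by (simp add: emeasure_sphere_measure_UNIV)
qed

lemma AE_sphere_measure: "AE u in sphere_measure. norm u = 1"
  unfolding sphere_measure_def
  by (subst AE_density) (auto simp: indicator_def)

lemma orthogonal_transformation_borel: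
  fixes f :: "'a::euclidean_space \<Rightarrow> 'a"
  assumes "orthogonal_transformation f"
  shows "f \<in> borel_measurable borel"
  using assms by (intro borel_measurable_continuous_onI linear_continuous_on)
    (simp add: orthogonal_transformation_def linear_linear)

text \<open>An orthogonal map is an isometry, which preserves the Hausdorff measure, and it maps the
  sphere to itself, which preserves the density.\<close>

lemma distr_sphere_measure:
  fixes f :: "'a::euclidean_space \<Rightarrow> 'a"
  assumes f: "orthogonal_transformation f"
  shows "distr sphere_measure borel f = sphere_measure"
proof -
  let ?H = "hausdorff_measure (DIM('a) - 1) :: 'a measure"
  have lin: "linear f" using f by (simp add: orthogonal_transformation_def)
  have nf: "norm (f x) = norm x" for x using f by (simp add: orthogonal_transformation_norm)
  note [measurable] = orthogonal_transformation_borel[OF f]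
  have d: "distr ?H borel f = ?H"
  proof (rule hausdorff_measure_distr_isometry)
    show "dist (f x) (f y) = dist x y" for x y
      by (simp add: dist_norm linear_diff[OF lin, symmetric] nf)
    show "surj f" using f by (rule orthogonal_transformation_surj)
  qed
  have "distr sphere_measure borel f = distr (density ?H (\<lambda>u. ennreal (indicator (sphere 0 1) (f u)))) borel f"
    by (simp add: sphere_measure_def indicator_def nf)
  also have "\<dots> = density (distr ?H borel f) (\<lambda>u. ennreal (indicator (sphere 0 1) u))"
    by (subst density_distr) auto
  also have "\<dots> = sphere_measure" by (simp only: d sphere_measure_def)
  finally show ?thesis .
qed

lemma nn_integral_sphere_measure_rotate:
  fixes f :: "'a::euclidean_space \<Rightarrow> 'a"
  assumes f: "orthogonal_transformation f" and [measurable]: "g \<in> borel_measurable borel"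
  shows "(\<integral>\<^sup>+u. g (f u) \<partial>sphere_measure) = (\<integral>\<^sup>+u. g u \<partial>sphere_measure)"
proof -
  note [measurable] = orthogonal_transformation_borel[OF f]
  have "(\<integral>\<^sup>+u. g u \<partial>distr sphere_measure borel f) = (\<integral>\<^sup>+u. g (f u) \<partial>sphere_measure)"
    by (subst nn_integral_distr) auto
  then show ?thesis by (simp add: distr_sphere_measure[OF f])
qed

section \<open>Averaging over rotations of a plane\<close>

lemma orthogonal_transformation_plane_rotation:
  fixes e1 e2 :: "'a::euclidean_space"
  assumes e: "norm e1 = 1" "norm e2 = 1" "e1 \<bullet> e2 = 0" and cs: "c\<^sup>2 + s\<^sup>2 = 1"
  obtains f where "orthogonal_transformation f" "\<And>u. f u \<bullet> e1 = c * (u \<bullet> e1) - s * (u \<bullet> e2)"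
    "\<And>u. f u \<bullet> e2 = s * (u \<bullet> e1) + c * (u \<bullet> e2)"
proof -
  \<comment> \<open>Rotation of the plane of \<open>e1\<close> and \<open>e2\<close> that fixes its
    orthogonal complement: the correction terms are the rotation minus the identity, applied to the
    projection of \<open>u\<close>.\<close>
  define f where "f u = u + ((c - 1) * (u \<bullet> e1) - s * (u \<bullet> e2)) *\<^sub>R e1 + (s * (u \<bullet> e1) + (c - 1) * (u \<bullet> e2)) *\<^sub>R e2" for u :: 'a
  have ee: "e1 \<bullet> e1 = 1" "e2 \<bullet> e2 = 1" "e1 \<bullet> e2 = 0" "e2 \<bullet> e1 = 0"
    using e by (auto simp: norm_eq_1 inner_commute)
  have 1: "f u \<bullet> e1 = c * (u \<bullet> e1) - s * (u \<bullet> e2)" "f u \<bullet> e2 = s * (u \<bullet> e1) + c * (u \<bullet> e2)" for u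
    by (simp_all add: f_def inner_add_left ee algebra_simps)
  have "linear f"
    by (rule linearI) (simp_all add: f_def inner_add_left scaleR_add_left scaleR_add_right algebra_simps)
  moreover have "norm (f u) = norm u" for u
  proof -
    let ?a = "u \<bullet> e1" and ?b = "u \<bullet> e2"
    let ?p = "(c - 1) * ?a - s * ?b" and ?q = "s * ?a + (c - 1) * ?b"
    have "f u \<bullet> f u = u \<bullet> u + ?p * ?p + ?q * ?q + 2 * ?p * ?a + 2 * ?q * ?b"
      unfolding f_def by (simp add: inner_add_left inner_add_right ee inner_commute algebra_simps)
    also have "\<dots> = u \<bullet> u + (c\<^sup>2 + s\<^sup>2 - 1) * (?a\<^sup>2 + ?b\<^sup>2)"
      by (simp add: power2_eq_square algebra_simps)
    finally show ?thesis by (simp add: cs norm_eq_sqrt_inner)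
  qed
  ultimately have "orthogonal_transformation f" by (simp add: orthogonal_transformation)
  with 1 show ?thesis by (intro that)
qed

text \<open>The shifted period is cut at \<open>T\<close>, and the part beyond \<open>T\<close> is
  moved back by one period.\<close>

lemma nn_integral_periodic_shift:
  fixes p :: "real \<Rightarrow> ennreal"
  assumes [measurable]: "p \<in> borel_measurable borel" and per: "\<And>x. p (x + T) = p x" and T: "T > 0" and w: "0 \<le> w" "w \<le> T"
  shows "(\<integral>\<^sup>+x. p (x + w) * indicator {0..<T} x \<partial>lborel) = (\<integral>\<^sup>+x. p x * indicator {0..<T} x \<partial>lborel)"
proof -
  have "(\<integral>\<^sup>+x. p x * indicator {w..<w + T} x \<partial>lborel) = (\<integral>\<^sup>+x. p (w + 1 * x) * indicator {w..<w + T} (w + 1 * x) \<partial>lborel)"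
    by (subst nn_integral_real_affine[where c=1 and t=w]) auto
  also have "\<dots> = (\<integral>\<^sup>+x. p (x + w) * indicator {0..<T} x \<partial>lborel)"
    by (intro nn_integral_cong) (auto simp: indicator_def add.commute)
  finally have 1: "(\<integral>\<^sup>+x. p (x + w) * indicator {0..<T} x \<partial>lborel) = (\<integral>\<^sup>+x. p x * indicator {w..<w + T} x \<partial>lborel)" ..
  have "(\<integral>\<^sup>+x. p x * indicator {T..<T + w} x \<partial>lborel) = (\<integral>\<^sup>+x. p (T + 1 * x) * indicator {T..<T + w} (T + 1 * x) \<partial>lborel)"
    by (subst nn_integral_real_affine[where c=1 and t=T]) auto
  also have "\<dots> = (\<integral>\<^sup>+x. p x * indicator {0..<w} x \<partial>lborel)"
    using per by (intro nn_integral_cong) (auto simp: indicator_def add.commute)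
  finally have 2: "(\<integral>\<^sup>+x. p x * indicator {T..<T + w} x \<partial>lborel) = (\<integral>\<^sup>+x. p x * indicator {0..<w} x \<partial>lborel)" .
  have "(\<integral>\<^sup>+x. p x * indicator {w..<w + T} x \<partial>lborel) = (\<integral>\<^sup>+x. p x * indicator {w..<T} x + p x * indicator {T..<T + w} x \<partial>lborel)"
    using w by (intro nn_integral_cong) (auto simp: indicator_def)
  also have "\<dots> = (\<integral>\<^sup>+x. p x * indicator {w..<T} x \<partial>lborel) + (\<integral>\<^sup>+x. p x * indicator {0..<w} x \<partial>lborel)"
    by (subst nn_integral_add) (auto simp: 2)
  also have "\<dots> = (\<integral>\<^sup>+x. p x * indicator {w..<T} x + p x * indicator {0..<w} x \<partial>lborel)"
    by (subst nn_integral_add) auto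
  also have "\<dots> = (\<integral>\<^sup>+x. p x * indicator {0..<T} x \<partial>lborel)"
    using w by (intro nn_integral_cong) (auto simp: indicator_def)
  finally show ?thesis using 1 by simp
qed

text \<open>
  The left-hand integral does not change if the plane of \<open>e1\<close> and \<open>e2\<close> is rotated; integrating over
  the angle of rotation separates the radial from the angular part.
\<close>

lemma sphere_plane_average:
  fixes e1 e2 :: "'a::euclidean_space" and h :: "real \<times> real \<Rightarrow> ennreal"
  assumes e: "norm e1 = 1" "norm e2 = 1" "e1 \<bullet> e2 = 0"
    and [measurable]: "h \<in> borel_measurable borel"
    and hom: "\<And>s a b. s \<ge> 0 \<Longrightarrow> h (s * a, s * b) = ennreal (s powr r) * h (a, b)"
  shows "ennreal (2 * pi) * (\<integral>\<^sup>+u. h (u \<bullet> e1, u \<bullet> e2) \<partial>sphere_measure) =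
    (\<integral>\<^sup>+u. ennreal (sqrt ((u \<bullet> e1)\<^sup>2 + (u \<bullet> e2)\<^sup>2) powr r) \<partial>sphere_measure) *
    (\<integral>\<^sup>+\<theta>. h (cos \<theta>, sin \<theta>) * indicator {0..<2 * pi} \<theta> \<partial>lborel)"
proof -
  interpret fs: finite_measure "sphere_measure :: 'a measure" by (rule finite_measure_sphere_measure)
  interpret pair_sigma_finite "sphere_measure :: 'a measure" "lborel :: real measure" ..
  let ?G = "\<integral>\<^sup>+u. h (u \<bullet> e1, u \<bullet> e2) \<partial>sphere_measure"
  let ?P = "\<integral>\<^sup>+\<theta>. h (cos \<theta>, sin \<theta>) * indicator {0..<2 * pi} \<theta> \<partial>lborel"
  have rot: "(\<integral>\<^sup>+u. h (cos \<theta> * (u \<bullet> e1) - sin \<theta> * (u \<bullet> e2), sin \<theta> * (u \<bullet> e1) + cos \<theta> * (u \<bullet> e2)) \<partial>sphere_measure) = ?G" for \<theta>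
  proof -
    obtain f where f: "orthogonal_transformation f" "\<And>u. f u \<bullet> e1 = cos \<theta> * (u \<bullet> e1) - sin \<theta> * (u \<bullet> e2)"
      "\<And>u. f u \<bullet> e2 = sin \<theta> * (u \<bullet> e1) + cos \<theta> * (u \<bullet> e2)"
      using orthogonal_transformation_plane_rotation[OF e, of "cos \<theta>" "sin \<theta>"] by auto
    show ?thesis
      using nn_integral_sphere_measure_rotate[OF f(1), of "\<lambda>u. h (u \<bullet> e1, u \<bullet> e2)"] by (simp add: f)
  qed
  have inner: "(\<integral>\<^sup>+\<theta>. h (cos \<theta> * a - sin \<theta> * b, sin \<theta> * a + cos \<theta> * b) * indicator {0..<2 * pi} \<theta> \<partial>lborel) =
      ennreal (sqrt (a\<^sup>2 + b\<^sup>2) powr r) * ?P" for a b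
  proof -
    define \<rho> where "\<rho> = sqrt (a\<^sup>2 + b\<^sup>2)"
    have r0: "\<rho> \<ge> 0" by (simp add: \<rho>_def)
    \<comment> \<open>Polar form of \<open>(a, b)\<close>. At the origin any angle is suitable. By
      homogeneity the radius comes out as a factor, and the angle \<open>w\<close> disappears by
      periodicity.\<close>
    obtain w where w: "0 \<le> w" "w < 2 * pi" "a = \<rho> * cos w" "b = \<rho> * sin w"
    proof (cases "\<rho> = 0")
      case True
      then have "a = 0" "b = 0" by (auto simp: \<rho>_def sum_power2_eq_zero_iff)
      then show ?thesis using True by (intro that[of 0]) auto
    next
      case False
      have "(a / \<rho>)\<^sup>2 + (b / \<rho>)\<^sup>2 = (a\<^sup>2 + b\<^sup>2) / \<rho>\<^sup>2" by (simp add: power_divide add_divide_distrib)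
      also have "\<rho>\<^sup>2 = a\<^sup>2 + b\<^sup>2" by (simp add: \<rho>_def)
      finally have "(a / \<rho>)\<^sup>2 + (b / \<rho>)\<^sup>2 = 1" using False \<open>\<rho>\<^sup>2 = a\<^sup>2 + b\<^sup>2\<close> by (metis divide_self power_not_zero)
      then obtain t where "0 \<le> t" "t < 2 * pi" "a / \<rho> = cos t" "b / \<rho> = sin t" by (rule sincos_total_2pi)
      then show ?thesis using False by (intro that[of t]) (auto simp: field_simps)
    qed
    have *: "h (cos \<theta> * a - sin \<theta> * b, sin \<theta> * a + cos \<theta> * b) = ennreal (\<rho> powr r) * h (cos (\<theta> + w), sin (\<theta> + w))" for \<theta>
      unfolding w(3,4) hom[OF r0, symmetric] by (simp add: cos_add sin_add algebra_simps)
    have "(\<integral>\<^sup>+\<theta>. h (cos \<theta> * a - sin \<theta> * b, sin \<theta> * a + cos \<theta> * b) * indicator {0..<2 * pi} \<theta> \<partial>lborel) =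
       ennreal (\<rho> powr r) * (\<integral>\<^sup>+\<theta>. h (cos (\<theta> + w), sin (\<theta> + w)) * indicator {0..<2 * pi} \<theta> \<partial>lborel)"
      unfolding * by (simp add: mult.assoc nn_integral_cmult)
    also have "(\<integral>\<^sup>+\<theta>. h (cos (\<theta> + w), sin (\<theta> + w)) * indicator {0..<2 * pi} \<theta> \<partial>lborel) = ?P"
      using w by (intro nn_integral_periodic_shift[where p="\<lambda>\<theta>. h (cos \<theta>, sin \<theta>)"]) auto
    finally show ?thesis by (simp add: \<rho>_def)
  qed
  have "ennreal (2 * pi) * ?G = (\<integral>\<^sup>+\<theta>. ?G * indicator {0..<2 * pi} \<theta> \<partial>lborel)"
    by (subst nn_integral_cmult_indicator) (auto simp: mult.commute)
  also have "\<dots> = (\<integral>\<^sup>+\<theta>. (\<integral>\<^sup>+u. h (cos \<theta> * (u \<bullet> e1) - sin \<theta> * (u \<bullet> e2), sin \<theta> * (u \<bullet> e1) + cos \<theta> * (u \<bullet> e2)) * indicator {0..<2 * pi} \<theta> \<partial>sphere_measure) \<partial>lborel)"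
    by (subst nn_integral_multc) (auto simp: rot)
  also have "\<dots> = (\<integral>\<^sup>+u. (\<integral>\<^sup>+\<theta>. h (cos \<theta> * (u \<bullet> e1) - sin \<theta> * (u \<bullet> e2), sin \<theta> * (u \<bullet> e1) + cos \<theta> * (u \<bullet> e2)) * indicator {0..<2 * pi} \<theta> \<partial>lborel) \<partial>sphere_measure)"
    by (intro Fubini') measurable
  also have "\<dots> = (\<integral>\<^sup>+u. ennreal (sqrt ((u \<bullet> e1)\<^sup>2 + (u \<bullet> e2)\<^sup>2) powr r) * ?P \<partial>sphere_measure)"
    by (simp only: inner)
  also have "\<dots> = (\<integral>\<^sup>+u. ennreal (sqrt ((u \<bullet> e1)\<^sup>2 + (u \<bullet> e2)\<^sup>2) powr r) \<partial>sphere_measure) * ?P"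
    by (subst nn_integral_multc) auto
  finally show ?thesis .
qed

section \<open>The maximum of two sinusoids over a period\<close>

definition cos_int :: "real \<Rightarrow> real" where
  "cos_int r = (LBINT \<theta>:{- (pi / 2)..pi / 2}. cos \<theta> powr r)"

lemma nn_integral_cos_powr:
  assumes "- (pi / 2) \<le> a" "b \<le> pi / 2" "r > 0"
  shows "(\<integral>\<^sup>+\<theta>. ennreal (cos \<theta> powr r) * indicator {a..b} \<theta> \<partial>lborel) = ennreal (LBINT \<theta>:{a..b}. cos \<theta> powr r)"
    "set_integrable lborel {a..b} (\<lambda>\<theta>. cos \<theta> powr r)"
proof -
  have c: "0 \<le> cos \<theta>" if "\<theta> \<in> {a..b}" for \<theta> using that assms by (intro cos_ge_zero) auto
  show int: "set_integrable lborel {a..b} (\<lambda>\<theta>. cos \<theta> powr r)"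
    unfolding set_integrable_def
  proof (rule Bochner_Integration.integrable_bound)
    show "integrable lborel (\<lambda>\<theta>. indicator {a..b} \<theta> :: real)"
      by (rule integrable_real_indicator) (simp_all add: emeasure_lborel_Icc_eq)
    show "AE \<theta> in lborel. norm (indicator {a..b} \<theta> *\<^sub>R cos \<theta> powr r) \<le> norm (indicator {a..b} \<theta> :: real)"
      using c assms(3) by (auto simp: indicator_def intro!: powr_le1 AE_I2)
  qed simp
  have "(\<integral>\<^sup>+\<theta>. ennreal (cos \<theta> powr r) * indicator {a..b} \<theta> \<partial>lborel) = (\<integral>\<^sup>+\<theta>. ennreal (indicator {a..b} \<theta> *\<^sub>R (cos \<theta> powr r)) \<partial>lborel)"
    by (intro nn_integral_cong) (auto simp: indicator_def)
  also have "\<dots> = ennreal (LBINT \<theta>:{a..b}. cos \<theta> powr r)"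
    unfolding set_lebesgue_integral_def
    using int by (intro nn_integral_eq_integral) (auto simp: set_integrable_def)
  finally show "(\<integral>\<^sup>+\<theta>. ennreal (cos \<theta> powr r) * indicator {a..b} \<theta> \<partial>lborel) = ennreal (LBINT \<theta>:{a..b}. cos \<theta> powr r)" .
qed

lemma cos_int_pos:
  assumes "r > 0"
  shows "cos_int r > 0"
proof -
  have nn: "cos_int r \<ge> 0" unfolding cos_int_def set_lebesgue_integral_def by (intro integral_nonneg_AE) auto
  have "cos_int r \<noteq> 0"
  proof
    assume "cos_int r = 0"
    then have "(\<integral>\<^sup>+\<theta>. ennreal (cos \<theta> powr r) * indicator {- (pi / 2)..pi / 2} \<theta> \<partial>lborel) = 0"
      using nn_integral_cos_powr(1)[of "- (pi / 2)" "pi / 2" r] assms by (simp add: cos_int_def)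
    then have "AE \<theta> in lborel. ennreal (cos \<theta> powr r) * indicator {- (pi / 2)..pi / 2} \<theta> = 0"
      by (subst (asm) nn_integral_0_iff_AE) auto
    then have "AE \<theta> in lborel. \<theta> \<notin> {- (pi / 2)<..<pi / 2}"
    proof eventually_elim
      case (elim \<theta>)
      show ?case
      proof
        assume t: "\<theta> \<in> {- (pi / 2)<..<pi / 2}"
        then have "cos \<theta> > 0" by (intro cos_gt_zero_pi) auto
        then show False using elim t by (auto simp: indicator_def split: if_splits)
      qed
    qed
    then have "{- (pi / 2)<..<pi / 2} \<in> null_sets lborel"
      by (subst AE_iff_null_sets) auto
    then have "emeasure lborel {- (pi / 2)<..<pi / 2} = 0" by (rule null_setsD1)
    then show False by (subst (asm) emeasure_lborel_Ioo) auto
  qed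
  then show ?thesis using nn by simp
qed

lemma nn_integral_circle_max:
  assumes t: "0 \<le> t" and \<phi>: "0 < \<phi>" "\<phi> < pi" and r: "r > 0"
  shows "(\<integral>\<^sup>+\<theta>. ennreal (max (max (t * cos \<theta>) (cos \<phi> * cos \<theta> + sin \<phi> * sin \<theta>)) 0 powr r) * indicator {0..<2 * pi} \<theta> \<partial>lborel) =
    ennreal (t powr r * (LBINT \<theta>:{- (pi / 2)..alpha t \<phi>}. cos \<theta> powr r) +
      (LBINT \<theta>:{alpha t \<phi> - \<phi>..pi / 2}. cos \<theta> powr r))"
    and "- (pi / 2) \<le> alpha t \<phi> - \<phi>" "alpha t \<phi> \<in> {- (pi / 2)<..<pi / 2}"
proof -
  define \<alpha> where "\<alpha> = alpha t \<phi>"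
  have a: "- (pi / 2) < \<alpha>" "\<alpha> < pi / 2" using arctan_lbound arctan_ubound by (auto simp: \<alpha>_def alpha_def)
  then show "alpha t \<phi> \<in> {- (pi / 2)<..<pi / 2}" by (simp add: \<alpha>_def)
  have sp: "sin \<phi> > 0" using \<phi> by (intro sin_gt_zero) auto
  have ca: "cos \<alpha> > 0" using a by (intro cos_gt_zero_pi) auto
  have "tan \<alpha> = (t - cos \<phi>) / sin \<phi>" by (simp add: \<alpha>_def alpha_def tan_arctan)
  then have ta: "sin \<alpha> / cos \<alpha> * sin \<phi> = t - cos \<phi>" using sp by (simp add: tan_def)
  txt \<open>The vector of length \<open>t\<close> dominates exactly for angles up to \<open>\<alpha>\<close>.\<close>
  have diff: "t * cos \<theta> - cos (\<theta> - \<phi>) = sin \<phi> / cos \<alpha> * sin (\<alpha> - \<theta>)" for \<theta>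
  proof -
    have "t * cos \<theta> - cos (\<theta> - \<phi>) = (t - cos \<phi>) * cos \<theta> - sin \<theta> * sin \<phi>"
      by (simp add: cos_diff algebra_simps)
    also have "\<dots> = sin \<phi> / cos \<alpha> * sin (\<alpha> - \<theta>)"
      using ca by (simp add: ta[symmetric] sin_diff field_simps)
    finally show ?thesis .
  qed
  have le1: "cos (\<theta> - \<phi>) \<le> t * cos \<theta>" if "- (pi / 2) \<le> \<theta>" "\<theta> \<le> \<alpha>" for \<theta>
  proof -
    have "sin (\<alpha> - \<theta>) \<ge> 0" using that a by (intro sin_ge_zero) auto
    then have "t * cos \<theta> - cos (\<theta> - \<phi>) \<ge> 0" unfolding diff using sp ca by simp
    then show ?thesis by simp
  qed
  have le2: "t * cos \<theta> \<le> cos (\<theta> - \<phi>)" if "\<alpha> \<le> \<theta>" "\<theta> \<le> pi / 2" for \<theta>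
  proof -
    have "sin (\<theta> - \<alpha>) \<ge> 0" using that a by (intro sin_ge_zero) auto
    then have "sin (\<alpha> - \<theta>) \<le> 0" using sin_minus[of "\<theta> - \<alpha>"] by simp
    then have "t * cos \<theta> - cos (\<theta> - \<phi>) \<le> 0" unfolding diff using sp ca by (intro mult_nonneg_nonpos) auto
    then show ?thesis by simp
  qed
  have "0 \<le> cos (\<alpha> - \<phi>)" using le2[of \<alpha>] a t ca by (meson less_imp_le mult_nonneg_nonneg order_refl order_trans)
  \<comment> \<open>At the crossing angle \<open>cos (\<alpha> - \<phi>)\<close> is at least
    \<open>t * cos \<alpha> \<ge> 0\<close>. Since \<open>\<alpha> - \<phi>\<close> exceeds
    \<open>- 3 * pi / 2\<close>, a value below \<open>- pi / 2\<close> would make this cosine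
    negative.\<close>
  have lo: "- (pi / 2) \<le> \<alpha> - \<phi>"
  proof (rule ccontr)
    assume "\<not> ?thesis"
    then have "0 < cos (\<alpha> - \<phi> + pi)" using a \<phi> by (intro cos_gt_zero_pi) auto
    then show False using \<open>0 \<le> cos (\<alpha> - \<phi>)\<close> by simp
  qed
  then show "- (pi / 2) \<le> alpha t \<phi> - \<phi>" by (simp add: \<alpha>_def)
  let ?m = "\<lambda>\<theta>. max (max (t * cos \<theta>) (cos \<phi> * cos \<theta> + sin \<phi> * sin \<theta>)) 0"
  let ?p = "\<lambda>\<theta>. ennreal (?m \<theta> powr r)"
  have m: "?m \<theta> = max (max (t * cos \<theta>) (cos (\<theta> - \<phi>))) 0" for \<theta>
    by (simp add: cos_diff mult.commute)
  have neg: "cos x \<le> 0" if "pi / 2 \<le> x" "x \<le> 3 * pi / 2" for x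
  proof -
    have "0 \<le> cos (x - pi)" using that by (intro cos_ge_zero) auto
    then show ?thesis by (simp add: cos_diff)
  qed
  \<comment> \<open>With the period starting at \<open>- pi / 2\<close>, the three regimes are
    consecutive intervals: the first vector dominates up to \<alpha>, the second up to
    \<open>\<phi> + pi / 2\<close>, and afterwards neither is positive.\<close>
  have split: "?p (\<theta> + - (pi / 2)) * indicator {0..<2 * pi} \<theta> =
      ennreal (t powr r) * (ennreal (cos (\<theta> - pi / 2) powr r) * indicator {- (pi / 2)..<\<alpha>} (\<theta> - pi / 2)) +
      ennreal (cos (\<theta> - pi / 2 - \<phi>) powr r) * indicator {\<alpha>..\<phi> + pi / 2} (\<theta> - pi / 2)" for \<theta>
  proof -
    define x where "x = \<theta> - pi / 2"
    have "?p x * indicator {- (pi / 2)..<3 * pi / 2} x =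
      ennreal (t powr r) * (ennreal (cos x powr r) * indicator {- (pi / 2)..<\<alpha>} x) +
      ennreal (cos (x - \<phi>) powr r) * indicator {\<alpha>..\<phi> + pi / 2} x"
    proof -
      consider "x < - (pi / 2) \<or> x \<ge> 3 * pi / 2" | "- (pi / 2) \<le> x" "x < \<alpha>" | "\<alpha> \<le> x" "x \<le> pi / 2"
        | "pi / 2 < x" "x \<le> \<phi> + pi / 2" | "\<phi> + pi / 2 < x" "x < 3 * pi / 2" by linarith
      then show ?thesis
      proof cases
        case 1 then show ?thesis using a \<phi> by (auto simp: indicator_def)
      next
        case 2
        have "0 \<le> cos x" using 2 a by (intro cos_ge_zero) auto
        then have "?m x = t * cos x" unfolding m using le1[of x] 2 t by auto
        then show ?thesis using 2 a t \<open>0 \<le> cos x\<close> by (auto simp: indicator_def powr_mult ennreal_mult)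
      next
        case 3
        have "0 \<le> cos x" using 3 a by (intro cos_ge_zero) auto
        then have "0 \<le> t * cos x" using t by simp
        then have "?m x = cos (x - \<phi>)" unfolding m using le2[of x] 3 by auto
        then show ?thesis using 3 a \<phi> by (auto simp: indicator_def)
      next
        case 4
        have "cos x \<le> 0" using 4 \<phi> by (intro neg) auto
        then have "t * cos x \<le> 0" using t by (simp add: mult_nonneg_nonpos)
        moreover have "0 \<le> cos (x - \<phi>)" using 4 \<phi> by (intro cos_ge_zero) auto
        ultimately have "?m x = cos (x - \<phi>)" unfolding m by auto
        then show ?thesis using 4 a \<phi> by (auto simp: indicator_def)
      next
        case 5
        have "cos x \<le> 0" using 5 \<phi> by (intro neg) auto
        then have "t * cos x \<le> 0" using t by (simp add: mult_nonneg_nonpos)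
        moreover have "cos (x - \<phi>) \<le> 0" using 5 \<phi> by (intro neg) auto
        ultimately have "?m x = 0" unfolding m by auto
        then show ?thesis using 5 a \<phi> r by (auto simp: indicator_def)
      qed
    qed
    then show ?thesis by (simp add: x_def indicator_def algebra_simps)
  qed
  have shift: "(\<integral>\<^sup>+\<theta>. g (\<theta> - c) \<partial>lborel) = (\<integral>\<^sup>+\<theta>. g \<theta> \<partial>lborel)" if [measurable]: "g \<in> borel_measurable borel" for g :: "real \<Rightarrow> ennreal" and c
    by (subst nn_integral_real_affine[where c=1 and t="-c" and f=g]) auto
  \<comment> \<open>A shift by \<open>- pi / 2\<close> is, modulo the period, a shift by
    \<open>3 * pi / 2\<close>, which lies in the range covered by
    \<open>nn_integral_periodic_shift\<close>.\<close>
  have "(\<integral>\<^sup>+\<theta>. ?p \<theta> * indicator {0..<2 * pi} \<theta> \<partial>lborel) = (\<integral>\<^sup>+\<theta>. ?p (\<theta> + - (pi / 2)) * indicator {0..<2 * pi} \<theta> \<partial>lborel)"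
  proof -
    have "(\<integral>\<^sup>+\<theta>. ?p (\<theta> + - (pi / 2)) * indicator {0..<2 * pi} \<theta> \<partial>lborel) = (\<integral>\<^sup>+\<theta>. ?p (\<theta> + 3 * pi / 2) * indicator {0..<2 * pi} \<theta> \<partial>lborel)"
    proof (intro nn_integral_cong)
      fix \<theta>
      have "cos (\<theta> + 3 * pi / 2) = cos (\<theta> + - (pi / 2) + 2 * pi)" "sin (\<theta> + 3 * pi / 2) = sin (\<theta> + - (pi / 2) + 2 * pi)"
        by (simp_all add: algebra_simps)
      then have "cos (\<theta> + 3 * pi / 2) = cos (\<theta> + - (pi / 2))" "sin (\<theta> + 3 * pi / 2) = sin (\<theta> + - (pi / 2))"
        by (simp_all only: cos_periodic sin_periodic)
      then show "?p (\<theta> + - (pi / 2)) * indicator {0..<2 * pi} \<theta> = ?p (\<theta> + 3 * pi / 2) * indicator {0..<2 * pi} \<theta>"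
        by (simp only:)
    qed
    also have "\<dots> = (\<integral>\<^sup>+\<theta>. ?p \<theta> * indicator {0..<2 * pi} \<theta> \<partial>lborel)"
      by (rule nn_integral_periodic_shift) auto
    finally show ?thesis ..
  qed
  also have "\<dots> = (\<integral>\<^sup>+\<theta>. ennreal (t powr r) * (ennreal (cos (\<theta> - pi / 2) powr r) * indicator {- (pi / 2)..<\<alpha>} (\<theta> - pi / 2)) +
      ennreal (cos (\<theta> - pi / 2 - \<phi>) powr r) * indicator {\<alpha>..\<phi> + pi / 2} (\<theta> - pi / 2) \<partial>lborel)"
    by (simp only: split)
  also have "\<dots> = (\<integral>\<^sup>+\<theta>. ennreal (t powr r) * (ennreal (cos \<theta> powr r) * indicator {- (pi / 2)..<\<alpha>} \<theta>) +
      ennreal (cos (\<theta> - \<phi>) powr r) * indicator {\<alpha>..\<phi> + pi / 2} \<theta> \<partial>lborel)"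
    by (rule shift) measurable
  also have "\<dots> = ennreal (t powr r) * (\<integral>\<^sup>+\<theta>. ennreal (cos \<theta> powr r) * indicator {- (pi / 2)..<\<alpha>} \<theta> \<partial>lborel) +
      (\<integral>\<^sup>+\<theta>. ennreal (cos (\<theta> - \<phi>) powr r) * indicator {\<alpha>..\<phi> + pi / 2} \<theta> \<partial>lborel)"
    by (subst nn_integral_add) (auto simp: nn_integral_cmult)
  also have "(\<integral>\<^sup>+\<theta>. ennreal (cos \<theta> powr r) * indicator {- (pi / 2)..<\<alpha>} \<theta> \<partial>lborel) = (\<integral>\<^sup>+\<theta>. ennreal (cos \<theta> powr r) * indicator {- (pi / 2)..\<alpha>} \<theta> \<partial>lborel)"
    using AE_lborel_singleton[of \<alpha>] by (intro nn_integral_cong_AE) (auto simp: indicator_def elim!: eventually_mono)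
  also have "\<dots> = ennreal (LBINT \<theta>:{- (pi / 2)..\<alpha>}. cos \<theta> powr r)"
    using a r by (intro nn_integral_cos_powr) auto
  also have "(\<integral>\<^sup>+\<theta>. ennreal (cos (\<theta> - \<phi>) powr r) * indicator {\<alpha>..\<phi> + pi / 2} \<theta> \<partial>lborel) =
      (\<integral>\<^sup>+\<theta>. ennreal (cos (\<theta> - \<phi>) powr r) * indicator {\<alpha> - \<phi>..pi / 2} (\<theta> - \<phi>) \<partial>lborel)"
    by (intro nn_integral_cong) (auto simp: indicator_def)
  also have "\<dots> = (\<integral>\<^sup>+\<theta>. ennreal (cos \<theta> powr r) * indicator {\<alpha> - \<phi>..pi / 2} \<theta> \<partial>lborel)"
    by (rule shift) measurable
  also have "\<dots> = ennreal (LBINT \<theta>:{\<alpha> - \<phi>..pi / 2}. cos \<theta> powr r)"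
    using lo r by (intro nn_integral_cos_powr) auto
  also have "ennreal (t powr r) * ennreal (LBINT \<theta>:{- (pi / 2)..\<alpha>}. cos \<theta> powr r) + \<dots> =
     ennreal (t powr r * (LBINT \<theta>:{- (pi / 2)..\<alpha>}. cos \<theta> powr r) + (LBINT \<theta>:{\<alpha> - \<phi>..pi / 2}. cos \<theta> powr r))"
    by (subst ennreal_mult[symmetric]) (auto simp: set_lebesgue_integral_def intro!: integral_nonneg_AE)
  finally show "(\<integral>\<^sup>+\<theta>. ?p \<theta> * indicator {0..<2 * pi} \<theta> \<partial>lborel) = ennreal (t powr r * (LBINT \<theta>:{- (pi / 2)..alpha t \<phi>}. cos \<theta> powr r) +
      (LBINT \<theta>:{alpha t \<phi> - \<phi>..pi / 2}. cos \<theta> powr r))" by (simp add: \<alpha>_def)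
qed

section \<open>The constants c(n,r) and spherical integrals of linear forms\<close>

lemma orthogonal_transformation_exists_unit:
  fixes a b :: "real^'n"
  assumes "norm a = norm b"
  obtains f where "orthogonal_transformation f" "f a = b"
  using orthogonal_transformation_exists[OF assms] by blast

lemma sphere_integral_direction:
  fixes a b :: "real^'n" and p :: "real \<Rightarrow> ennreal"
  assumes ab: "norm a = norm b" and [measurable]: "p \<in> borel_measurable borel"
  shows "(\<integral>\<^sup>+u. p (a \<bullet> u) \<partial>sphere_measure) = (\<integral>\<^sup>+u. p (b \<bullet> u) \<partial>sphere_measure)"
proof -
  obtain f where f: "orthogonal_transformation f" "f a = b" by (rule orthogonal_transformation_exists_unit[OF ab])
  have "(\<integral>\<^sup>+u. p (b \<bullet> f u) \<partial>sphere_measure) = (\<integral>\<^sup>+u. p (b \<bullet> u) \<partial>sphere_measure)"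
    by (rule nn_integral_sphere_measure_rotate[OF f(1), where g="\<lambda>u. p (b \<bullet> u)"]) measurable
  moreover have "b \<bullet> f u = a \<bullet> u" for u using f by (auto simp: orthogonal_transformation_def)
  ultimately show ?thesis by simp
qed

text \<open>The unit vector chosen by \<open>SOME\<close> can be rotated into any other one. On the
  sphere the integrand is at most 1 and the measure is finite, so the Bochner integral in
  \<open>c_const\<close> agrees with the nonnegative integral.\<close>

lemma ennreal_c_const:
  fixes e :: "real^'n"
  assumes r: "r > 0" and e: "norm e = 1"
  shows "(\<integral>\<^sup>+u. ennreal (max (e \<bullet> u) 0 powr r) \<partial>sphere_measure) = ennreal (c_const TYPE(real^'n) r)"
proof -
  interpret fs: finite_measure "sphere_measure :: (real^'n) measure" by (rule finite_measure_sphere_measure)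
  define e' where "e' = (SOME e :: real^'n. norm e = 1)"
  have e': "norm e' = 1" unfolding e'_def using e by (rule someI)
  have int: "integrable sphere_measure (\<lambda>u. max (e' \<bullet> u) 0 powr r)"
  proof (rule fs.integrable_const_bound[where B=1])
    show "AE u in sphere_measure. norm (max (e' \<bullet> u) 0 powr r) \<le> 1"
      using AE_sphere_measure
    proof eventually_elim
      case (elim u)
      have "e' \<bullet> u \<le> norm e' * norm u" by (rule norm_cauchy_schwarz)
      then have "max (e' \<bullet> u) 0 \<le> 1" using elim e' by auto
      then show ?case using r by (auto intro!: powr_le1)
    qed
  qed measurable
  have "(\<integral>\<^sup>+u. ennreal (max (e \<bullet> u) 0 powr r) \<partial>sphere_measure) = (\<integral>\<^sup>+u. ennreal (max (e' \<bullet> u) 0 powr r) \<partial>sphere_measure)"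
    by (rule sphere_integral_direction[where p="\<lambda>x. ennreal (max x 0 powr r)"]) (auto simp: e e')
  also have "\<dots> = ennreal (\<integral>u. max (e' \<bullet> u) 0 powr r \<partial>sphere_measure)"
    using int by (intro nn_integral_eq_integral) auto
  also have "(\<integral>u. max (e' \<bullet> u) 0 powr r \<partial>sphere_measure) = c_const TYPE(real^'n) r"
    unfolding c_const_def Let_def e'_def[symmetric]
    by (subst integral_sphere_measure) auto
  finally show ?thesis .
qed

lemma c_const_nonneg: "c_const TYPE('a::euclidean_space) r \<ge> 0"
  unfolding c_const_def Let_def set_lebesgue_integral_def by (intro integral_nonneg_AE) auto

text \<open>If the constant vanished, almost every \<open>u\<close> would have nonpositive inner
  product with all basis vectors and their negatives, hence be 0. This contradicts
  \<open>norm u = 1\<close> because the sphere has positive measure.\<close>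

lemma c_const_pos:
  assumes n: "CARD('n::finite) \<ge> 2" and r: "r > 0"
  shows "c_const TYPE(real^'n) r > 0"
proof -
  have "c_const TYPE(real^'n) r \<noteq> 0"
  proof
    assume c0: "c_const TYPE(real^'n) r = 0"
    have z: "AE u in sphere_measure. (b::real^'n) \<bullet> u \<le> 0" if "norm b = 1" for b
    proof -
      have "(\<integral>\<^sup>+u. ennreal (max (b \<bullet> u) 0 powr r) \<partial>sphere_measure) = 0"
        by (simp add: ennreal_c_const[OF r that] c0)
      then have "AE u in sphere_measure. ennreal (max (b \<bullet> u) 0 powr r) = 0"
        by (subst (asm) nn_integral_0_iff_AE) auto
      then show ?thesis by eventually_elim (auto simp: ennreal_eq_0_iff max_def split: if_splits)
    qed
    have "AE u in sphere_measure. \<forall>b\<in>Basis. (b::real^'n) \<bullet> u \<le> 0 \<and> (- b) \<bullet> u \<le> 0"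
      by (intro AE_ball_countable[THEN iffD2] ballI AE_conjI z) (auto intro: countable_finite)
    then have "AE u in (sphere_measure :: (real^'n) measure). False"
      using AE_sphere_measure
    proof eventually_elim
      case (elim u)
      have "u \<bullet> b = 0 \<bullet> b" if "b \<in> Basis" for b
        using elim(1)[rule_format, OF that] by (simp add: inner_commute[of u b])
      then have "u = 0" by (rule euclidean_eqI)
      then show ?case using elim(2) by simp
    qed
    then have "emeasure sphere_measure (UNIV :: (real^'n) set) = 0"
      by (simp add: AE_iff_measurable[OF _ refl])
    moreover have "DIM(real^'n) \<ge> 2" using n by simp
    ultimately show False using hausdorff_outer_sphere_pos[where 'a="real^'n"] by (simp add: emeasure_sphere_measure_UNIV)
  qed
  then show ?thesis using c_const_nonneg[where 'a="real^'n", of r] by simp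
qed

text \<open>The case \<open>t = 0\<close>, \<open>\<phi> = pi / 2\<close> of
  \<open>nn_integral_circle_max\<close>, where the first sinusoid vanishes and \<open>alpha\<close>
  is 0, after a quarter turn that exchanges sine and cosine.\<close>

lemma nn_integral_circle_cos:
  assumes r: "r > 0"
  shows "(\<integral>\<^sup>+\<theta>. ennreal (max (cos \<theta>) 0 powr r) * indicator {0..<2 * pi} \<theta> \<partial>lborel) = ennreal (cos_int r)"
proof -
  have "(\<integral>\<^sup>+\<theta>. ennreal (max (cos \<theta>) 0 powr r) * indicator {0..<2 * pi} \<theta> \<partial>lborel) =
     (\<integral>\<^sup>+\<theta>. ennreal (max (cos (\<theta> + pi / 2)) 0 powr r) * indicator {0..<2 * pi} \<theta> \<partial>lborel)"
    by (rule nn_integral_periodic_shift[symmetric]) auto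
  also have "\<dots> = (\<integral>\<^sup>+\<theta>. ennreal (max (max (0 * cos \<theta>) (cos (pi / 2) * cos \<theta> + sin (pi / 2) * sin \<theta>)) 0 powr r) * indicator {0..<2 * pi} \<theta> \<partial>lborel)"
    (is "?L = ?R")
  proof -
    have "?R = (\<integral>\<^sup>+\<theta>. ennreal (max (sin (\<theta> + pi)) 0 powr r) * indicator {0..<2 * pi} \<theta> \<partial>lborel)"
      by (subst nn_integral_periodic_shift[where p="\<lambda>\<theta>. ennreal (max (sin \<theta>) 0 powr r)"]) (auto simp: max.commute)
    then show ?thesis by (simp add: cos_add)
  qed
  also have "\<dots> = ennreal (0 powr r * (LBINT \<theta>:{- (pi / 2)..alpha 0 (pi / 2)}. cos \<theta> powr r) +
      (LBINT \<theta>:{alpha 0 (pi / 2) - pi / 2..pi / 2}. cos \<theta> powr r))"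
    by (rule nn_integral_circle_max) (use r in auto)
  also have "\<dots> = ennreal (cos_int r)"
    using r by (simp add: alpha_def cos_int_def)
  finally show ?thesis .
qed

lemma homogeneous_max_powr:
  "s \<ge> 0 \<Longrightarrow> ennreal (max (s * x) 0 powr r) = ennreal (s powr r) * ennreal (max x 0 powr r)"
  by (cases "x \<ge> 0") (auto simp: max_def powr_mult ennreal_mult mult_le_0_iff mult_nonneg_nonpos)

text \<open>In the plane the radial factor of \<open>sphere_plane_average\<close> is 1 on the
  circle, so it integrates to the length of the circle and cancels the factor \<open>2 * pi\<close>
  on the other side.\<close>

lemma c_const_2: "c_const TYPE(real^2) r = cos_int r" if r: "r > 0"
proof -
  let ?e1 = "axis 1 1 :: real^2" and ?e2 = "axis 2 1 :: real^2"
  have e: "norm ?e1 = 1" "norm ?e2 = 1" "?e1 \<bullet> ?e2 = 0" by (auto simp: inner_axis_axis)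
  define h where "h = (\<lambda>p :: real \<times> real. ennreal (max (fst p) 0 powr r))"
  have hm: "h \<in> borel_measurable borel"
  proof -
    have "fst \<in> borel_measurable (borel :: (real \<times> real) measure)"
      by (intro borel_measurable_continuous_onI continuous_intros)
    moreover have "(\<lambda>x. ennreal (max x 0 powr r)) \<in> borel_measurable borel" by measurable
    ultimately show ?thesis unfolding h_def by (rule measurable_compose)
  qed
  have "ennreal (2 * pi) * (\<integral>\<^sup>+u. h (u \<bullet> ?e1, u \<bullet> ?e2) \<partial>sphere_measure) =
    (\<integral>\<^sup>+u. ennreal (sqrt ((u \<bullet> ?e1)\<^sup>2 + (u \<bullet> ?e2)\<^sup>2) powr r) \<partial>sphere_measure) *
    (\<integral>\<^sup>+\<theta>. h (cos \<theta>, sin \<theta>) * indicator {0..<2 * pi} \<theta> \<partial>lborel)"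
    by (rule sphere_plane_average[OF e hm]) (auto simp: h_def homogeneous_max_powr)
  also have "(\<integral>\<^sup>+\<theta>. h (cos \<theta>, sin \<theta>) * indicator {0..<2 * pi} \<theta> \<partial>lborel) = ennreal (cos_int r)"
    by (simp add: h_def nn_integral_circle_cos[OF r])
  also have "(\<integral>\<^sup>+u. h (u \<bullet> ?e1, u \<bullet> ?e2) \<partial>sphere_measure) = ennreal (c_const TYPE(real^2) r)"
    by (simp add: h_def ennreal_c_const[OF r e(1), symmetric] inner_commute)
  also have "(\<integral>\<^sup>+u. ennreal (sqrt ((u \<bullet> ?e1)\<^sup>2 + (u \<bullet> ?e2)\<^sup>2) powr r) \<partial>sphere_measure) = (\<integral>\<^sup>+u. 1 \<partial>(sphere_measure :: (real^2) measure))"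
    using AE_sphere_measure by (intro nn_integral_cong_AE) (auto simp: inner_axis norm_vec2 elim!: eventually_mono)
  also have "\<dots> = ennreal (2 * pi)"
    using hausdorff_outer_circle by (simp add: emeasure_sphere_measure_UNIV)
  finally have "ennreal (2 * pi * c_const TYPE(real^2) r) = ennreal (2 * pi * cos_int r)"
    using c_const_nonneg[where 'a="real^2", of r] cos_int_pos[OF r] by (simp add: ennreal_mult)
  then show ?thesis
    using c_const_nonneg[where 'a="real^2", of r] cos_int_pos[OF r] by (simp add: ennreal_inj)
qed

lemma nn_integral_circle_max_F:
  assumes "0 \<le> t" "0 < \<phi>" "\<phi> < pi" "r > 0"
  shows "(\<integral>\<^sup>+\<theta>. ennreal (max (max (t * cos \<theta>) (cos \<phi> * cos \<theta> + sin \<phi> * sin \<theta>)) 0 powr r) * indicator {0..<2 * pi} \<theta> \<partial>lborel) =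
    ennreal (cos_int r * F r t \<phi>)"
  unfolding nn_integral_circle_max[OF assms] F_def using c_const_2[OF assms(4)] cos_int_pos[OF assms(4)] by simp

text \<open>Dropping the vector of length \<open>t\<close> from the maximum leaves the shifted
  cosine, whose integral is exactly the normalising constant of F.\<close>

lemma F_ge_1:
  assumes "0 \<le> t" "0 < \<phi>" "\<phi> < pi" "r > 0"
  shows "F r t \<phi> \<ge> 1"
proof -
  have cosper: "cos (\<theta> + 2 * pi - \<phi>) = cos (\<theta> - \<phi>)" for \<theta>
    using cos_periodic[of "\<theta> - \<phi>"] by (simp only: diff_add_eq)
  have per: "(\<integral>\<^sup>+\<theta>. ennreal (max (cos (\<theta> - \<phi>)) 0 powr r) * indicator {0..<2 * pi} \<theta> \<partial>lborel) = ennreal (cos_int r)"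
  proof -
    have "(\<integral>\<^sup>+\<theta>. ennreal (max (cos ((\<theta> + \<phi>) - \<phi>)) 0 powr r) * indicator {0..<2 * pi} \<theta> \<partial>lborel) =
      (\<integral>\<^sup>+\<theta>. ennreal (max (cos (\<theta> - \<phi>)) 0 powr r) * indicator {0..<2 * pi} \<theta> \<partial>lborel)"
      using assms by (intro nn_integral_periodic_shift[where p="\<lambda>\<theta>. ennreal (max (cos (\<theta> - \<phi>)) 0 powr r)"])
        (simp_all only: cosper, auto)
    then show ?thesis using nn_integral_circle_cos[OF assms(4)] by simp
  qed
  have "ennreal (cos_int r) \<le> (\<integral>\<^sup>+\<theta>. ennreal (max (max (t * cos \<theta>) (cos \<phi> * cos \<theta> + sin \<phi> * sin \<theta>)) 0 powr r) * indicator {0..<2 * pi} \<theta> \<partial>lborel)"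
    unfolding per[symmetric] using assms
    by (intro nn_integral_mono mult_right_mono ennreal_leI powr_mono2) (auto simp: cos_diff mult.commute)
  then have "ennreal (cos_int r) \<le> ennreal (cos_int r * F r t \<phi>)" by (simp only: nn_integral_circle_max_F[OF assms])
  then have "cos_int r \<le> cos_int r * F r t \<phi>"
    using cos_int_pos[OF assms(4)] by (simp add: ennreal_le_iff2)
  then show ?thesis using cos_int_pos[OF assms(4)] by simp
qed

lemma sphere_integral_single:
  fixes x :: "real^'n"
  assumes r: "r > 0"
  shows "(\<integral>\<^sup>+u. ennreal (max (x \<bullet> u) 0 powr r) \<partial>sphere_measure) = ennreal (c_const TYPE(real^'n) r * norm x powr r)"
proof (cases "x = 0")
  case False
  define e where "e = x /\<^sub>R norm x"
  have e: "norm e = 1" "x = norm x *\<^sub>R e" using False by (auto simp: e_def)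
  have "(\<integral>\<^sup>+u. ennreal (max (x \<bullet> u) 0 powr r) \<partial>sphere_measure) = (\<integral>\<^sup>+u. ennreal (norm x powr r) * ennreal (max (e \<bullet> u) 0 powr r) \<partial>sphere_measure)"
    by (subst e(2)) (simp add: homogeneous_max_powr)
  also have "\<dots> = ennreal (norm x powr r) * ennreal (c_const TYPE(real^'n) r)"
    by (subst nn_integral_cmult) (auto simp: ennreal_c_const[OF r e(1)])
  finally show ?thesis using c_const_nonneg[where 'a="real^'n", of r] by (simp add: ennreal_mult mult.commute)
qed (use r in simp)

text \<open>\<open>sphere_plane_average\<close> is used twice with the same radial factor: for the
  positive part of one coordinate, giving c(n,r), and for the maximum, giving
  \<open>cos_int r * F\<close>. Comparing the two eliminates the radial factor.\<close>

proposition sphere_integral_max: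
  fixes x y :: "real^'n"
  assumes r: "r > 0" and x: "x \<noteq> 0" and y: "y \<noteq> 0"
    and \<phi>: "\<phi> = arccos (x \<bullet> y / (norm x * norm y))" "0 < \<phi>" "\<phi> < pi"
  shows "(\<integral>\<^sup>+u. ennreal (max (max (x \<bullet> u) (y \<bullet> u)) 0 powr r) \<partial>sphere_measure) =
    ennreal (c_const TYPE(real^'n) r * norm y powr r * F r (norm x / norm y) \<phi>)"
proof -
  let ?t = "norm x / norm y"
  let ?q = "x \<bullet> y / (norm x * norm y)"
  have q: "-1 \<le> ?q" "?q \<le> 1"
    using Cauchy_Schwarz_ineq2[of x y] x y by (auto simp: divide_le_eq le_divide_eq abs_le_iff)
  have cq: "cos \<phi> = ?q" using q by (simp add: \<phi>(1) cos_arccos)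
  have sp: "sin \<phi> > 0" using \<phi> by (intro sin_gt_zero) auto
  define e1 where "e1 = x /\<^sub>R norm x"
  define y1 where "y1 = y /\<^sub>R norm y"
  have n1: "norm e1 = 1" "norm y1 = 1" "e1 \<bullet> y1 = cos \<phi>" using x y by (auto simp: e1_def y1_def cq field_simps)
  have ip: "e1 \<bullet> e1 = 1" "y1 \<bullet> y1 = 1" using n1 by (auto simp: norm_eq_1)
  \<comment> \<open>Gram-Schmidt: the normalised part of \<open>y1\<close> orthogonal to
    \<open>e1\<close>. The divisor \<open>sin \<phi>\<close> is positive because \<phi> lies
    strictly between 0 and pi.\<close>
  define e2 where "e2 = (1 / sin \<phi>) *\<^sub>R (y1 - cos \<phi> *\<^sub>R e1)"
  have xe: "x = norm x *\<^sub>R e1" using x by (simp add: e1_def)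
  have ye: "y1 = cos \<phi> *\<^sub>R e1 + sin \<phi> *\<^sub>R e2" using sp by (simp add: e2_def)
  have ye': "y = norm y *\<^sub>R (cos \<phi> *\<^sub>R e1 + sin \<phi> *\<^sub>R e2)" using y by (simp add: ye[symmetric] y1_def)
  have o: "e1 \<bullet> e2 = 0" by (simp add: e2_def inner_diff_right n1 ip)
  have "(y1 - cos \<phi> *\<^sub>R e1) \<bullet> (y1 - cos \<phi> *\<^sub>R e1) = 1 - (cos \<phi>)\<^sup>2"
    using n1(3) by (simp add: inner_diff_left inner_diff_right ip inner_commute power2_eq_square)
  also have "\<dots> = (sin \<phi>)\<^sup>2" by (simp add: sin_squared_eq)
  finally have "e2 \<bullet> e2 = 1" using sp by (simp add: e2_def power2_eq_square)
  then have n2: "norm e2 = 1" by (simp add: norm_eq_1)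
  have K: "cos_int r > 0" using r by (rule cos_int_pos)
  let ?J = "\<integral>\<^sup>+u. ennreal (sqrt ((u \<bullet> e1)\<^sup>2 + (u \<bullet> e2)\<^sup>2) powr r) \<partial>sphere_measure"
  let ?c = "c_const TYPE(real^'n) r"
  define h where "h = (\<lambda>p :: real \<times> real. ennreal (max (fst p) 0 powr r))"
  have hm: "h \<in> borel_measurable borel"
  proof -
    have "fst \<in> borel_measurable (borel :: (real \<times> real) measure)"
      by (intro borel_measurable_continuous_onI continuous_intros)
    moreover have "(\<lambda>x. ennreal (max x 0 powr r)) \<in> borel_measurable borel" by measurable
    ultimately show ?thesis unfolding h_def by (rule measurable_compose)
  qed
  have "ennreal (2 * pi) * (\<integral>\<^sup>+u. h (u \<bullet> e1, u \<bullet> e2) \<partial>sphere_measure) = ?J *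
    (\<integral>\<^sup>+\<theta>. h (cos \<theta>, sin \<theta>) * indicator {0..<2 * pi} \<theta> \<partial>lborel)"
    by (rule sphere_plane_average[OF n1(1) n2 o hm]) (auto simp: h_def homogeneous_max_powr)
  \<comment> \<open>This equation expresses the radial factor through c(n,r) and is what allows it
    to be eliminated below.\<close>
  then have 1: "ennreal (2 * pi) * ennreal ?c = ?J * ennreal (cos_int r)"
    by (simp add: h_def nn_integral_circle_cos[OF r] ennreal_c_const[OF r n1(1)] inner_commute[of _ e1])
  define g where "g = (\<lambda>(a, b). ennreal (max (max (?t * a) (cos \<phi> * a + sin \<phi> * b)) 0 powr r))"
  have [measurable]: "g \<in> borel_measurable borel"
    unfolding g_def by (simp add: borel_prod[symmetric] split_beta)
  have ghom: "g (s * a, s * b) = ennreal (s powr r) * g (a, b)" if s: "s \<ge> 0" for s a b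
  proof -
    have "max (?t * (s * a)) (cos \<phi> * (s * a) + sin \<phi> * (s * b)) = s * max (?t * a) (cos \<phi> * a + sin \<phi> * b)"
      using s by (simp add: max_mult_distrib_left algebra_simps)
    then show ?thesis by (simp only: g_def prod.case homogeneous_max_powr[OF s])
  qed
  have 2: "ennreal (2 * pi) * (\<integral>\<^sup>+u. g (u \<bullet> e1, u \<bullet> e2) \<partial>sphere_measure) = ?J * ennreal (cos_int r * F r ?t \<phi>)"
  proof -
    have "(\<integral>\<^sup>+\<theta>. g (cos \<theta>, sin \<theta>) * indicator {0..<2 * pi} \<theta> \<partial>lborel) = ennreal (cos_int r * F r ?t \<phi>)"
      unfolding g_def prod.case using \<phi> r by (intro nn_integral_circle_max_F) auto
    with sphere_plane_average[OF n1(1) n2 o, of g r] ghom show ?thesis by simp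
  qed
  have Fp: "F r ?t \<phi> \<ge> 1" using \<phi> r by (intro F_ge_1) auto
  have "ennreal (2 * pi) * (\<integral>\<^sup>+u. g (u \<bullet> e1, u \<bullet> e2) \<partial>sphere_measure) = ?J * (ennreal (cos_int r) * ennreal (F r ?t \<phi>))"
    using 2 K Fp by (simp add: ennreal_mult)
  also have "\<dots> = ennreal (2 * pi) * (ennreal ?c * ennreal (F r ?t \<phi>))"
    unfolding mult.assoc[symmetric] 1 ..
  finally have "ennreal (1 / (2 * pi)) * (ennreal (2 * pi) * (\<integral>\<^sup>+u. g (u \<bullet> e1, u \<bullet> e2) \<partial>sphere_measure)) =
      ennreal (1 / (2 * pi)) * (ennreal (2 * pi) * (ennreal ?c * ennreal (F r ?t \<phi>)))" by simp
  then have g: "(\<integral>\<^sup>+u. g (u \<bullet> e1, u \<bullet> e2) \<partial>sphere_measure) = ennreal ?c * ennreal (F r ?t \<phi>)"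
    unfolding mult.assoc[symmetric] by (simp add: ennreal_mult[symmetric])
  have m: "ennreal (max (max (x \<bullet> u) (y \<bullet> u)) 0 powr r) = ennreal (norm y powr r) * g (u \<bullet> e1, u \<bullet> e2)" for u
  proof -
    have "x \<bullet> u = norm x * (u \<bullet> e1)" by (subst xe) (simp add: inner_commute)
    then have 1: "x \<bullet> u = norm y * (?t * (u \<bullet> e1))" using y by simp
    have 2: "y \<bullet> u = norm y * (cos \<phi> * (u \<bullet> e1) + sin \<phi> * (u \<bullet> e2))"
      by (subst ye') (simp only: inner_scaleR_left inner_add_left inner_commute[of e1 u] inner_commute[of e2 u])
    show ?thesis unfolding 1 2 g_def prod.case
      by (subst homogeneous_max_powr[symmetric]) (simp_all only: max_mult_distrib_left norm_ge_zero if_True)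
  qed
  have "(\<integral>\<^sup>+u. ennreal (max (max (x \<bullet> u) (y \<bullet> u)) 0 powr r) \<partial>sphere_measure) = ennreal (norm y powr r) * (ennreal ?c * ennreal (F r ?t \<phi>))"
    unfolding m by (subst nn_integral_cmult) (auto simp: g)
  then show ?thesis using Fp c_const_nonneg[where 'a="real^'n", of r] by (simp add: ennreal_mult mult_ac)
qed

subsection \<open>Polar coordinates\<close>

lemma nn_integral_lborel_translate:
  fixes g :: "'a::euclidean_space \<Rightarrow> ennreal"
  assumes [measurable]: "g \<in> borel_measurable borel"
  shows "(\<integral>\<^sup>+x. g (c + x) \<partial>lborel) = (\<integral>\<^sup>+x. g x \<partial>lborel)"
  by (subst lborel_distr_plus[of c, symmetric], subst nn_integral_distr) auto

lemma lborel_distr_orthogonal_transformation: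
  fixes f :: "'a::euclidean_space \<Rightarrow> 'a"
  assumes f: "orthogonal_transformation f"
  shows "distr lborel borel f = lborel"
proof (rule measure_eqI)
  note [measurable] = orthogonal_transformation_borel[OF f]
  have lin: "linear f" and nf: "norm (f x) = norm x" for x
    using f by (auto simp: orthogonal_transformation)
  fix B assume "B \<in> sets (distr lborel borel f)"
  then have B [measurable]: "B \<in> sets borel" by simp
  txt \<open>
    The image measure is translation invariant. Evaluating the product of \<open>lborel A\<close> and the image
    measure of \<open>B\<close> with translations in either factor compares \<open>B\<close> with the ball \<open>A\<close>, on which the two
    measures agree.
  \<close>
  define A where "A = {x::'a. norm x \<le> 1}"
  have [measurable]: "A \<in> sets borel" unfolding A_def by measurable
  define k where "k = emeasure lborel A"
  have "A = cball 0 1" by (auto simp: A_def)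
  then have kA: "k = ennreal (unit_ball_vol (real DIM('a)))" by (simp add: k_def emeasure_cball)
  then have k: "k \<noteq> 0" "k \<noteq> \<top>" by (simp_all add: ennreal_eq_0_iff not_le)
  have "k * emeasure (distr lborel borel f) B = (\<integral>\<^sup>+x. indicator A x * emeasure (distr lborel borel f) B \<partial>lborel)"
    by (subst nn_integral_multc) (auto simp: k_def)
  also have "\<dots> = (\<integral>\<^sup>+x. (\<integral>\<^sup>+z. indicator A x * indicator B (f z + x) \<partial>lborel) \<partial>lborel)"
  proof (intro nn_integral_cong)
    fix x
    obtain w where w: "f w = x" using orthogonal_transformation_surj[OF f] by (metis surjD)
    have "emeasure (distr lborel borel f) B = (\<integral>\<^sup>+z. indicator B (f z) \<partial>lborel)"
    proof -
      have "(\<integral>\<^sup>+z. indicator B (f z) \<partial>lborel) = (\<integral>\<^sup>+y. indicator B y \<partial>distr lborel borel f)"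
        by (subst nn_integral_distr) auto
      then show ?thesis by simp
    qed
    also have "\<dots> = (\<integral>\<^sup>+z. indicator B (f (w + z)) \<partial>lborel)"
      by (rule nn_integral_lborel_translate[symmetric]) measurable
    also have "\<dots> = (\<integral>\<^sup>+z. indicator B (f z + x) \<partial>lborel)"
      by (simp add: linear_add[OF lin] w add.commute)
    finally show "indicator A x * emeasure (distr lborel borel f) B = (\<integral>\<^sup>+z. indicator A x * indicator B (f z + x) \<partial>lborel)"
      by (subst nn_integral_cmult) auto
  qed
  also have "\<dots> = (\<integral>\<^sup>+z. (\<integral>\<^sup>+x. indicator A x * indicator B (f z + x) \<partial>lborel) \<partial>lborel)"
    by (rule lborel_pair.Fubini') measurable
  also have "\<dots> = (\<integral>\<^sup>+z. (\<integral>\<^sup>+x. indicator A (x - f z) * indicator B x \<partial>lborel) \<partial>lborel)"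
  proof (rule nn_integral_cong)
    fix z
    show "(\<integral>\<^sup>+x. indicator A x * indicator B (f z + x) \<partial>lborel) = (\<integral>\<^sup>+x. indicator A (x - f z) * indicator B x \<partial>lborel)"
      using nn_integral_lborel_translate[of "\<lambda>x. indicator A (x - f z) * indicator B x" "f z"] by simp
  qed
  also have "\<dots> = (\<integral>\<^sup>+x. (\<integral>\<^sup>+z. indicator A (x - f z) * indicator B x \<partial>lborel) \<partial>lborel)"
    by (rule lborel_pair.Fubini') measurable
  also have "\<dots> = (\<integral>\<^sup>+x. k * indicator B x \<partial>lborel)"
  proof (intro nn_integral_cong)
    fix x
    obtain w where w: "f w = x" using orthogonal_transformation_surj[OF f] by (metis surjD)
    have "norm (x - f z) = norm (w - z)" for z by (simp add: w[symmetric] linear_diff[OF lin, symmetric] nf)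
    then have "(\<integral>\<^sup>+z. indicator A (x - f z) \<partial>lborel) = (\<integral>\<^sup>+z. indicator (cball w 1) z \<partial>lborel)"
      by (intro nn_integral_cong) (simp only: indicator_def A_def mem_Collect_eq mem_cball dist_norm)
    also have "\<dots> = k" by (simp add: kA emeasure_cball)
    finally show "(\<integral>\<^sup>+z. indicator A (x - f z) * indicator B x \<partial>lborel) = k * indicator B x"
      by (subst nn_integral_multc) auto
  qed
  also have "\<dots> = k * emeasure lborel B" by (subst nn_integral_cmult) auto
  finally show "emeasure (distr lborel borel f) B = emeasure lborel B"
    using k by (simp add: ennreal_mult_cancel_left)
qed simp

lemma nn_integral_lborel_rotate:
  fixes f :: "'a::euclidean_space \<Rightarrow> 'a"
  assumes f: "orthogonal_transformation f" and [measurable]: "g \<in> borel_measurable borel"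
  shows "(\<integral>\<^sup>+x. g (f x) \<partial>lborel) = (\<integral>\<^sup>+x. g x \<partial>lborel)"
proof -
  note [measurable] = orthogonal_transformation_borel[OF f]
  have "(\<integral>\<^sup>+x. g x \<partial>distr lborel borel f) = (\<integral>\<^sup>+x. g (f x) \<partial>lborel)"
    by (subst nn_integral_distr) auto
  then show ?thesis by (simp add: lborel_distr_orthogonal_transformation[OF f])
qed

section \<open>Radial integration\<close>

definition radial_density :: "nat \<Rightarrow> real \<Rightarrow> ennreal" where
  "radial_density m \<rho> = ennreal (real m * unit_ball_vol (real m) * \<rho> ^ (m - 1)) * indicator {0..} \<rho>"

lemma radial_density_measurable [measurable]: "radial_density m \<in> borel_measurable borel"
  unfolding radial_density_def by measurable

lemma emeasure_radial_density:
  assumes m: "m \<ge> 1"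
  shows "(\<integral>\<^sup>+\<rho>. radial_density m \<rho> * indicator {..a} \<rho> \<partial>lborel) = (if a \<le> 0 then 0 else ennreal (unit_ball_vol (real m) * a ^ m))"
proof (cases "a > 0")
  case True
  let ?k = "unit_ball_vol (real m)"
  have "(\<integral>\<^sup>+\<rho>. radial_density m \<rho> * indicator {..a} \<rho> \<partial>lborel) = (\<integral>\<^sup>+\<rho>. ennreal (real m * ?k * \<rho> ^ (m - 1)) * indicator {0..a} \<rho> \<partial>lborel)"
    by (intro nn_integral_cong) (auto simp: radial_density_def indicator_def)
  also have "\<dots> = ennreal (?k * a ^ m - ?k * 0 ^ m)"
    using True by (intro nn_integral_FTC_Icc) (auto intro!: derivative_eq_intros)
  finally show ?thesis using True m by (simp add: power_0_left)
next
  case False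
  have "(\<integral>\<^sup>+\<rho>. radial_density m \<rho> * indicator {..a} \<rho> \<partial>lborel) = (\<integral>\<^sup>+\<rho>. 0 \<partial>(lborel :: real measure))"
    using False AE_lborel_singleton[of "0::real"]
    by (intro nn_integral_cong_AE) (auto simp: radial_density_def indicator_def elim!: eventually_mono)
  then show ?thesis using False by simp
qed

text \<open>The half-lines \<open>{..a}\<close> generate the Borel sets, and on them both measures
  give the volume of a ball, whose derivative is \<open>radial_density\<close>. An arbitrary finite
  index set is allowed so that the coordinates orthogonal to an axis are covered as well.\<close>

lemma distr_PiM_norm:
  assumes I: "finite I" "I \<noteq> {}"
  shows "distr (Pi\<^sub>M I (\<lambda>_. lborel)) borel (\<lambda>f. sqrt (\<Sum>i\<in>I. (f i)\<^sup>2)) = density lborel (radial_density (card I))"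
proof (rule measure_eqI_generator_eq[where E="range atMost" and \<Omega>=UNIV and A="\<lambda>n. {..real n}"])
  let ?P = "Pi\<^sub>M I (\<lambda>_. lborel :: real measure)"
  let ?D = "distr ?P borel (\<lambda>f. sqrt (\<Sum>i\<in>I. (f i)\<^sup>2))"
  let ?k = "unit_ball_vol (real (card I))"
  have m: "card I \<ge> 1" using I by (simp add: Suc_le_eq card_gt_0_iff)
  have D: "emeasure ?D {..a} = emeasure ?P ({f. sqrt (\<Sum>i\<in>I. (f i)\<^sup>2) \<le> a} \<inter> space ?P)" for a
    by (subst emeasure_distr) (auto intro!: arg_cong[where f="emeasure ?P"])
  have pos: "emeasure ?D {..a} = ennreal (?k * a ^ card I)" if "a > 0" for a
    unfolding D using I that by (intro emeasure_cball_aux) auto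
  \<comment> \<open>The ball formula is applied to positive radii; the mass at 0 is squeezed by the
    balls of radius \<epsilon>.\<close>
  have zero: "emeasure ?D {..a} = 0" if a: "a \<le> 0" for a
  proof -
    have "emeasure ?D {..a} \<le> 0"
    proof (rule ennreal_le_epsilon)
      fix e :: real assume e: "e > 0"
      have k: "?k > 0" by simp
      define \<epsilon> where "\<epsilon> = min 1 (e / ?k)"
      have ep: "\<epsilon> > 0" "\<epsilon> \<le> 1" "?k * \<epsilon> \<le> e" using e k by (auto simp: \<epsilon>_def min_def field_simps)
      have "emeasure ?D {..a} \<le> emeasure ?D {..\<epsilon>}" using a ep by (intro emeasure_mono) auto
      also have "\<dots> = ennreal (?k * \<epsilon> ^ card I)" using ep by (intro pos)
      also have "\<epsilon> ^ card I \<le> \<epsilon> ^ 1" using ep m by (intro power_decreasing) auto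
      then have "ennreal (?k * \<epsilon> ^ card I) \<le> ennreal (?k * \<epsilon>)" using k by (intro ennreal_leI mult_left_mono) auto
      also have "\<dots> \<le> ennreal e" using ep by (intro ennreal_leI)
      finally show "emeasure ?D {..a} \<le> 0 + ennreal e" by simp
    qed
    then show ?thesis by simp
  qed
  show "Int_stable (range atMost :: real set set)" by (auto simp: Int_stable_def)
  show "sets ?D = sigma_sets UNIV (range atMost)"
    by (simp add: borel_eq_atMost)
  show "sets (density lborel (radial_density (card I))) = sigma_sets UNIV (range atMost)"
    by (simp add: borel_eq_atMost)
  show "emeasure ?D X = emeasure (density lborel (radial_density (card I))) X" if X: "X \<in> range atMost" for X
  proof -
    obtain a where a: "X = {..a}" using X by auto
    have "emeasure (density lborel (radial_density (card I))) X = (\<integral>\<^sup>+\<rho>. radial_density (card I) \<rho> * indicator {..a} \<rho> \<partial>lborel)"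
      unfolding a by (subst emeasure_density) auto
    then show ?thesis using pos[of a] zero[of a] by (auto simp: emeasure_radial_density[OF m] a)
  qed
  show "emeasure ?D {..real n} \<noteq> \<infinity>" for n
    using pos[of "real n"] zero[of "real n"] by (cases "n = 0") auto
  show "(\<Union>n. {..real n}) = UNIV" by (auto intro: real_arch_simple)
qed auto

lemma nn_integral_PiM_norm:
  assumes "finite I" "I \<noteq> {}" and [measurable]: "h \<in> borel_measurable borel"
  shows "(\<integral>\<^sup>+f. h (sqrt (\<Sum>i\<in>I. (f i)\<^sup>2)) \<partial>(Pi\<^sub>M I (\<lambda>_. lborel))) = (\<integral>\<^sup>+\<rho>. radial_density (card I) \<rho> * h \<rho> \<partial>lborel)"
proof -
  have "(\<integral>\<^sup>+f. h (sqrt (\<Sum>i\<in>I. (f i)\<^sup>2)) \<partial>(Pi\<^sub>M I (\<lambda>_. lborel))) =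
    (\<integral>\<^sup>+\<rho>. h \<rho> \<partial>distr (Pi\<^sub>M I (\<lambda>_. lborel)) borel (\<lambda>f. sqrt (\<Sum>i\<in>I. (f i)\<^sup>2)))"
    by (subst nn_integral_distr) auto
  also have "\<dots> = (\<integral>\<^sup>+\<rho>. radial_density (card I) \<rho> * h \<rho> \<partial>lborel)"
    unfolding distr_PiM_norm[OF assms(1,2)] by (subst nn_integral_density) auto
  finally show ?thesis .
qed

lemma norm_sum_Basis:
  "norm (\<Sum>b\<in>Basis. f b *\<^sub>R b :: 'a::euclidean_space) = sqrt (\<Sum>b\<in>Basis. (f b)\<^sup>2)"
  using euclidean_dist_l2[of "0 :: 'a" "\<Sum>b\<in>Basis. f b *\<^sub>R b"] by (simp add: L2_set_def)

proposition nn_integral_radial: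
  assumes [measurable]: "h \<in> borel_measurable borel"
  shows "(\<integral>\<^sup>+x. h (norm x) \<partial>(lborel :: 'a::euclidean_space measure)) = (\<integral>\<^sup>+\<rho>. radial_density DIM('a) \<rho> * h \<rho> \<partial>lborel)"
proof -
  have "(\<integral>\<^sup>+x. h (norm x) \<partial>(lborel :: 'a measure)) =
    (\<integral>\<^sup>+f. h (norm (\<Sum>b\<in>Basis. f b *\<^sub>R b :: 'a)) \<partial>(Pi\<^sub>M Basis (\<lambda>_. lborel)))"
    by (subst lborel_eq, subst nn_integral_distr) auto
  also have "\<dots> = (\<integral>\<^sup>+\<rho>. radial_density DIM('a) \<rho> * h \<rho> \<partial>lborel)"
    unfolding norm_sum_Basis by (rule nn_integral_PiM_norm) auto
  finally show ?thesis .
qed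

section \<open>Polar coordinates about an axis\<close>

lemma borel_measurable_arccos [measurable]: "arccos \<in> borel_measurable borel"
proof -
  have "(\<lambda>y. if y \<in> {-1..1} then arccos y else (THE x::real. False)) \<in> borel_measurable borel"
    by (rule borel_measurable_continuous_on_if) (auto intro: continuous_on_arccos')
  also have "(\<lambda>y. if y \<in> {-1..1} then arccos y else (THE x::real. False)) = arccos"
  proof
    fix y :: real
    \<comment> \<open>Outside the interval from -1 to 1 the description defining
      \<open>arccos\<close> is unsatisfiable, so its value there is one fixed constant.\<close>
    have "(THE x. 0 \<le> x \<and> x \<le> pi \<and> cos x = y) = (THE x::real. False)" if "y \<notin> {-1..1}"
      using that by (intro arg_cong[where f=The] ext) auto
    then show "(if y \<in> {-1..1} then arccos y else (THE x::real. False)) = arccos y"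
      by (simp add: arccos_def)
  qed
  finally show ?thesis .
qed

text \<open>The substitution \<open>a = \<rho> * cot \<phi>\<close>, whose derivative has absolute
  value \<open>\<rho> / (sin \<phi>)\<^sup>2\<close>. It is obtained by checking that the image of
  this density gives every interval its length.\<close>

lemma nn_integral_cot:
  fixes q :: "real \<Rightarrow> ennreal"
  assumes [measurable]: "q \<in> borel_measurable borel" and \<rho>: "\<rho> > 0"
  shows "(\<integral>\<^sup>+a. q a \<partial>lborel) = (\<integral>\<^sup>+\<phi>. ennreal (\<rho> / (sin \<phi>)\<^sup>2) * indicator {0<..<pi} \<phi> * q (\<rho> * cot \<phi>) \<partial>lborel)"
proof -
  let ?d = "\<lambda>\<phi>. ennreal (\<rho> / (sin \<phi>)\<^sup>2) * indicator {0<..<pi} \<phi>"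
  let ?c = "\<lambda>\<phi>. \<rho> * cot \<phi>"
  have [measurable]: "?c \<in> borel_measurable borel" unfolding cot_def by measurable
  have M: "lborel = distr (density lborel ?d) borel ?c"
  proof (rule lborel_eqI)
    fix l u :: real assume "\<And>b. b \<in> Basis \<Longrightarrow> l \<bullet> b \<le> u \<bullet> b"
    then have lu: "l \<le> u" by auto
    \<comment> \<open>\<open>b1\<close> and \<open>b2\<close> are the arccotangents of
      \<open>u / \<rho>\<close> and \<open>l / \<rho>\<close>; the order of the endpoints is
      reversed because the cotangent decreases.\<close>
    define b1 where "b1 = pi / 2 - arctan (u / \<rho>)"
    define b2 where "b2 = pi / 2 - arctan (l / \<rho>)"
    have b: "0 < b1" "b1 \<le> b2" "b2 < pi"
      using arctan_ubound[of "u / \<rho>"] arctan_lbound[of "l / \<rho>"] arctan_monotone'[of "l / \<rho>" "u / \<rho>"] lu \<rho>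
      by (auto simp: b1_def b2_def divide_right_mono)
    have cot: "cot \<phi> = tan (pi / 2 - \<phi>)" for \<phi> :: real
      by (simp add: cot_def tan_def sin_diff cos_diff)
    have iff: "l < ?c \<phi> \<and> ?c \<phi> < u \<longleftrightarrow> b1 < \<phi> \<and> \<phi> < b2" if "0 < \<phi>" "\<phi> < pi" for \<phi>
    proof -
      have at: "arctan (cot \<phi>) = pi / 2 - \<phi>" unfolding cot using that by (intro arctan_tan) auto
      have "?c \<phi> < u \<longleftrightarrow> cot \<phi> < u / \<rho>" using \<rho> by (simp add: less_divide_eq mult.commute)
      also have "\<dots> \<longleftrightarrow> arctan (cot \<phi>) < arctan (u / \<rho>)" by (simp only: arctan_less_iff)
      also have "\<dots> \<longleftrightarrow> b1 < \<phi>" unfolding at b1_def by auto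
      finally have 1: "?c \<phi> < u \<longleftrightarrow> b1 < \<phi>" .
      have "l < ?c \<phi> \<longleftrightarrow> l / \<rho> < cot \<phi>" using \<rho> by (simp add: divide_less_eq mult.commute)
      also have "\<dots> \<longleftrightarrow> arctan (l / \<rho>) < arctan (cot \<phi>)" by (simp only: arctan_less_iff)
      also have "\<dots> \<longleftrightarrow> \<phi> < b2" unfolding at b2_def by auto
      finally show ?thesis using 1 by blast
    qed
    have "emeasure (distr (density lborel ?d) borel ?c) (box l u) = emeasure (density lborel ?d) (?c -` {l<..<u})"
      by (subst emeasure_distr) auto
    also have "\<dots> = (\<integral>\<^sup>+\<phi>. ?d \<phi> * indicator (?c -` {l<..<u}) \<phi> \<partial>lborel)"
      by (subst emeasure_density) (auto intro!: measurable_sets[of ?c borel borel, simplified])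
    also have "\<dots> = (\<integral>\<^sup>+\<phi>. ennreal (\<rho> / (sin \<phi>)\<^sup>2) * indicator {b1..b2} \<phi> \<partial>lborel)"
    proof (rule nn_integral_cong_AE)
      show "AE \<phi> in lborel. ?d \<phi> * indicator (?c -` {l<..<u}) \<phi> = ennreal (\<rho> / (sin \<phi>)\<^sup>2) * indicator {b1..b2} \<phi>"
        using AE_lborel_singleton[of b1] AE_lborel_singleton[of b2]
      proof eventually_elim
        case (elim \<phi>)
        show ?case
        proof (cases "0 < \<phi> \<and> \<phi> < pi")
          case True
          then show ?thesis using iff[of \<phi>] elim by (auto simp: indicator_def)
        next
          case False
          then show ?thesis using b by (auto simp: indicator_def)
        qed
      qed
    qed
    also have "\<dots> = ennreal (- \<rho> * cot b2 - (- \<rho> * cot b1))"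
    proof (rule nn_integral_FTC_Icc)
      fix \<phi> assume p: "\<phi> \<in> {b1..b2}"
      then have "sin \<phi> > 0" using b by (intro sin_gt_zero) auto
      then show "((\<lambda>\<phi>. - \<rho> * cot \<phi>) has_real_derivative \<rho> / (sin \<phi>)\<^sup>2) (at \<phi>)"
        by (auto intro!: derivative_eq_intros DERIV_cot simp: field_simps)
      show "0 \<le> \<rho> / (sin \<phi>)\<^sup>2" using \<rho> by simp
    qed (use b in auto)
    also have "- \<rho> * cot b2 - (- \<rho> * cot b1) = u - l"
      using \<rho> by (simp add: cot b1_def b2_def tan_arctan)
    finally show "emeasure (distr (density lborel ?d) borel ?c) (box l u) = ennreal (\<Prod>b\<in>Basis. (u - l) \<bullet> b)"
      by simp
  qed simp
  have "(\<integral>\<^sup>+a. q a \<partial>lborel) = (\<integral>\<^sup>+a. q a \<partial>distr (density lborel ?d) borel ?c)" by (subst M) simp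
  also have "\<dots> = (\<integral>\<^sup>+\<phi>. ?d \<phi> * q (?c \<phi>) \<partial>lborel)"
    by (subst nn_integral_distr, simp, simp, subst nn_integral_density) auto
  finally show ?thesis .
qed

text \<open>Plane polar coordinates by two one-dimensional substitutions:
  \<open>a = \<rho> * cot \<phi>\<close> for fixed \<rho>, and after an exchange of integrals
  \<open>\<rho> = s * sin \<phi>\<close> for fixed \<phi>.\<close>

lemma nn_integral_half_plane_polar:
  fixes g :: "real \<times> real \<Rightarrow> ennreal"
  assumes g [measurable]: "g \<in> borel_measurable (borel \<Otimes>\<^sub>M borel)"
  shows "(\<integral>\<^sup>+a. (\<integral>\<^sup>+\<rho>. ennreal (\<rho> ^ k) * indicator {0..} \<rho> * g (sqrt (a\<^sup>2 + \<rho>\<^sup>2), arccos (a / sqrt (a\<^sup>2 + \<rho>\<^sup>2))) \<partial>lborel) \<partial>lborel) =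
    (\<integral>\<^sup>+\<phi>. (\<integral>\<^sup>+s. g (s, \<phi>) * ennreal (s ^ Suc k) * indicator {0<..} s \<partial>lborel) * ennreal (sin \<phi> ^ k) * indicator {0<..<pi} \<phi> \<partial>lborel)"
proof -
  let ?G = "\<lambda>a \<rho>. g (sqrt (a\<^sup>2 + \<rho>\<^sup>2), arccos (a / sqrt (a\<^sup>2 + \<rho>\<^sup>2)))"
  have [measurable]: "(\<lambda>p. arccos (fst p / sqrt ((fst p)\<^sup>2 + (snd p)\<^sup>2))) \<in> borel_measurable (borel \<Otimes>\<^sub>M borel)"
    by measurable
  have Gm [measurable]: "(\<lambda>p. ?G (fst p) (snd p)) \<in> borel_measurable (borel \<Otimes>\<^sub>M borel)"
    by measurable
  have G1 [measurable]: "(\<lambda>a. ?G a \<rho>) \<in> borel_measurable borel" for \<rho> by measurable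
  have "(\<integral>\<^sup>+a. (\<integral>\<^sup>+\<rho>. ennreal (\<rho> ^ k) * indicator {0..} \<rho> * ?G a \<rho> \<partial>lborel) \<partial>lborel) =
    (\<integral>\<^sup>+\<rho>. (\<integral>\<^sup>+a. ennreal (\<rho> ^ k) * indicator {0..} \<rho> * ?G a \<rho> \<partial>lborel) \<partial>lborel)"
    by (rule lborel_pair.Fubini'[symmetric]) measurable
  also have "\<dots> = (\<integral>\<^sup>+\<rho>. (\<integral>\<^sup>+\<phi>. g (\<rho> / sin \<phi>, \<phi>) * ennreal (\<rho> ^ Suc k / (sin \<phi>)\<^sup>2) * indicator {0<..} \<rho> * indicator {0<..<pi} \<phi> \<partial>lborel) \<partial>lborel)"
  proof (rule nn_integral_cong_AE)
    show "AE \<rho> in lborel. (\<integral>\<^sup>+a. ennreal (\<rho> ^ k) * indicator {0..} \<rho> * ?G a \<rho> \<partial>lborel) =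
      (\<integral>\<^sup>+\<phi>. g (\<rho> / sin \<phi>, \<phi>) * ennreal (\<rho> ^ Suc k / (sin \<phi>)\<^sup>2) * indicator {0<..} \<rho> * indicator {0<..<pi} \<phi> \<partial>lborel)"
      using AE_lborel_singleton[of "0::real"]
    proof eventually_elim
      case (elim \<rho>)
      show ?case
      proof (cases "\<rho> > 0")
        case False
        then show ?thesis using elim by simp
      next
        case True
        have "(\<integral>\<^sup>+a. ennreal (\<rho> ^ k) * indicator {0..} \<rho> * ?G a \<rho> \<partial>lborel) =
          (\<integral>\<^sup>+\<phi>. ennreal (\<rho> / (sin \<phi>)\<^sup>2) * indicator {0<..<pi} \<phi> * (ennreal (\<rho> ^ k) * indicator {0..} \<rho> * ?G (\<rho> * cot \<phi>) \<rho>) \<partial>lborel)"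
          using True by (intro nn_integral_cot) measurable
        also have "\<dots> = (\<integral>\<^sup>+\<phi>. g (\<rho> / sin \<phi>, \<phi>) * ennreal (\<rho> ^ Suc k / (sin \<phi>)\<^sup>2) * indicator {0<..} \<rho> * indicator {0<..<pi} \<phi> \<partial>lborel)"
        proof (intro nn_integral_cong)
          fix \<phi>
          show "ennreal (\<rho> / (sin \<phi>)\<^sup>2) * indicator {0<..<pi} \<phi> * (ennreal (\<rho> ^ k) * indicator {0..} \<rho> * ?G (\<rho> * cot \<phi>) \<rho>) =
            g (\<rho> / sin \<phi>, \<phi>) * ennreal (\<rho> ^ Suc k / (sin \<phi>)\<^sup>2) * indicator {0<..} \<rho> * indicator {0<..<pi} \<phi>"
          proof (cases "0 < \<phi> \<and> \<phi> < pi")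
            case phi: True
            then have sp: "sin \<phi> > 0" by (intro sin_gt_zero) auto
            have "(\<rho> * cot \<phi>)\<^sup>2 + \<rho>\<^sup>2 = (\<rho> / sin \<phi>)\<^sup>2 * ((cos \<phi>)\<^sup>2 + (sin \<phi>)\<^sup>2)"
            proof -
              have "\<rho>\<^sup>2 * (cos \<phi>)\<^sup>2 + \<rho>\<^sup>2 * (sin \<phi>)\<^sup>2 = \<rho>\<^sup>2" by (simp flip: distrib_left)
              then show ?thesis using sp by (simp add: cot_def field_simps)
            qed
            then have sq: "(\<rho> * cot \<phi>)\<^sup>2 + \<rho>\<^sup>2 = (\<rho> / sin \<phi>)\<^sup>2" by simp
            have 1: "sqrt ((\<rho> * cot \<phi>)\<^sup>2 + \<rho>\<^sup>2) = \<rho> / sin \<phi>" unfolding sq using sp True by simp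
            have 2: "\<rho> * cot \<phi> / (\<rho> / sin \<phi>) = cos \<phi>" using sp True by (simp add: cot_def)
            have 3: "arccos (cos \<phi>) = \<phi>" using phi by (intro arccos_cos) auto
            have "ennreal (\<rho> / (sin \<phi>)\<^sup>2) * ennreal (\<rho> ^ k) = ennreal (\<rho> ^ Suc k / (sin \<phi>)\<^sup>2)"
              using True sp by (subst ennreal_mult[symmetric]) auto
            then show ?thesis unfolding 1 2 3 using phi True by (simp add: mult_ac) (metis mult.assoc mult.commute)
          qed auto
        qed
        finally show ?thesis .
      qed
    qed
  qed
  also have "\<dots> = (\<integral>\<^sup>+\<phi>. (\<integral>\<^sup>+\<rho>. g (\<rho> / sin \<phi>, \<phi>) * ennreal (\<rho> ^ Suc k / (sin \<phi>)\<^sup>2) * indicator {0<..} \<rho> * indicator {0<..<pi} \<phi> \<partial>lborel) \<partial>lborel)"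
    by (rule lborel_pair.Fubini'[symmetric]) measurable
  also have "\<dots> = (\<integral>\<^sup>+\<phi>. (\<integral>\<^sup>+s. g (s, \<phi>) * ennreal (s ^ Suc k) * indicator {0<..} s \<partial>lborel) * ennreal (sin \<phi> ^ k) * indicator {0<..<pi} \<phi> \<partial>lborel)"
  proof (intro nn_integral_cong)
    fix \<phi>
    show "(\<integral>\<^sup>+\<rho>. g (\<rho> / sin \<phi>, \<phi>) * ennreal (\<rho> ^ Suc k / (sin \<phi>)\<^sup>2) * indicator {0<..} \<rho> * indicator {0<..<pi} \<phi> \<partial>lborel) =
      (\<integral>\<^sup>+s. g (s, \<phi>) * ennreal (s ^ Suc k) * indicator {0<..} s \<partial>lborel) * ennreal (sin \<phi> ^ k) * indicator {0<..<pi} \<phi>"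
    proof (cases "0 < \<phi> \<and> \<phi> < pi")
      case phi: True
      then have sp: "sin \<phi> > 0" by (intro sin_gt_zero) auto
      let ?h = "\<lambda>\<rho>. g (\<rho> / sin \<phi>, \<phi>) * ennreal (\<rho> ^ Suc k / (sin \<phi>)\<^sup>2) * indicator {0<..} \<rho>"
      have "(\<integral>\<^sup>+\<rho>. ?h \<rho> \<partial>lborel) = ennreal \<bar>sin \<phi>\<bar> * (\<integral>\<^sup>+s. ?h (0 + sin \<phi> * s) \<partial>lborel)"
        using sp by (intro nn_integral_real_affine) auto
      also have "\<dots> = (\<integral>\<^sup>+s. ennreal (sin \<phi>) * ?h (sin \<phi> * s) \<partial>lborel)"
        using sp by (subst nn_integral_cmult) auto
      also have "\<dots> = (\<integral>\<^sup>+s. g (s, \<phi>) * ennreal (s ^ Suc k) * indicator {0<..} s * ennreal (sin \<phi> ^ k) \<partial>lborel)"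
      proof (intro nn_integral_cong)
        fix s
        show "ennreal (sin \<phi>) * ?h (sin \<phi> * s) = g (s, \<phi>) * ennreal (s ^ Suc k) * indicator {0<..} s * ennreal (sin \<phi> ^ k)"
        proof (cases "s > 0")
          case True
          \<comment> \<open>The exponent of the sine is \<open>k\<close>: one power from the
            substitution, \<open>k + 1\<close> from the power of \<rho>, and minus two from the
            cotangent.\<close>
          have "sin \<phi> * ((sin \<phi> * s) ^ Suc k / (sin \<phi>)\<^sup>2) = s ^ Suc k * sin \<phi> ^ k"
            using sp by (simp add: power_mult_distrib power2_eq_square)
          then have "ennreal (sin \<phi>) * ennreal ((sin \<phi> * s) ^ Suc k / (sin \<phi>)\<^sup>2) = ennreal (s ^ Suc k) * ennreal (sin \<phi> ^ k)"
            using sp True by (subst (1 2) ennreal_mult[symmetric]) auto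
          then have "ennreal (sin \<phi>) * (g (s, \<phi>) * ennreal ((sin \<phi> * s) ^ Suc k / (sin \<phi>)\<^sup>2)) = g (s, \<phi>) * ennreal (s ^ Suc k) * ennreal (sin \<phi> ^ k)"
            by (metis mult.assoc mult.left_commute)
          then show ?thesis using sp True by (simp add: indicator_def del: power_Suc)
        next
          case False
          then show ?thesis using sp by (simp add: indicator_def zero_less_mult_iff)
        qed
      qed
      also have "\<dots> = (\<integral>\<^sup>+s. g (s, \<phi>) * ennreal (s ^ Suc k) * indicator {0<..} s \<partial>lborel) * ennreal (sin \<phi> ^ k)"
        by (subst nn_integral_multc) auto
      finally show ?thesis using phi by simp
    qed simp
  qed
  finally show ?thesis .
qed

text \<open>After rotating \<open>e\<close> to a basis vector, \<open>a\<close> is the coordinate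
  along it and \<rho> the distance from the axis. The latter has the radial density of dimension
  \<open>n - 1\<close>, whence the constant, and the pair \<open>(a, \<rho>)\<close> is treated as a
  point of a half-plane.\<close>

proposition nn_integral_polar:
  fixes e :: "real^'n" and g :: "real \<times> real \<Rightarrow> ennreal"
  assumes n: "CARD('n) \<ge> 2" and e: "norm e = 1" and g [measurable]: "g \<in> borel_measurable (borel \<Otimes>\<^sub>M borel)"
  shows "(\<integral>\<^sup>+x. g (norm x, arccos (x \<bullet> e / norm x)) \<partial>lborel) = ennreal (sphere_area (CARD('n) - 1)) *
    (\<integral>\<^sup>+\<phi>. (\<integral>\<^sup>+s. g (s, \<phi>) * ennreal (s ^ (CARD('n) - 1)) * indicator {0<..} s \<partial>lborel) * ennreal (sin \<phi> ^ (CARD('n) - 2)) * indicator {0<..<pi} \<phi> \<partial>lborel)"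
proof -
  interpret P: product_sigma_finite "\<lambda>_::real^'n. lborel :: real measure" by standard
  define e0 where "e0 = (SOME b. b \<in> (Basis :: (real^'n) set))"
  have e0: "e0 \<in> Basis" unfolding e0_def by (rule someI_ex) (use nonempty_Basis in blast)
  define I where "I = (Basis :: (real^'n) set) - {e0}"
  have I: "finite I" "e0 \<notin> I" "Basis = insert e0 I" using e0 by (auto simp: I_def)
  have cI: "card I = CARD('n) - 1" using e0 by (simp add: I_def)
  \<comment> \<open>Dimension at least 2 leaves coordinates orthogonal to the axis, so that their
    distance has a density.\<close>
  have Ine: "I \<noteq> {}" using cI n by auto
  obtain f where f: "orthogonal_transformation f" "f e = e0"
    using orthogonal_transformation_exists[of e e0] e e0 by (auto simp: norm_Basis)
  have fi: "f x \<bullet> e0 = x \<bullet> e" "norm (f x) = norm x" for x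
    using f by (auto simp: orthogonal_transformation_def orthogonal_transformation_norm[OF f(1)])
  have [measurable]: "(\<lambda>x::real^'n. g (norm x, arccos (x \<bullet> e0 / norm x))) \<in> borel_measurable borel"
    by measurable
  define G where "G a \<rho> = g (sqrt (a\<^sup>2 + \<rho>\<^sup>2), arccos (a / sqrt (a\<^sup>2 + \<rho>\<^sup>2)))" for a \<rho>
  have Gm [measurable]: "G a \<in> borel_measurable borel" for a unfolding G_def by measurable
  have "(\<integral>\<^sup>+x. g (norm x, arccos (x \<bullet> e / norm x)) \<partial>lborel) = (\<integral>\<^sup>+x. g (norm (f x), arccos (f x \<bullet> e0 / norm (f x))) \<partial>lborel)"
    by (simp add: fi)
  also have "\<dots> = (\<integral>\<^sup>+x. g (norm x, arccos (x \<bullet> e0 / norm x)) \<partial>lborel)"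
    by (rule nn_integral_lborel_rotate[OF f(1), where g="\<lambda>x. g (norm x, arccos (x \<bullet> e0 / norm x))"]) measurable
  also have "\<dots> = (\<integral>\<^sup>+h. g (norm (\<Sum>b\<in>Basis. h b *\<^sub>R b :: real^'n), arccos ((\<Sum>b\<in>Basis. h b *\<^sub>R b) \<bullet> e0 / norm (\<Sum>b\<in>Basis. h b *\<^sub>R b :: real^'n)))
      \<partial>(Pi\<^sub>M Basis (\<lambda>_. lborel)))"
    by (subst lborel_eq, subst nn_integral_distr) auto
  also have "\<dots> = (\<integral>\<^sup>+h. g (sqrt (\<Sum>b\<in>Basis. (h b)\<^sup>2), arccos (h e0 / sqrt (\<Sum>b\<in>Basis. (h b)\<^sup>2))) \<partial>(Pi\<^sub>M Basis (\<lambda>_. lborel)))"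
    by (simp add: norm_sum_Basis inner_sum_left_Basis e0)
  also have "\<dots> = (\<integral>\<^sup>+h. g (sqrt (\<Sum>b\<in>insert e0 I. (h b)\<^sup>2), arccos (h e0 / sqrt (\<Sum>b\<in>insert e0 I. (h b)\<^sup>2))) \<partial>(Pi\<^sub>M (insert e0 I) (\<lambda>_. lborel)))"
    by (simp only: I(3)[symmetric])
  also have "\<dots> = (\<integral>\<^sup>+a. (\<integral>\<^sup>+h. g (sqrt (\<Sum>b\<in>insert e0 I. ((h(e0 := a)) b)\<^sup>2), arccos ((h(e0 := a)) e0 / sqrt (\<Sum>b\<in>insert e0 I. ((h(e0 := a)) b)\<^sup>2))) \<partial>(Pi\<^sub>M I (\<lambda>_. lborel))) \<partial>lborel)"
    by (rule P.product_nn_integral_insert_rev[OF I(1,2)]) measurable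
  also have "\<dots> = (\<integral>\<^sup>+a. (\<integral>\<^sup>+h. G a (sqrt (\<Sum>b\<in>I. (h b)\<^sup>2)) \<partial>(Pi\<^sub>M I (\<lambda>_. lborel))) \<partial>lborel)"
  proof -
    have "(\<Sum>b\<in>insert e0 I. ((h(e0 := a)) b)\<^sup>2) = a\<^sup>2 + (sqrt (\<Sum>b\<in>I. (h b)\<^sup>2))\<^sup>2" for h :: "real^'n \<Rightarrow> real" and a
    proof -
      have "(\<Sum>b\<in>I. ((h(e0 := a)) b)\<^sup>2) = (\<Sum>b\<in>I. (h b)\<^sup>2)" using I by (intro sum.cong) auto
      then show ?thesis using I(1,2) by (simp add: sum_nonneg)
    qed
    then show ?thesis by (simp add: G_def del: sum.insert)
  qed
  also have "\<dots> = (\<integral>\<^sup>+a. (\<integral>\<^sup>+\<rho>. radial_density (card I) \<rho> * G a \<rho> \<partial>lborel) \<partial>lborel)"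
    by (subst nn_integral_PiM_norm[OF I(1) Ine]) auto
  also have "\<dots> = (\<integral>\<^sup>+a. ennreal (sphere_area (CARD('n) - 1)) * (\<integral>\<^sup>+\<rho>. ennreal (\<rho> ^ (CARD('n) - 2)) * indicator {0..} \<rho> * G a \<rho> \<partial>lborel) \<partial>lborel)"
  proof (intro nn_integral_cong)
    fix a
    have "CARD('n) - 1 - 1 = CARD('n) - 2" by simp
    then have rd: "radial_density (card I) \<rho> * G a \<rho> = ennreal (sphere_area (CARD('n) - 1)) * (ennreal (\<rho> ^ (CARD('n) - 2)) * indicator {0..} \<rho> * G a \<rho>)" for \<rho>
      by (cases "\<rho> \<ge> 0") (auto simp: radial_density_def cI sphere_area_def ennreal_mult mult_ac)
    show "(\<integral>\<^sup>+\<rho>. radial_density (card I) \<rho> * G a \<rho> \<partial>lborel) = ennreal (sphere_area (CARD('n) - 1)) * (\<integral>\<^sup>+\<rho>. ennreal (\<rho> ^ (CARD('n) - 2)) * indicator {0..} \<rho> * G a \<rho> \<partial>lborel)"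
      unfolding rd by (subst nn_integral_cmult) auto
  qed
  also have "\<dots> = ennreal (sphere_area (CARD('n) - 1)) * (\<integral>\<^sup>+a. (\<integral>\<^sup>+\<rho>. ennreal (\<rho> ^ (CARD('n) - 2)) * indicator {0..} \<rho> * G a \<rho> \<partial>lborel) \<partial>lborel)"
    unfolding G_def by (subst nn_integral_cmult) auto
  also have "Suc (CARD('n) - 2) = CARD('n) - 1" using n by simp
  then have "(\<integral>\<^sup>+a. (\<integral>\<^sup>+\<rho>. ennreal (\<rho> ^ (CARD('n) - 2)) * indicator {0..} \<rho> * G a \<rho> \<partial>lborel) \<partial>lborel) =
    (\<integral>\<^sup>+\<phi>. (\<integral>\<^sup>+s. g (s, \<phi>) * ennreal (s ^ (CARD('n) - 1)) * indicator {0<..} s \<partial>lborel) * ennreal (sin \<phi> ^ (CARD('n) - 2)) * indicator {0<..<pi} \<phi> \<partial>lborel)"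
    unfolding G_def using nn_integral_half_plane_polar[OF g, of "CARD('n) - 2"] by simp
  finally show ?thesis .
qed

subsection \<open>Hyperplanes separating points from the origin\<close>

lemma hyperplane_eq_iff:
  fixes u v :: "'a::euclidean_space"
  assumes u: "norm u = 1" and v: "norm v = 1"
  shows "hyperplane u t = hyperplane v s \<longleftrightarrow> v = u \<and> s = t \<or> v = - u \<and> s = - t"
proof
  assume eq: "hyperplane u t = hyperplane v s"
  have uu: "u \<bullet> u = 1" and vv: "v \<bullet> v = 1" using u v by (auto simp: norm_eq_1)
  have "t *\<^sub>R u \<in> hyperplane u t" using uu by (simp add: hyperplane_def)
  then have p: "(t *\<^sub>R u) \<bullet> v = s" unfolding eq by (simp add: hyperplane_def)
  \<comment> \<open>The part of \<open>v\<close> orthogonal to \<open>u\<close>. Both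
    \<open>t *\<^sub>R u\<close> and \<open>t *\<^sub>R u + w\<close> lie in the hyperplane, so
    \<open>w\<close> is orthogonal to \<open>v\<close> and hence to itself.\<close>
  define w where "w = v - (v \<bullet> u) *\<^sub>R u"
  have wu: "w \<bullet> u = 0" by (simp add: w_def inner_diff_left uu)
  have "t *\<^sub>R u + w \<in> hyperplane u t" using wu uu by (simp add: hyperplane_def inner_add_left)
  then have "(t *\<^sub>R u + w) \<bullet> v = s" unfolding eq by (simp add: hyperplane_def)
  then have wv: "w \<bullet> v = 0" using p by (simp add: inner_add_left)
  have "w \<bullet> w = w \<bullet> v - (v \<bullet> u) * (w \<bullet> u)" by (subst (2) w_def) (simp add: inner_diff_right)
  then have "w = 0" using wv wu by simp
  then have vu: "v = (v \<bullet> u) *\<^sub>R u" by (simp add: w_def)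
  then have "\<bar>v \<bullet> u\<bar> = 1" using u v by (metis norm_scaleR mult.right_neutral)
  then have "v \<bullet> u = 1 \<or> v \<bullet> u = - 1" by linarith
  then have "v = u \<or> v = - u" using vu by (metis scaleR_one scaleR_minus1_left)
  then show "v = u \<and> s = t \<or> v = - u \<and> s = - t" using p uu by auto
qed (auto simp: hyperplane_def)

lemma topspace_hyperplane_topology [simp]: "topspace hyperplane_topology = (hyperplanes :: 'a::euclidean_space set set)"
proof -
  have "openin hyperplane_topology (hyperplanes :: 'a set set)"
    unfolding openin_hyperplane_topology
  proof (intro conjI order_refl)
    have "{(u, t). u \<in> sphere (0::'a) 1 \<and> hyperplane u t \<in> hyperplanes} = sphere 0 1 \<times> UNIV"
      by (auto simp: hyperplanes_def)
    then show "openin (top_of_set (sphere 0 1 \<times> UNIV)) {(u, t). u \<in> sphere (0::'a) 1 \<and> hyperplane u t \<in> hyperplanes}"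
      by simp
  qed
  moreover have "U \<subseteq> hyperplanes" if "openin hyperplane_topology (U :: 'a set set)" for U
    using that by (simp add: openin_hyperplane_topology)
  ultimately show ?thesis by (meson openin_subset openin_topspace subset_antisym)
qed

lemma space_hyperplane_borel [simp]: "space hyperplane_borel = (hyperplanes :: 'a::euclidean_space set set)"
  unfolding hyperplane_borel_def by (rule space_measure_of) (auto simp: openin_hyperplane_topology)

lemma openin_hyperplane_borel: "openin hyperplane_topology U \<Longrightarrow> U \<in> sets hyperplane_borel"
  unfolding hyperplane_borel_def by (subst sets_measure_of) (auto simp: openin_hyperplane_topology)

lemma openin_hyperplane_topologyI:
  fixes U :: "'a::euclidean_space set set"
  assumes "U \<subseteq> hyperplanes" "open T" "\<And>u t. norm u = 1 \<Longrightarrow> hyperplane u t \<in> U \<longleftrightarrow> (u, t) \<in> T"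
  shows "openin hyperplane_topology U"
  unfolding openin_hyperplane_topology openin_open
  using assms by (intro conjI exI[of _ T]) auto

lemma continuous_map_hyperplane:
  "continuous_map (top_of_set (sphere 0 1 \<times> UNIV)) hyperplane_topology (\<lambda>(u :: 'a::euclidean_space, t). hyperplane u t)"
proof -
  have eq: "{x \<in> sphere 0 1 \<times> UNIV. (case x of (u :: 'a, t) \<Rightarrow> hyperplane u t) \<in> U} = {(u, t). u \<in> sphere 0 1 \<and> hyperplane u t \<in> U}" for U
    by auto
  show ?thesis
    unfolding continuous_map
    by (auto simp: hyperplanes_def openin_hyperplane_topology eq)
qed

text \<open>
  Hyperplanes through the origin (\<open>t = 0\<close>) are included, with both of their orientations, since the
  zero cell uses both half-spaces.
\<close>

definition cut_ball :: "'a::euclidean_space \<Rightarrow> real \<Rightarrow> 'a set set" where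
  "cut_ball q \<epsilon> = {hyperplane u t | u t. norm u = 1 \<and> 0 \<le> t \<and> t + \<epsilon> \<le> q \<bullet> u}"

definition cut_point :: "'a::euclidean_space \<Rightarrow> 'a set set" where
  "cut_point x = {hyperplane u t | u t. norm u = 1 \<and> 0 \<le> t \<and> t < x \<bullet> u}"

lemma hyperplane_in_cut_ball:
  "norm u = 1 \<Longrightarrow> hyperplane u t \<in> cut_ball q \<epsilon> \<longleftrightarrow> 0 \<le> t \<and> t + \<epsilon> \<le> q \<bullet> u \<or> t \<le> 0 \<and> q \<bullet> u \<le> t - \<epsilon>"
proof -
  assume u: "norm u = 1"
  have "hyperplane u t \<in> cut_ball q \<epsilon> \<longleftrightarrow> (\<exists>v s. norm v = 1 \<and> 0 \<le> s \<and> s + \<epsilon> \<le> q \<bullet> v \<and> (v = u \<and> s = t \<or> v = - u \<and> s = - t))"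
    unfolding cut_ball_def using hyperplane_eq_iff[OF u] by blast
  also have "\<dots> \<longleftrightarrow> 0 \<le> t \<and> t + \<epsilon> \<le> q \<bullet> u \<or> t \<le> 0 \<and> q \<bullet> u \<le> t - \<epsilon>"
  proof -
    have "(\<exists>v s. norm v = 1 \<and> 0 \<le> s \<and> s + \<epsilon> \<le> q \<bullet> v \<and> (v = u \<and> s = t \<or> v = - u \<and> s = - t)) \<longleftrightarrow>
      0 \<le> t \<and> t + \<epsilon> \<le> q \<bullet> u \<or> 0 \<le> - t \<and> - t + \<epsilon> \<le> q \<bullet> (- u)"
      using u by (metis norm_minus_cancel)
    also have "0 \<le> - t \<and> - t + \<epsilon> \<le> q \<bullet> (- u) \<longleftrightarrow> t \<le> 0 \<and> q \<bullet> u \<le> t - \<epsilon>" by auto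
    finally show ?thesis .
  qed
  finally show ?thesis .
qed

lemma hyperplane_in_cut_point:
  assumes "norm u = 1" "t > 0"
  shows "hyperplane u t \<in> cut_point x \<longleftrightarrow> t < x \<bullet> u"
proof -
  have "hyperplane u t \<in> cut_point x \<longleftrightarrow> (\<exists>v s. norm v = 1 \<and> 0 \<le> s \<and> s < x \<bullet> v \<and> (v = u \<and> s = t \<or> v = - u \<and> s = - t))"
    unfolding cut_point_def using hyperplane_eq_iff[OF assms(1)] by blast
  also have "\<dots> \<longleftrightarrow> t < x \<bullet> u"
  proof
    assume "t < x \<bullet> u"
    then show "\<exists>v s. norm v = 1 \<and> 0 \<le> s \<and> s < x \<bullet> v \<and> (v = u \<and> s = t \<or> v = - u \<and> s = - t)"
      using assms by (intro exI[of _ u] exI[of _ t]) auto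
  qed (use assms in auto)
  finally show ?thesis .
qed

lemma cut_ball_subset_hyperplanes: "cut_ball q \<epsilon> \<subseteq> hyperplanes"
  by (auto simp: cut_ball_def hyperplanes_def)

text \<open>Openness is tested on the preimage under the two-to-one parametrisation, so the
  complement is described with both representations \<open>(u, t)\<close> and
  \<open>(- u, - t)\<close>.\<close>

lemma cut_ball_measurable [measurable]: "cut_ball q \<epsilon> \<in> sets hyperplane_borel"
proof -
  define T where "T = - {p :: 'a \<times> real. 0 \<le> snd p \<and> snd p + \<epsilon> \<le> q \<bullet> fst p \<or> snd p \<le> 0 \<and> q \<bullet> fst p \<le> snd p - \<epsilon>}"
  have "open T"
    unfolding T_def
    by (intro open_Compl closed_Collect_disj closed_Collect_conj closed_Collect_le continuous_intros)
  then have "openin hyperplane_topology (hyperplanes - cut_ball q \<epsilon>)"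
    by (rule openin_hyperplane_topologyI[rotated]) (auto simp: T_def hyperplane_in_cut_ball hyperplanes_def)
  from sets.compl_sets[OF openin_hyperplane_borel[OF this]] show ?thesis
    using cut_ball_subset_hyperplanes[of q \<epsilon>] by (simp add: double_diff)
qed

text \<open>This is where local finiteness of the process becomes available. The margin \<epsilon>
  turns the strict inequality of \<open>cut_point\<close> into a closed condition, and
  \<open>q \<bullet> u \<le> norm q\<close> bounds the offset.\<close>

lemma compactin_cut_ball: "compactin hyperplane_topology (cut_ball q \<epsilon>)"
proof -
  let ?K = "{p \<in> sphere 0 1 \<times> {0..norm q + \<bar>\<epsilon>\<bar>}. snd p + \<epsilon> \<le> q \<bullet> fst p}"
  have "compact (sphere (0::'a) 1 \<times> {0..norm q + \<bar>\<epsilon>\<bar>})" by (intro compact_Times compact_sphere compact_Icc)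
  moreover have "?K = (sphere 0 1 \<times> {0..norm q + \<bar>\<epsilon>\<bar>}) \<inter> {p. snd p + \<epsilon> \<le> q \<bullet> fst p}" by auto
  moreover have "closed {p :: 'a \<times> real. snd p + \<epsilon> \<le> q \<bullet> fst p}"
    by (intro closed_Collect_le continuous_intros)
  ultimately have "compact ?K" by (simp add: compact_Int_closed)
  then have "compactin (top_of_set (sphere 0 1 \<times> UNIV)) ?K"
    by (simp add: compactin_subtopology) blast
  then have "compactin hyperplane_topology ((\<lambda>(u, t). hyperplane u t) ` ?K)"
    by (rule image_compactin[OF _ continuous_map_hyperplane])
  moreover have "(\<lambda>(u, t). hyperplane u t) ` ?K = cut_ball q \<epsilon>"
  proof
    show "cut_ball q \<epsilon> \<subseteq> (\<lambda>(u, t). hyperplane u t) ` ?K"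
    proof
      fix H assume "H \<in> cut_ball q \<epsilon>"
      then obtain u t where H: "H = hyperplane u t" "norm u = 1" "0 \<le> t" "t + \<epsilon> \<le> q \<bullet> u" by (auto simp: cut_ball_def)
      have "q \<bullet> u \<le> norm q" using norm_cauchy_schwarz[of q u] H by simp
      then show "H \<in> (\<lambda>(u, t). hyperplane u t) ` ?K" using H by (intro image_eqI[of _ _ "(u, t)"]) auto
    qed
    show "(\<lambda>(u, t). hyperplane u t) ` ?K \<subseteq> cut_ball q \<epsilon>" unfolding cut_ball_def by fastforce
  qed
  ultimately show ?thesis by simp
qed

text \<open>Exhausts the hyperplanes cutting off a point by compact sets, on which the counts are
  finite.\<close>

lemma cut_point_eq_UN: "cut_point x = (\<Union>n. cut_ball x (1 / real (Suc n)))"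
proof
  show "cut_point x \<subseteq> (\<Union>n. cut_ball x (1 / real (Suc n)))"
  proof
    fix H assume "H \<in> cut_point x"
    then obtain u t where H: "H = hyperplane u t" "norm u = 1" "0 \<le> t" "t < x \<bullet> u" by (auto simp: cut_point_def)
    then obtain n where "1 / real (Suc n) < x \<bullet> u - t" using nat_approx_posE[of "x \<bullet> u - t"] by auto
    then have "H \<in> cut_ball x (1 / real (Suc n))" using H by (auto simp: cut_ball_def intro!: exI[of _ u] exI[of _ t])
    then show "H \<in> (\<Union>n. cut_ball x (1 / real (Suc n)))" by blast
  qed
  show "(\<Union>n. cut_ball x (1 / real (Suc n))) \<subseteq> cut_point x"
  proof
    fix H assume "H \<in> (\<Union>n. cut_ball x (1 / real (Suc n)))"
    then obtain n u t where H: "H = hyperplane u t" "norm u = 1" "0 \<le> t" "t + 1 / real (Suc n) \<le> x \<bullet> u" by (auto simp: cut_ball_def)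
    have "1 / real (Suc n) > 0" by simp
    then have "t < x \<bullet> u" using H(4) by linarith
    with H show "H \<in> cut_point x" unfolding cut_point_def by blast
  qed
qed

lemma cut_point_measurable [measurable]: "cut_point x \<in> sets hyperplane_borel"
  unfolding cut_point_eq_UN by (intro sets.countable_UN) auto

section \<open>Separation of hyperplanes and existence of atoms\<close>

definition hit_ball :: "'a::euclidean_space \<Rightarrow> real \<Rightarrow> 'a set set" where
  "hit_ball q \<delta> = {H \<in> hyperplanes. H \<inter> ball q \<delta> \<noteq> {}}"

text \<open>The distance of \<open>q\<close> from the hyperplane is
  \<open>\<bar>q \<bullet> u - t\<bar>\<close>, so meeting an open ball is an open condition on the
  parameters.\<close>

lemma hit_ball_measurable: "hit_ball q \<delta> \<in> sets hyperplane_borel"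
proof (rule openin_hyperplane_borel, rule openin_hyperplane_topologyI[where T="{p. \<bar>q \<bullet> fst p - snd p\<bar> < \<delta>}"])
  show "open {p :: 'a \<times> real. \<bar>q \<bullet> fst p - snd p\<bar> < \<delta>}"
    by (intro open_Collect_less continuous_intros)
  fix u :: 'a and t assume u: "norm u = 1"
  then have uu: "u \<bullet> u = 1" by (simp add: norm_eq_1)
  have "hyperplane u t \<inter> ball q \<delta> \<noteq> {} \<longleftrightarrow> \<bar>q \<bullet> u - t\<bar> < \<delta>"
  proof
    assume "hyperplane u t \<inter> ball q \<delta> \<noteq> {}"
    then obtain x where "x \<in> hyperplane u t" "x \<in> ball q \<delta>" by blast
    then have x: "x \<bullet> u = t" "norm (q - x) < \<delta>" by (auto simp: hyperplane_def dist_norm)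
    have "\<bar>(q - x) \<bullet> u\<bar> \<le> norm (q - x)" using Cauchy_Schwarz_ineq2[of "q - x" u] u by simp
    then show "\<bar>q \<bullet> u - t\<bar> < \<delta>" using x by (simp add: inner_diff_left)
  next
    assume a: "\<bar>q \<bullet> u - t\<bar> < \<delta>"
    let ?x = "q - (q \<bullet> u - t) *\<^sub>R u"
    have "?x \<in> hyperplane u t \<inter> ball q \<delta>"
      using a u uu by (simp add: hyperplane_def inner_diff_left dist_norm)
    then show "hyperplane u t \<inter> ball q \<delta> \<noteq> {}" by blast
  qed
  then show "hyperplane u t \<in> hit_ball q \<delta> \<longleftrightarrow> (u, t) \<in> {p. \<bar>q \<bullet> fst p - snd p\<bar> < \<delta>}"
    using u by (auto simp: hit_ball_def hyperplanes_def)
qed (auto simp: hit_ball_def)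

lemma closed_if_hyperplane: "H \<in> hyperplanes \<Longrightarrow> closed (H :: 'a::euclidean_space set)"
proof -
  have "closed {x :: 'a. x \<bullet> u = t}" for u t by (intro closed_Collect_eq continuous_intros)
  then show "H \<in> hyperplanes \<Longrightarrow> closed H" by (auto simp: hyperplanes_def hyperplane_def)
qed

text \<open>A point of \<open>H\<close> outside the closed set \<open>H'\<close> has a neighbourhood
  missing \<open>H'\<close>. Balls with centres in \<open>D\<close> and radii
  \<open>1 / Suc n\<close> suffice, which gives a countable separating family when \<open>D\<close>
  is countable.\<close>

lemma hit_ball_separates:
  fixes H H' :: "'a::euclidean_space set"
  assumes D: "\<And>U :: 'a set. open U \<Longrightarrow> U \<noteq> {} \<Longrightarrow> \<exists>d\<in>D. d \<in> U"
    and H: "H \<in> hyperplanes" "H' \<in> hyperplanes" "\<not> H \<subseteq> H'"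
  shows "\<exists>q\<in>D. \<exists>n. H \<in> hit_ball q (1 / real (Suc n)) \<and> H' \<notin> hit_ball q (1 / real (Suc n))"
proof -
  obtain x where x: "x \<in> H" "x \<notin> H'" using H by blast
  have "open (- H')" using closed_if_hyperplane[OF H(2)] by (rule open_Compl)
  then obtain e where e: "e > 0" "ball x e \<subseteq> - H'" using x by (meson ComplI open_contains_ball)
  obtain n where n: "1 / real (Suc n) < e / 2" using nat_approx_posE[of "e / 2"] e by auto
  have n0: "1 / real (Suc n) > 0" by simp
  obtain q where q: "q \<in> D" "q \<in> ball x (1 / real (Suc n))" using D[of "ball x (1 / real (Suc n))"] n0 by (metis ball_eq_empty not_le open_ball)
  have "x \<in> ball q (1 / real (Suc n))" using q by (simp add: dist_commute)
  moreover have "ball q (1 / real (Suc n)) \<subseteq> ball x e"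
  proof
    fix z assume "z \<in> ball q (1 / real (Suc n))"
    then have "dist q z < e / 2" "dist x q < e / 2" using q n by auto
    then show "z \<in> ball x e" using dist_triangle[of x z q] by simp
  qed
  ultimately have "H \<in> hit_ball q (1 / real (Suc n))" "H' \<notin> hit_ball q (1 / real (Suc n))"
    using x e H by (auto simp: hit_ball_def)
  then show ?thesis using q by blast
qed

text \<open>
  Successive halving along the separating sequence keeps a part of measure at least one, and the
  intersection of these parts is a single point.
\<close>

lemma atom_exists:
  assumes B: "B \<in> sets \<mu>" "emeasure \<mu> B \<noteq> 0" "emeasure \<mu> B < \<infinity>"
    and int: "\<And>A. A \<in> sets \<mu> \<Longrightarrow> emeasure \<mu> A \<in> range ennreal_of_enat"
    and A: "\<And>k::nat. A k \<in> sets \<mu>"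
    and sep: "\<And>x y. x \<in> space \<mu> \<Longrightarrow> y \<in> space \<mu> \<Longrightarrow> x \<noteq> y \<Longrightarrow> \<exists>k. (x \<in> A k) \<noteq> (y \<in> A k)"
  shows "\<exists>x\<in>B. emeasure \<mu> {x} > 0"
proof -
  \<comment> \<open>Integer values make every nonzero mass at least 1, a bound that survives the
    decreasing intersection below.\<close>
  have ge1: "emeasure \<mu> S \<ge> 1" if S: "S \<in> sets \<mu>" "emeasure \<mu> S \<noteq> 0" for S
  proof -
    obtain k where k: "emeasure \<mu> S = ennreal_of_enat k" using int[OF S(1)] by blast
    have "k \<noteq> 0" using k S(2) by auto
    then have "1 \<le> k" by (simp add: ileI1 one_eSuc i0_less)
    then show ?thesis unfolding k by (cases k) (auto simp: one_enat_def)
  qed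
  define C where "C = rec_nat B (\<lambda>k S. if emeasure \<mu> (S \<inter> A k) \<noteq> 0 then S \<inter> A k else S - A k)"
  have C0: "C 0 = B" and CS: "C (Suc k) = (if emeasure \<mu> (C k \<inter> A k) \<noteq> 0 then C k \<inter> A k else C k - A k)" for k
    by (simp_all add: C_def)
  have C: "C k \<in> sets \<mu> \<and> emeasure \<mu> (C k) \<noteq> 0" for k
  proof (induction k)
    case (Suc k)
    show ?case
    proof (cases "emeasure \<mu> (C k \<inter> A k) = 0")
      case True
      have "emeasure \<mu> (C k) \<noteq> 0" using Suc by simp
      also have "emeasure \<mu> (C k) = emeasure \<mu> (C k \<inter> A k) + emeasure \<mu> (C k - A k)"
        using Suc A[of k] by (subst plus_emeasure) (auto intro!: arg_cong[where f="emeasure \<mu>"])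
      finally show ?thesis using True Suc A[of k] by (auto simp: CS)
    next
      case False
      then show ?thesis using Suc A[of k] by (auto simp: CS)
    qed
  qed (use B C0 in auto)
  have dec: "decseq C" by (intro decseq_SucI) (auto simp: CS)
  have CB: "C k \<subseteq> B" for k using decseqD[OF dec, of 0 k] C0 by simp
  have Cfin: "emeasure \<mu> (C k) \<noteq> \<infinity>" for k
    using emeasure_mono[OF CB B(1), of k] B(3) by (auto simp: top_unique)
  have "emeasure \<mu> (\<Inter>k. C k) = (INF k. emeasure \<mu> (C k))"
    using C dec Cfin by (intro INF_emeasure_decseq[symmetric]) auto
  also have "\<dots> \<ge> 1" using C by (intro INF_greatest ge1) auto
  finally have I1: "emeasure \<mu> (\<Inter>k. C k) \<ge> 1" .
  then have "(\<Inter>k. C k) \<noteq> {}" by (metis emeasure_empty not_one_le_zero)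
  then obtain x where x: "x \<in> (\<Inter>k. C k)" by blast
  have "y = x" if y: "y \<in> (\<Inter>k. C k)" for y
  proof (rule ccontr)
    assume ne: "y \<noteq> x"
    have sp: "x \<in> space \<mu>" "y \<in> space \<mu>" using x y C[of 0] sets.sets_into_space by blast+
    then obtain k where k: "(x \<in> A k) \<noteq> (y \<in> A k)" using sep ne by metis
    have "x \<in> C (Suc k)" "y \<in> C (Suc k)" using x y by blast+
    then show False using k by (auto simp: CS split: if_splits)
  qed
  then have "(\<Inter>k. C k) = {x}" using x by blast
  then have "emeasure \<mu> {x} \<ge> 1" using I1 by simp
  moreover have "x \<in> B" using x CB by blast
  ultimately show ?thesis by (metis less_le_trans zero_less_one)
qed

text \<open>Supplies actual hyperplanes of positive mass, which is what \<open>zero_cell\<close>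
  refers to, from a nonzero count. The separating sequence enumerates pairs of a centre from a
  countable dense set and a radius \<open>1 / Suc n\<close>.\<close>

lemma hyperplane_atom_exists:
  fixes \<mu> :: "'a::euclidean_space set measure"
  assumes s: "sets \<mu> = sets hyperplane_borel"
    and int: "\<And>A. A \<in> sets hyperplane_borel \<Longrightarrow> emeasure \<mu> A \<in> range ennreal_of_enat"
    and B: "B \<in> sets hyperplane_borel" "emeasure \<mu> B \<noteq> 0" "emeasure \<mu> B < \<infinity>"
  shows "\<exists>H\<in>B. emeasure \<mu> {H} > 0"
proof -
  obtain D :: "'a set" where D: "countable D" "\<And>U. open U \<Longrightarrow> U \<noteq> {} \<Longrightarrow> \<exists>d\<in>D. d \<in> U"
    using countable_dense_exists[where 'a='a] by blast
  define E where "E = D \<times> (UNIV :: nat set)"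
  have "D \<noteq> {}" using D(2)[of UNIV] by auto
  then have E: "countable E" "E \<noteq> {}" using D by (auto simp: E_def)
  define A where "A k = (case from_nat_into E k of (q, n) \<Rightarrow> hit_ball q (1 / real (Suc n)))" for k
  show ?thesis
  proof (rule atom_exists[where A=A])
    show "A k \<in> sets \<mu>" for k by (auto simp: A_def s hit_ball_measurable split: prod.split)
  next
    fix x y assume xy: "x \<in> space \<mu>" "y \<in> space \<mu>" "x \<noteq> y"
    have "space \<mu> = hyperplanes" using sets_eq_imp_space_eq[OF s] by simp
    then have h: "x \<in> hyperplanes" "y \<in> hyperplanes" using xy by auto
    have "\<exists>q\<in>D. \<exists>n. (x \<in> hit_ball q (1 / real (Suc n))) \<noteq> (y \<in> hit_ball q (1 / real (Suc n)))"
    proof (cases "x \<subseteq> y")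
      case True
      then have "\<not> y \<subseteq> x" using xy by auto
      from hit_ball_separates[OF D(2) h(2,1) this] show ?thesis by blast
    next
      case False
      from hit_ball_separates[OF D(2) h this] show ?thesis by blast
    qed
    then obtain q n where qn: "q \<in> D" "(x \<in> hit_ball q (1 / real (Suc n))) \<noteq> (y \<in> hit_ball q (1 / real (Suc n)))" by blast
    have "(q, n) \<in> E" using qn by (simp add: E_def)
    then obtain k where "from_nat_into E k = (q, n)" using from_nat_into_surj[OF E(1)] by blast
    then show "\<exists>k. (x \<in> A k) \<noteq> (y \<in> A k)" using qn by (intro exI[of _ k]) (simp add: A_def)
  qed (use s int B in auto)
qed

section \<open>Membership in the zero cell as a counting event\<close>

lemma not_in_zero_cell: "x \<notin> zero_cell \<xi> \<longleftrightarrow> (\<exists>H\<in>cut_point x. emeasure \<xi> {H} > 0)"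
proof
  assume "x \<notin> zero_cell \<xi>"
  then obtain H u t where "emeasure \<xi> {H} > 0" "norm u = 1" "H = hyperplane u t" "0 \<le> t" "\<not> x \<bullet> u \<le> t"
    unfolding zero_cell_def zero_halfspaces_def by blast
  then show "\<exists>H\<in>cut_point x. emeasure \<xi> {H} > 0"
    by (intro bexI[of _ H]) (auto simp: cut_point_def not_le)
next
  assume "\<exists>H\<in>cut_point x. emeasure \<xi> {H} > 0"
  then obtain H u t where H: "emeasure \<xi> {H} > 0" "norm u = 1" "H = hyperplane u t" "0 \<le> t" "t < x \<bullet> u"
    unfolding cut_point_def by blast
  then have "H \<in> hyperplanes" "{y. y \<bullet> u \<le> t} \<in> zero_halfspaces H" "x \<notin> {y. y \<bullet> u \<le> t}"
    unfolding hyperplanes_def zero_halfspaces_def by auto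
  then show "x \<notin> zero_cell \<xi>" using H(1) unfolding zero_cell_def by blast
qed

lemma hyperplane_processD:
  assumes "hyperplane_process M X" "\<omega> \<in> space M"
  shows "sets (X \<omega>) = sets hyperplane_borel"
    "\<And>B. B \<in> sets hyperplane_borel \<Longrightarrow> emeasure (X \<omega>) B \<in> range ennreal_of_enat"
    "\<And>q \<epsilon>. emeasure (X \<omega>) (cut_ball q \<epsilon>) < \<infinity>"
  using assms compactin_cut_ball unfolding hyperplane_process_def by blast+

lemma emeasure_process_measurable [measurable (raw)]:
  "hyperplane_process M X \<Longrightarrow> B \<in> sets hyperplane_borel \<Longrightarrow> (\<lambda>\<omega>. emeasure (X \<omega>) B) \<in> borel_measurable M"
  unfolding hyperplane_process_def by blast

lemma cut_ball_null_iff: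
  assumes "hyperplane_process M X" "\<omega> \<in> space M"
  shows "emeasure (X \<omega>) (cut_ball q \<epsilon>) \<noteq> 0 \<longleftrightarrow> (\<exists>H\<in>cut_ball q \<epsilon>. emeasure (X \<omega>) {H} > 0)"
proof
  assume "emeasure (X \<omega>) (cut_ball q \<epsilon>) \<noteq> 0"
  then show "\<exists>H\<in>cut_ball q \<epsilon>. emeasure (X \<omega>) {H} > 0"
    by (intro hyperplane_atom_exists hyperplane_processD[OF assms] cut_ball_measurable)
next
  assume "\<exists>H\<in>cut_ball q \<epsilon>. emeasure (X \<omega>) {H} > 0"
  then obtain H where H: "H \<in> cut_ball q \<epsilon>" "emeasure (X \<omega>) {H} > 0" by blast
  have "emeasure (X \<omega>) {H} \<le> emeasure (X \<omega>) (cut_ball q \<epsilon>)"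
    using H by (intro emeasure_mono) (auto simp: hyperplane_processD[OF assms])
  then show "emeasure (X \<omega>) (cut_ball q \<epsilon>) \<noteq> 0" using H by auto
qed

text \<open>The detour over \<open>cut_ball\<close> is needed because atoms are found in sets of
  finite mass, and \<open>cut_point\<close> may have infinite mass; a countable union of null sets
  brings the statement back.\<close>

lemma in_zero_cell_iff_null:
  assumes "hyperplane_process M X" "\<omega> \<in> space M"
  shows "x \<in> zero_cell (X \<omega>) \<longleftrightarrow> emeasure (X \<omega>) (cut_point x) = 0"
proof -
  have "x \<notin> zero_cell (X \<omega>) \<longleftrightarrow> (\<exists>n. emeasure (X \<omega>) (cut_ball x (1 / real (Suc n))) \<noteq> 0)"
    unfolding not_in_zero_cell cut_ball_null_iff[OF assms] cut_point_eq_UN by blast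
  also have "\<dots> \<longleftrightarrow> emeasure (X \<omega>) (cut_point x) \<noteq> 0"
  proof
    assume "\<exists>n. emeasure (X \<omega>) (cut_ball x (1 / real (Suc n))) \<noteq> 0"
    then obtain n where n: "emeasure (X \<omega>) (cut_ball x (1 / real (Suc n))) \<noteq> 0" ..
    have "emeasure (X \<omega>) (cut_ball x (1 / real (Suc n))) \<le> emeasure (X \<omega>) (cut_point x)"
      by (intro emeasure_mono) (auto simp: cut_point_eq_UN hyperplane_processD[OF assms] intro!: sets.countable_UN)
    then show "emeasure (X \<omega>) (cut_point x) \<noteq> 0" using n by auto
  next
    assume a: "emeasure (X \<omega>) (cut_point x) \<noteq> 0"
    show "\<exists>n. emeasure (X \<omega>) (cut_ball x (1 / real (Suc n))) \<noteq> 0"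
    proof (rule ccontr)
      assume "\<not> ?thesis"
      then have "emeasure (X \<omega>) (\<Union>n. cut_ball x (1 / real (Suc n))) = 0"
        by (intro emeasure_UN_eq_0) (auto simp: hyperplane_processD[OF assms])
      then show False using a by (simp add: cut_point_eq_UN)
    qed
  qed
  finally show ?thesis by blast
qed

lemma zero_cell_pair_measurable:
  fixes X :: "'w \<Rightarrow> 'a::euclidean_space set measure"
  assumes X: "hyperplane_process M X"
  shows "{p \<in> space (M \<Otimes>\<^sub>M borel). snd p \<in> zero_cell (X (fst p))} \<in> sets (M \<Otimes>\<^sub>M borel)"
proof -
  obtain D :: "'a set" where D: "countable D" "\<And>U. open U \<Longrightarrow> U \<noteq> {} \<Longrightarrow> \<exists>d\<in>D. d \<in> U"
    using countable_dense_exists[where 'a='a] by blast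
  txt \<open>
    A point outside the zero cell has a neighbourhood from a countable base that is separated from
    the origin by one hyperplane of the process.
  \<close>
  let ?c = "\<lambda>q n. {\<omega> \<in> space M. emeasure (X \<omega>) (cut_ball q (1 / real (Suc n))) \<noteq> 0} \<times> ball q (1 / real (Suc n))"
  have eq: "{p \<in> space (M \<Otimes>\<^sub>M borel). snd p \<in> zero_cell (X (fst p))} = space (M \<Otimes>\<^sub>M borel) - (\<Union>q\<in>D. \<Union>n. ?c q n)"
  proof -
    have *: "x \<notin> zero_cell (X \<omega>) \<longleftrightarrow> (\<exists>q\<in>D. \<exists>n. emeasure (X \<omega>) (cut_ball q (1 / real (Suc n))) \<noteq> 0 \<and> x \<in> ball q (1 / real (Suc n)))"
      if w: "\<omega> \<in> space M" for x \<omega>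
    proof
      assume "x \<notin> zero_cell (X \<omega>)"
      then obtain u t where H: "norm u = 1" "0 \<le> t" "t < x \<bullet> u" "emeasure (X \<omega>) {hyperplane u t} > 0"
        by (auto simp: not_in_zero_cell cut_point_def)
      \<comment> \<open>Half of the gap: one radius is lost when \<open>x\<close> is replaced by the
        nearby centre \<open>q\<close>, the other is the margin required by
        \<open>cut_ball\<close>.\<close>
      obtain n where n: "1 / real (Suc n) < (x \<bullet> u - t) / 2" using nat_approx_posE[of "(x \<bullet> u - t) / 2"] H by auto
      have n0: "1 / real (Suc n) > 0" by simp
      obtain q where q: "q \<in> D" "q \<in> ball x (1 / real (Suc n))" using D(2)[of "ball x (1 / real (Suc n))"] n0 by (metis ball_eq_empty not_le open_ball)
      have "\<bar>(x - q) \<bullet> u\<bar> \<le> norm (x - q)" using Cauchy_Schwarz_ineq2[of "x - q" u] H by simp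
      then have "\<bar>x \<bullet> u - q \<bullet> u\<bar> < 1 / real (Suc n)" using q by (simp add: dist_norm inner_diff_left)
      then have "x \<bullet> u - q \<bullet> u < 1 / real (Suc n)" unfolding abs_less_iff by blast
      moreover have "2 * (1 / real (Suc n)) < x \<bullet> u - t" using n by simp
      ultimately have "t + 1 / real (Suc n) \<le> q \<bullet> u" by linarith
      then have "hyperplane u t \<in> cut_ball q (1 / real (Suc n))" using H unfolding cut_ball_def by blast
      then have "emeasure (X \<omega>) (cut_ball q (1 / real (Suc n))) \<noteq> 0"
        unfolding cut_ball_null_iff[OF X w] using H by blast
      then show "\<exists>q\<in>D. \<exists>n. emeasure (X \<omega>) (cut_ball q (1 / real (Suc n))) \<noteq> 0 \<and> x \<in> ball q (1 / real (Suc n))"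
        using q by (auto simp: dist_commute)
    next
      assume "\<exists>q\<in>D. \<exists>n. emeasure (X \<omega>) (cut_ball q (1 / real (Suc n))) \<noteq> 0 \<and> x \<in> ball q (1 / real (Suc n))"
      then obtain q n u t where H: "norm u = 1" "0 \<le> t" "t + 1 / real (Suc n) \<le> q \<bullet> u" "emeasure (X \<omega>) {hyperplane u t} > 0"
        and x: "x \<in> ball q (1 / real (Suc n))"
        unfolding cut_ball_null_iff[OF X w] unfolding cut_ball_def by blast
      have "\<bar>(q - x) \<bullet> u\<bar> \<le> norm (q - x)" using Cauchy_Schwarz_ineq2[of "q - x" u] H by simp
      then have "\<bar>q \<bullet> u - x \<bullet> u\<bar> < 1 / real (Suc n)" using x by (simp add: dist_norm inner_diff_left)
      then have "t < x \<bullet> u" using H by linarith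
      then have "hyperplane u t \<in> cut_point x" using H unfolding cut_point_def by blast
      then show "x \<notin> zero_cell (X \<omega>)" using H unfolding not_in_zero_cell by blast
    qed
    show ?thesis
    proof (rule set_eqI)
      fix p :: "'w \<times> 'a"
      obtain \<omega> x where p: "p = (\<omega>, x)" by (cases p)
      show "p \<in> {p \<in> space (M \<Otimes>\<^sub>M borel). snd p \<in> zero_cell (X (fst p))} \<longleftrightarrow> p \<in> space (M \<Otimes>\<^sub>M borel) - (\<Union>q\<in>D. \<Union>n. ?c q n)"
        using *[of \<omega> x] unfolding p
        by (simp only: space_pair_measure mem_Collect_eq fst_conv snd_conv Diff_iff UN_iff mem_Sigma_iff space_borel) blast
    qed
  qed
  have "?c q n \<in> sets (M \<Otimes>\<^sub>M borel)" for q n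
  proof (rule pair_measureI)
    have [measurable]: "(\<lambda>\<omega>. emeasure (X \<omega>) (cut_ball q (1 / real (Suc n)))) \<in> borel_measurable M"
      using X by (rule emeasure_process_measurable) measurable
    show "{\<omega> \<in> space M. emeasure (X \<omega>) (cut_ball q (1 / real (Suc n))) \<noteq> 0} \<in> sets M" by measurable
  qed simp
  then show ?thesis unfolding eq using D(1) by (intro sets.compl_sets sets.countable_UN' sets.countable_UN) auto
qed

lemma prob_cut_points_null:
  assumes P: "poisson_hyperplane_process M X \<Theta>" and fin: "\<Theta> (cut_point x \<union> cut_point y) < \<infinity>"
  shows "measure M {\<omega> \<in> space M. x \<in> zero_cell (X \<omega>) \<and> y \<in> zero_cell (X \<omega>)} = exp (- enn2real (\<Theta> (cut_point x \<union> cut_point y)))"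
proof -
  have X: "hyperplane_process M X" using P by (simp add: poisson_hyperplane_process_def)
  let ?B = "cut_point x \<union> cut_point y"
  have B: "?B \<in> sets hyperplane_borel" by auto
  \<comment> \<open>Both points lie in the cell exactly if the union of their cutting sets is empty
    of hyperplanes; this is the Poisson probability of the value 0.\<close>
  have "x \<in> zero_cell (X \<omega>) \<and> y \<in> zero_cell (X \<omega>) \<longleftrightarrow> emeasure (X \<omega>) ?B = of_nat 0" if w: "\<omega> \<in> space M" for \<omega>
  proof -
    have s: "sets (X \<omega>) = sets hyperplane_borel" by (rule hyperplane_processD[OF X w])
    have "emeasure (X \<omega>) ?B = 0 \<longleftrightarrow> ?B \<in> null_sets (X \<omega>)" using B by (auto simp: null_sets_def s)
    also have "\<dots> \<longleftrightarrow> cut_point x \<in> null_sets (X \<omega>) \<and> cut_point y \<in> null_sets (X \<omega>)"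
      using null_sets_subset[of ?B "X \<omega>"] by (auto simp: s intro: null_sets_subset)
    also have "\<dots> \<longleftrightarrow> emeasure (X \<omega>) (cut_point x) = 0 \<and> emeasure (X \<omega>) (cut_point y) = 0"
      by (auto simp: null_sets_def s)
    finally show ?thesis by (simp add: in_zero_cell_iff_null[OF X w])
  qed
  then have "{\<omega> \<in> space M. x \<in> zero_cell (X \<omega>) \<and> y \<in> zero_cell (X \<omega>)} = {\<omega> \<in> space M. emeasure (X \<omega>) ?B = of_nat 0}" by blast
  moreover have "measure M {\<omega> \<in> space M. emeasure (X \<omega>) ?B = of_nat k} = enn2real (\<Theta> ?B) ^ k / fact k * exp (- enn2real (\<Theta> ?B))" for k
    using P B fin unfolding poisson_hyperplane_process_def by blast
  from this[of 0] have "measure M {\<omega> \<in> space M. emeasure (X \<omega>) ?B = of_nat 0} = exp (- enn2real (\<Theta> ?B))" by simp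
  ultimately show ?thesis by simp
qed

lemma nn_integral_powr_interval:
  assumes r: "r > 0" and m: "m \<ge> 0"
  shows "(\<integral>\<^sup>+t. ennreal (t powr (r - 1)) * indicator {0..m} t \<partial>lborel) = ennreal (m powr r / r)"
proof -
  have "((\<lambda>x. x powr (r - 1)) has_integral (m powr (r - 1 + 1) / (r - 1 + 1))) {0..m}"
    using r m by (intro has_integral_powr_from_0) auto
  then have "((\<lambda>x. x powr (r - 1)) has_integral (m powr r / r)) {0..m}" by simp
  from nn_integral_has_integral_lebesgue[OF _ this] have
    "(\<integral>\<^sup>+t. ennreal (indicator {0..m} t * t powr (r - 1)) \<partial>lborel) = ennreal (m powr r / r)" by simp
  moreover have "(\<integral>\<^sup>+t. ennreal (t powr (r - 1)) * indicator {0..m} t \<partial>lborel) = (\<integral>\<^sup>+t. ennreal (indicator {0..m} t * t powr (r - 1)) \<partial>lborel)"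
    by (intro nn_integral_cong) (auto simp: indicator_def)
  ultimately show ?thesis by simp
qed

text \<open>For a fixed normal \<open>u\<close>, the offsets that cut off \<open>x\<close> or
  \<open>y\<close> fill the interval from 0 to the positive part of the larger inner product, up to
  endpoints, and the radial integral gives its power divided by \<open>r\<close>. Offset 0, where a
  hyperplane has two orientations, is a null event.\<close>

lemma hyperplane_intensity_cut_points:
  fixes x y :: "'a::euclidean_space"
  assumes r: "r > 0"
  shows "hyperplane_intensity \<gamma> r (cut_point x \<union> cut_point y) = ennreal (2 * \<gamma> / (real DIM('a) * unit_ball_vol (real DIM('a)))) *
    (ennreal (1 / r) * (\<integral>\<^sup>+u. ennreal (max (max (x \<bullet> u) (y \<bullet> u)) 0 powr r) \<partial>sphere_measure))"
proof -
  let ?m = "\<lambda>u. max (max (x \<bullet> u) (y \<bullet> u)) 0"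
  have inner: "(\<integral>\<^sup>+t\<in>{0..}. indicator (cut_point x \<union> cut_point y) (hyperplane u t) * ennreal (t powr (r - 1)) \<partial>lborel) = ennreal (?m u powr r / r)"
    if u: "norm u = 1" for u
  proof -
    have "(\<integral>\<^sup>+t\<in>{0..}. indicator (cut_point x \<union> cut_point y) (hyperplane u t) * ennreal (t powr (r - 1)) \<partial>lborel) =
      (\<integral>\<^sup>+t. ennreal (t powr (r - 1)) * indicator {0..?m u} t \<partial>lborel)"
    proof (rule nn_integral_cong_AE)
      show "AE t in lborel. indicator (cut_point x \<union> cut_point y) (hyperplane u t) * ennreal (t powr (r - 1)) * indicator {0..} t =
        ennreal (t powr (r - 1)) * indicator {0..?m u} t"
        using AE_lborel_singleton[of 0] AE_lborel_singleton[of "?m u"]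
      proof eventually_elim
        case (elim t)
        show ?case
        proof (cases "t > 0")
          case True
          have "hyperplane u t \<in> cut_point x \<union> cut_point y \<longleftrightarrow> t < x \<bullet> u \<or> t < y \<bullet> u"
            using hyperplane_in_cut_point[OF u True] by auto
          then show ?thesis using True elim by (auto simp: indicator_def max_def split: if_splits)
        next
          case False
          then show ?thesis using elim by (auto simp: indicator_def)
        qed
      qed
    qed
    also have "\<dots> = ennreal (?m u powr r / r)" using r by (intro nn_integral_powr_interval) auto
    finally show ?thesis .
  qed
  have "(\<integral>\<^sup>+u\<in>sphere (0::'a) 1. (\<integral>\<^sup>+t\<in>{0..}. indicator (cut_point x \<union> cut_point y) (hyperplane u t) * ennreal (t powr (r - 1)) \<partial>lborel) \<partial>hausdorff_measure (DIM('a) - 1)) =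
    (\<integral>\<^sup>+u\<in>sphere (0::'a) 1. ennreal (?m u powr r / r) \<partial>hausdorff_measure (DIM('a) - 1))"
  proof (rule nn_integral_cong)
    fix u :: 'a
    show "(\<integral>\<^sup>+t\<in>{0..}. indicator (cut_point x \<union> cut_point y) (hyperplane u t) * ennreal (t powr (r - 1)) \<partial>lborel) * indicator (sphere 0 1) u =
      ennreal (?m u powr r / r) * indicator (sphere 0 1) u"
    proof (cases "norm u = 1")
      case True
      then show ?thesis by (simp only: inner)
    qed simp
  qed
  also have "\<dots> = (\<integral>\<^sup>+u. ennreal (?m u powr r / r) \<partial>sphere_measure)"
    by (rule nn_integral_sphere_measure) measurable
  also have "\<dots> = (\<integral>\<^sup>+u. ennreal (1 / r) * ennreal (?m u powr r) \<partial>sphere_measure)"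
    using r by (intro nn_integral_cong) (simp add: ennreal_mult[symmetric])
  also have "\<dots> = ennreal (1 / r) * (\<integral>\<^sup>+u. ennreal (?m u powr r) \<partial>sphere_measure)"
    by (subst nn_integral_cmult) auto
  finally show ?thesis by (simp only: hyperplane_intensity_def)
qed

text \<open>
  The expected number of hyperplanes separating \<open>x\<close> from the origin is \<open>rate * norm x powr r\<close>.
\<close>

definition rate :: "'n::finite itself \<Rightarrow> real \<Rightarrow> real \<Rightarrow> real" where
  "rate _ \<gamma> r = 2 * \<gamma> * c_const TYPE(real^'n) r / (real CARD('n) * unit_ball_vol (real CARD('n)) * r)"

lemma rate_pos: "CARD('n::finite) \<ge> 2 \<Longrightarrow> \<gamma> > 0 \<Longrightarrow> r > 0 \<Longrightarrow> rate TYPE('n) \<gamma> r > 0"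
  using c_const_pos[where 'n='n, of r] by (auto simp: rate_def intro!: divide_pos_pos mult_pos_pos)

text \<open>The number \<open>b\<close> stands for the spherical integral in units of c(n,r), so
  that pairs in general position and the diagonal \<open>x = y\<close> are handled alike.\<close>

lemma prob_pair_in_zero_cell:
  fixes x y :: "real^'n"
  assumes P: "poisson_hyperplane_process M X (hyperplane_intensity \<gamma> r)" and \<gamma>: "\<gamma> > 0" and r: "r > 0"
    and G: "(\<integral>\<^sup>+u. ennreal (max (max (x \<bullet> u) (y \<bullet> u)) 0 powr r) \<partial>sphere_measure) = ennreal (c_const TYPE(real^'n) r * b)" and b: "b \<ge> 0"
  shows "measure M {\<omega> \<in> space M. x \<in> zero_cell (X \<omega>) \<and> y \<in> zero_cell (X \<omega>)} = exp (- (rate TYPE('n) \<gamma> r * b))"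
proof -
  let ?c = "c_const TYPE(real^'n) r"
  have c: "?c \<ge> 0" by (rule c_const_nonneg)
  have "2 * \<gamma> / (real CARD('n) * unit_ball_vol (real CARD('n))) * (1 / r * (?c * b)) = rate TYPE('n) \<gamma> r * b"
    using r by (simp add: rate_def)
  then have \<Theta>: "hyperplane_intensity \<gamma> r (cut_point x \<union> cut_point y) = ennreal (rate TYPE('n) \<gamma> r * b)"
    unfolding hyperplane_intensity_cut_points[OF r] G using \<gamma> r c b by (simp add: ennreal_mult[symmetric])
  have "rate TYPE('n) \<gamma> r * b \<ge> 0" using \<gamma> r c b by (simp add: rate_def)
  then show ?thesis using prob_cut_points_null[OF P, of x y] by (simp add: \<Theta>)
qed

subsection \<open>Integration over pairs of points\<close>

lemma nn_integral_powr_substitution: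
  fixes q :: "real \<Rightarrow> ennreal"
  assumes r: "r > 0" and [measurable]: "q \<in> borel_measurable borel"
  shows "(\<integral>\<^sup>+\<rho>. ennreal (r * \<rho> powr (r - 1)) * indicator {0..} \<rho> * q (\<rho> powr r) \<partial>lborel) = (\<integral>\<^sup>+u. indicator {0..} u * q u \<partial>lborel)"
proof -
  let ?d = "\<lambda>\<rho>. ennreal (r * \<rho> powr (r - 1)) * indicator {0..} \<rho>"
  let ?M = "distr (density lborel ?d) borel (\<lambda>\<rho>. \<rho> powr r)"
  let ?N = "density lborel (\<lambda>u :: real. indicator {0..} u :: ennreal)"
  have N: "emeasure ?N {..a} = ennreal (max a 0)" for a :: real
  proof -
    have "emeasure ?N {..a} = (\<integral>\<^sup>+u. indicator {0..a} u \<partial>lborel)"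
      by (subst emeasure_density, simp, simp, rule nn_integral_cong) (auto simp: indicator_def)
    also have "\<dots> = ennreal (max a 0)" by (simp add: emeasure_lborel_Icc_eq max_def)
    finally show ?thesis .
  qed
  have M: "emeasure ?M {..a} = ennreal (max a 0)" for a :: real
  proof -
    have "emeasure ?M {..a} = emeasure (density lborel ?d) ((\<lambda>\<rho>. \<rho> powr r) -` {..a})"
      by (subst emeasure_distr) auto
    also have "\<dots> = (\<integral>\<^sup>+\<rho>. ?d \<rho> * indicator ((\<lambda>\<rho>. \<rho> powr r) -` {..a}) \<rho> \<partial>lborel)"
      by (rule emeasure_density) (auto intro!: measurable_sets[of "\<lambda>\<rho>. \<rho> powr r" borel borel, simplified])
    also have "\<dots> = (\<integral>\<^sup>+\<rho>. ennreal r * (ennreal (\<rho> powr (r - 1)) * indicator {0..max a 0 powr (1 / r)} \<rho>) \<partial>lborel)"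
    proof (rule nn_integral_cong_AE)
      show "AE \<rho> in lborel. ?d \<rho> * indicator ((\<lambda>\<rho>. \<rho> powr r) -` {..a}) \<rho> = ennreal r * (ennreal (\<rho> powr (r - 1)) * indicator {0..max a 0 powr (1 / r)} \<rho>)"
        using AE_lborel_singleton[of 0]
      proof eventually_elim
        case (elim \<rho>)
        show ?case
        proof (cases "\<rho> > 0")
          case True
          have pr: "\<rho> powr r > 0" using True by simp
          have "\<rho> powr r \<le> a \<longleftrightarrow> \<rho> \<le> max a 0 powr (1 / r)"
          proof
            assume a: "\<rho> powr r \<le> a"
            have a0: "max a 0 = a" using a pr by linarith
            have "(\<rho> powr r) powr (1 / r) \<le> a powr (1 / r)" using r a by (intro powr_mono2) auto
            then show "\<rho> \<le> max a 0 powr (1 / r)" using True r unfolding a0 by (simp add: powr_powr)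
          next
            assume a: "\<rho> \<le> max a 0 powr (1 / r)"
            then have "\<rho> powr r \<le> (max a 0 powr (1 / r)) powr r" using True r by (intro powr_mono2) auto
            then have "\<rho> powr r \<le> max a 0" using r by (simp add: powr_powr)
            then show "\<rho> powr r \<le> a" using pr by (simp add: max_def split: if_splits)
          qed
          then show ?thesis using True r by (auto simp: indicator_def ennreal_mult)
        next
          case False
          then show ?thesis using elim by (auto simp: indicator_def)
        qed
      qed
    qed
    also have "\<dots> = ennreal r * ennreal ((max a 0 powr (1 / r)) powr r / r)"
      using r by (subst nn_integral_cmult) (auto simp: nn_integral_powr_interval)
    also have "\<dots> = ennreal (max a 0)"
      using r by (simp add: ennreal_mult[symmetric] powr_powr)
    finally show ?thesis .
  qed
  have "?M = ?N"
  proof (rule measure_eqI_generator_eq[where E="range atMost" and \<Omega>=UNIV and A="\<lambda>n. {..real n}"])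
    show "Int_stable (range atMost :: real set set)" by (auto simp: Int_stable_def)
    show "sets ?M = sigma_sets UNIV (range atMost)"
      by (simp add: borel_eq_atMost)
    show "sets ?N = sigma_sets UNIV (range atMost)"
      by (simp add: borel_eq_atMost)
    show "emeasure ?M X = emeasure ?N X" if "X \<in> range atMost" for X using that M N by auto
    show "emeasure ?M {..real n} \<noteq> \<infinity>" for n by (simp add: M)
    show "(\<Union>n. {..real n}) = UNIV" by (auto intro: real_arch_simple)
  qed auto
  then have "(\<integral>\<^sup>+u. q u \<partial>?M) = (\<integral>\<^sup>+u. q u \<partial>?N)" by simp
  moreover have "(\<integral>\<^sup>+u. q u \<partial>?M) = (\<integral>\<^sup>+\<rho>. ?d \<rho> * q (\<rho> powr r) \<partial>lborel)"
    by (subst nn_integral_distr, simp, simp, subst nn_integral_density) auto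
  moreover have "(\<integral>\<^sup>+u. q u \<partial>?N) = (\<integral>\<^sup>+u. indicator {0..} u * q u \<partial>lborel)"
    by (subst nn_integral_density) auto
  ultimately show ?thesis by simp
qed

lemma nn_integral_Gamma_scaled:
  assumes z: "z > 0" and a: "a > 0"
  shows "(\<integral>\<^sup>+u. indicator {0..} u * ennreal (u powr (z - 1) * exp (- (a * u))) \<partial>lborel) = ennreal (Gamma z * (1 / a) powr z)"
proof -
  have "ennreal (Gamma z) = (\<integral>\<^sup>+t. ennreal (indicator {0..} t * t powr (z - 1) / exp t) \<partial>lborel)"
    using Gamma_conv_nn_integral_real[OF z] by simp
  also have "\<dots> = ennreal \<bar>a\<bar> * (\<integral>\<^sup>+u. ennreal (indicator {0..} (0 + a * u) * (0 + a * u) powr (z - 1) / exp (0 + a * u)) \<partial>lborel)"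
    using a by (intro nn_integral_real_affine) auto
  also have "\<dots> = (\<integral>\<^sup>+u. ennreal a * ennreal (indicator {0..} (a * u) * (a * u) powr (z - 1) / exp (a * u)) \<partial>lborel)"
    using a by (subst nn_integral_cmult) auto
  also have "\<dots> = (\<integral>\<^sup>+u. ennreal (a powr z) * (indicator {0..} u * ennreal (u powr (z - 1) * exp (- (a * u)))) \<partial>lborel)"
  proof (rule nn_integral_cong)
    fix u :: real
    show "ennreal a * ennreal (indicator {0..} (a * u) * (a * u) powr (z - 1) / exp (a * u)) =
      ennreal (a powr z) * (indicator {0..} u * ennreal (u powr (z - 1) * exp (- (a * u))))"
    proof (cases "u \<ge> 0")
      case True
      have "a * a powr (z - 1) = a powr z" using a by (simp add: powr_diff)
      then have "a * ((a * u) powr (z - 1) / exp (a * u)) = a powr z * (u powr (z - 1) * exp (- (a * u)))"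
        using True a by (simp add: powr_mult exp_minus field_simps)
      then show ?thesis using True a by (simp add: ennreal_mult[symmetric])
    next
      case False
      then have "a * u < 0" using a by (simp add: mult_pos_neg)
      then show ?thesis using False by simp
    qed
  qed
  also have "\<dots> = ennreal (a powr z) * (\<integral>\<^sup>+u. indicator {0..} u * ennreal (u powr (z - 1) * exp (- (a * u))) \<partial>lborel)"
    by (subst nn_integral_cmult) auto
  finally have "ennreal (1 / a powr z) * ennreal (Gamma z) =
    (ennreal (1 / a powr z) * ennreal (a powr z)) * (\<integral>\<^sup>+u. indicator {0..} u * ennreal (u powr (z - 1) * exp (- (a * u))) \<partial>lborel)"
    by (simp add: mult.assoc)
  moreover have "ennreal (1 / a powr z) * ennreal (a powr z) = 1" using a by (simp add: ennreal_mult[symmetric])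
  moreover have "(1 / a) powr z = 1 / a powr z" using a by (simp add: powr_divide)
  ultimately show ?thesis using a z Gamma_real_pos[OF z] by (simp add: ennreal_mult[symmetric] mult.commute)
qed

text \<open>The power \<open>\<rho> ^ (n - 1)\<close> is the radial density of the longer vector and
  \<open>\<rho> ^ n\<close> comes from scaling the shorter one. Substituting
  \<open>u = \<rho> powr r\<close> turns the exponent \<open>2 * n - 1\<close> into that of the
  Gamma function at \<open>2 * n / r\<close>.\<close>

lemma nn_integral_power_exp_powr:
  fixes n :: nat
  assumes r: "r > 0" and a: "a > 0" and n: "n \<ge> 1"
  shows "(\<integral>\<^sup>+\<rho>. indicator {0..} \<rho> * ennreal (\<rho> ^ (n - 1) * \<rho> ^ n * exp (- (a * \<rho> powr r))) \<partial>lborel) =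
    ennreal (Gamma (2 * real n / r) / r * (1 / a) powr (2 * real n / r))"
proof -
  let ?z = "2 * real n / r"
  have z: "?z > 0" using r n by simp
  \<comment> \<open>The division by \<open>r\<close> compensates the factor \<open>r\<close> in the
    derivative of \<open>\<rho> powr r\<close>.\<close>
  define q where "q u = ennreal (u powr (?z - 1) * exp (- (a * u)) / r)" for u
  have [measurable]: "q \<in> borel_measurable borel" unfolding q_def by measurable
  have "(\<integral>\<^sup>+\<rho>. indicator {0..} \<rho> * ennreal (\<rho> ^ (n - 1) * \<rho> ^ n * exp (- (a * \<rho> powr r))) \<partial>lborel) =
    (\<integral>\<^sup>+\<rho>. ennreal (r * \<rho> powr (r - 1)) * indicator {0..} \<rho> * q (\<rho> powr r) \<partial>lborel)"
  proof (rule nn_integral_cong_AE)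
    show "AE \<rho> in lborel. indicator {0..} \<rho> * ennreal (\<rho> ^ (n - 1) * \<rho> ^ n * exp (- (a * \<rho> powr r))) =
      ennreal (r * \<rho> powr (r - 1)) * indicator {0..} \<rho> * q (\<rho> powr r)"
      using AE_lborel_singleton[of 0]
    proof eventually_elim
      case (elim \<rho>)
      show ?case
      proof (cases "\<rho> > 0")
        case True
        have "\<rho> ^ (n - 1) * \<rho> ^ n = \<rho> powr (real (n - 1) + real n)" using True by (simp add: powr_realpow powr_add)
        also have "real (n - 1) + real n = 2 * real n - 1" using n by simp
        also have "\<rho> powr (2 * real n - 1) = \<rho> powr (r - 1) * \<rho> powr (2 * real n - r)" by (simp add: powr_add[symmetric])
        also have "\<rho> powr (2 * real n - r) = (\<rho> powr r) powr (?z - 1)"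
          using r by (simp add: powr_powr right_diff_distrib)
        finally have eq: "\<rho> ^ (n - 1) * \<rho> ^ n * exp (- (a * \<rho> powr r)) = (r * \<rho> powr (r - 1)) * ((\<rho> powr r) powr (?z - 1) * exp (- (a * \<rho> powr r)) / r)"
          using r by simp
        have "ennreal (\<rho> ^ (n - 1) * \<rho> ^ n * exp (- (a * \<rho> powr r))) = ennreal (r * \<rho> powr (r - 1)) * q (\<rho> powr r)"
          unfolding eq q_def using r by (intro ennreal_mult) auto
        then show ?thesis using True by simp
      next
        case False
        then show ?thesis using elim by simp
      qed
    qed
  qed
  also have "\<dots> = (\<integral>\<^sup>+u. indicator {0..} u * q u \<partial>lborel)"
    using r by (rule nn_integral_powr_substitution) measurable
  also have "\<dots> = (\<integral>\<^sup>+u. ennreal (1 / r) * (indicator {0..} u * ennreal (u powr (?z - 1) * exp (- (a * u)))) \<partial>lborel)"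
  proof (rule nn_integral_cong)
    fix u
    have "q u = ennreal (1 / r) * ennreal (u powr (?z - 1) * exp (- (a * u)))"
      using r unfolding q_def by (subst ennreal_mult[symmetric]) auto
    then show "indicator {0..} u * q u = ennreal (1 / r) * (indicator {0..} u * ennreal (u powr (?z - 1) * exp (- (a * u))))"
      by (simp add: mult.left_commute)
  qed
  also have "\<dots> = ennreal (1 / r) * (\<integral>\<^sup>+u. indicator {0..} u * ennreal (u powr (?z - 1) * exp (- (a * u))) \<partial>lborel)"
    by (subst nn_integral_cmult) auto
  also have "\<dots> = ennreal (Gamma ?z / r * (1 / a) powr ?z)"
    unfolding nn_integral_Gamma_scaled[OF z a] using r Gamma_real_pos[OF z] by (simp add: ennreal_mult[symmetric] mult_ac)
  finally show ?thesis .
qed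

section \<open>Pairs of points in polar coordinates\<close>

lemma span_singleton_null:
  fixes y :: "'a::euclidean_space"
  assumes "DIM('a) \<ge> 2"
  shows "span {y} \<in> null_sets lborel"
proof -
  have "dim {y} \<le> 1" using dim_le_card'[of "{y}"] by simp
  then have "negligible (span {y})" using assms by (intro negligible_lowdim) (simp add: dim_span)
  then show ?thesis by (simp add: negligible_iff_null_sets null_sets_completion_iff closed_span)
qed

text \<open>The angles 0 and pi are the equality cases of the Cauchy-Schwarz inequality and occur
  only on the line through \<open>y\<close>, a null set in dimension at least 2. They are excluded
  because \<open>alpha\<close> divides by the sine.\<close>

lemma AE_angle:
  fixes y :: "real^'n"
  assumes n: "CARD('n) \<ge> 2" and y: "y \<noteq> 0"
  shows "AE x in lborel. x \<noteq> 0 \<and> 0 < arccos (x \<bullet> y / (norm x * norm y)) \<and> arccos (x \<bullet> y / (norm x * norm y)) < pi"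
proof -
  have "span {y} \<in> null_sets lborel" using n by (intro span_singleton_null) simp
  then have "AE x in lborel. x \<notin> span {y}" by (rule AE_not_in)
  then show ?thesis
  proof eventually_elim
    case (elim x)
    have x0: "x \<noteq> 0" using elim span_zero by blast
    let ?q = "x \<bullet> y / (norm x * norm y)"
    have nn: "norm x * norm y > 0" using x0 y by simp
    have "\<bar>x \<bullet> y\<bar> \<noteq> norm x * norm y"
    proof
      assume "\<bar>x \<bullet> y\<bar> = norm x * norm y"
      then have "norm y *\<^sub>R x = norm x *\<^sub>R y \<or> norm y *\<^sub>R x = - norm x *\<^sub>R y"
        unfolding norm_cauchy_schwarz_abs_eq by (metis minus_minus scaleR_minus_left)
      then have "norm y *\<^sub>R x \<in> span {y}" by (metis insertI1 span_base span_mul)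
      then have "(1 / norm y) *\<^sub>R (norm y *\<^sub>R x) \<in> span {y}" by (rule span_mul)
      then show False using elim y by simp
    qed
    then have "\<bar>x \<bullet> y\<bar> < norm x * norm y" using Cauchy_Schwarz_ineq2[of x y] by linarith
    then have q: "-1 < ?q" "?q < 1" using nn by (auto simp: divide_less_eq less_divide_eq abs_less_iff)
    then show ?case using x0 arccos_lt_bounded[of ?q] by auto
  qed
qed

lemma sphere_area_nonneg: "sphere_area k \<ge> 0"
  by (simp add: sphere_area_def)

text \<open>Symmetry allows \<open>y\<close> to be taken as the longer vector, at the price of the
  factor 2; this confines the ratio of the norms to the unit interval. Pairs of equal norm form a
  null set.\<close>

lemma nn_integral_swap_le:
  fixes p :: "real^'n \<Rightarrow> real^'n \<Rightarrow> ennreal"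
  assumes [measurable]: "(\<lambda>(x, y). p x y) \<in> borel_measurable (borel \<Otimes>\<^sub>M borel)"
    and sym: "\<And>x y. p x y = p y x"
  shows "(\<integral>\<^sup>+y. \<integral>\<^sup>+x. p x y \<partial>lborel \<partial>lborel) = 2 * (\<integral>\<^sup>+y. \<integral>\<^sup>+x. p x y * indicator {..norm y} (norm x) \<partial>lborel \<partial>lborel)"
proof -
  have pm [measurable (raw)]: "(\<lambda>w. p (a w) (b w)) \<in> borel_measurable L"
    if "a \<in> borel_measurable L" "b \<in> borel_measurable L" for a b and L :: "'z measure"
    using measurable_compose[OF _ assms(1), of "\<lambda>w. (a w, b w)" L] that by simp
  have [measurable (raw)]: "(\<lambda>w. indicator {..a w} (b w) :: ennreal) \<in> borel_measurable L"
    if [measurable]: "a \<in> borel_measurable L" "b \<in> borel_measurable L" for a b :: "'z \<Rightarrow> real" and L :: "'z measure"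
    unfolding indicator_def atMost_iff by measurable
  have [measurable (raw)]: "(\<lambda>w. indicator {..<a w} (b w) :: ennreal) \<in> borel_measurable L"
    if [measurable]: "a \<in> borel_measurable L" "b \<in> borel_measurable L" for a b :: "'z \<Rightarrow> real" and L :: "'z measure"
    unfolding indicator_def lessThan_iff by measurable
  have "(\<integral>\<^sup>+y. \<integral>\<^sup>+x. p x y \<partial>lborel \<partial>lborel) =
    (\<integral>\<^sup>+y. (\<integral>\<^sup>+x. p x y * indicator {..norm y} (norm x) \<partial>lborel) + (\<integral>\<^sup>+x. p x y * indicator {..<norm x} (norm y) \<partial>lborel) \<partial>lborel)"
  proof (rule nn_integral_cong)
    fix y :: "real^'n"
    have "(\<integral>\<^sup>+x. p x y \<partial>lborel) = (\<integral>\<^sup>+x. p x y * indicator {..norm y} (norm x) + p x y * indicator {..<norm x} (norm y) \<partial>lborel)"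
      by (intro nn_integral_cong) (auto simp: indicator_def)
    also have "\<dots> = (\<integral>\<^sup>+x. p x y * indicator {..norm y} (norm x) \<partial>lborel) + (\<integral>\<^sup>+x. p x y * indicator {..<norm x} (norm y) \<partial>lborel)"
      by (subst nn_integral_add) auto
    finally show "(\<integral>\<^sup>+x. p x y \<partial>lborel) = (\<integral>\<^sup>+x. p x y * indicator {..norm y} (norm x) \<partial>lborel) + (\<integral>\<^sup>+x. p x y * indicator {..<norm x} (norm y) \<partial>lborel)" .
  qed
  also have "\<dots> = (\<integral>\<^sup>+y. \<integral>\<^sup>+x. p x y * indicator {..norm y} (norm x) \<partial>lborel \<partial>lborel) + (\<integral>\<^sup>+y. \<integral>\<^sup>+x. p x y * indicator {..<norm x} (norm y) \<partial>lborel \<partial>lborel)"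
    by (subst nn_integral_add) auto
  also have "(\<integral>\<^sup>+y. \<integral>\<^sup>+x. p x y * indicator {..<norm x} (norm y) \<partial>lborel \<partial>lborel) = (\<integral>\<^sup>+x. \<integral>\<^sup>+y. p x y * indicator {..<norm x} (norm y) \<partial>lborel \<partial>lborel)"
    by (rule lborel_pair.Fubini') measurable
  also have "\<dots> = (\<integral>\<^sup>+y. \<integral>\<^sup>+x. p x y * indicator {..norm y} (norm x) \<partial>lborel \<partial>lborel)"
  proof (rule nn_integral_cong)
    fix y :: "real^'n"
    have "sphere 0 (norm y) \<in> null_sets (lborel :: (real^'n) measure)"
      using negligible_sphere[of "0::real^'n" "norm y"] by (simp add: negligible_iff_null_sets null_sets_completion_iff)
    then have "AE x in lborel. (x :: real^'n) \<notin> sphere 0 (norm y)" by (rule AE_not_in)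
    then show "(\<integral>\<^sup>+x. p y x * indicator {..<norm y} (norm x) \<partial>lborel) = (\<integral>\<^sup>+x. p x y * indicator {..norm y} (norm x) \<partial>lborel)"
      by (intro nn_integral_cong_AE) (auto simp: indicator_def sym[of y] elim!: eventually_mono)
  qed
  finally show ?thesis by (simp add: mult_2)
qed

text \<open>Stated for a general \<open>f\<close> so that the same constant stands in front of the
  second moment, with \<open>F r\<close>, and of the squared mean, with
  \<open>t powr r + 1\<close>.\<close>

proposition nn_integral_pair_polar:
  fixes p :: "real^'n \<Rightarrow> real^'n \<Rightarrow> ennreal" and f :: "real \<Rightarrow> real \<Rightarrow> real"
  assumes n: "CARD('n) \<ge> 2" and K: "K > 0" and r: "r > 0"
    and f [measurable]: "(\<lambda>q. f (fst q) (snd q)) \<in> borel_measurable (borel \<Otimes>\<^sub>M borel)"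
    and f1: "\<And>t \<phi>. 0 \<le> t \<Longrightarrow> 0 < \<phi> \<Longrightarrow> \<phi> < pi \<Longrightarrow> 1 \<le> f t \<phi>"
    and p [measurable]: "(\<lambda>(x, y). p x y) \<in> borel_measurable (borel \<Otimes>\<^sub>M borel)"
    and sym: "\<And>x y. p x y = p y x"
    and pf: "\<And>x y \<phi>. x \<noteq> 0 \<Longrightarrow> y \<noteq> 0 \<Longrightarrow> \<phi> = arccos (x \<bullet> y / (norm x * norm y)) \<Longrightarrow> 0 < \<phi> \<Longrightarrow> \<phi> < pi \<Longrightarrow>
      p x y = ennreal (exp (- (K * (norm y powr r * f (norm x / norm y) \<phi>))))"
  shows "(\<integral>\<^sup>+y. \<integral>\<^sup>+x. p x y \<partial>lborel \<partial>lborel) =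
    ennreal (2 * sphere_area (CARD('n) - 1) * sphere_area CARD('n) / r * Gamma (2 * real CARD('n) / r) * (1 / K) powr (2 * real CARD('n) / r)) *
    (\<integral>\<^sup>+\<phi>. (\<integral>\<^sup>+t. ennreal (t ^ (CARD('n) - 1) / f t \<phi> powr (2 * real CARD('n) / r)) * indicator {0<..1} t \<partial>lborel) *
      ennreal (sin \<phi> ^ (CARD('n) - 2)) * indicator {0<..<pi} \<phi> \<partial>lborel)"
proof -
  let ?n = "CARD('n)"
  let ?z = "2 * real ?n / r"
  let ?A = "sphere_area (?n - 1)"
  \<comment> \<open>The integrand in the variables \<open>\<rho> = norm y\<close>, \<open>t\<close>
    and \<phi> after the scaling \<open>s = \<rho> * t\<close>, which contributes
    \<open>\<rho> ^ (n - 1)\<close> through the power of \<open>s\<close> and one more \<rho>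
    through the substitution.\<close>
  define W where "W \<rho> t \<phi> = ennreal (\<rho> ^ ?n * exp (- (K * \<rho> powr r * f t \<phi>))) * ennreal (t ^ (?n - 1)) * indicator {0<..1} t * (ennreal (sin \<phi> ^ (?n - 2)) * indicator {0<..<pi} \<phi>)" for \<rho> t \<phi>
  have Wm [measurable]: "(\<lambda>q. W (fst (fst q)) (snd (fst q)) (snd q)) \<in> borel_measurable ((borel \<Otimes>\<^sub>M borel) \<Otimes>\<^sub>M borel)"
  proof -
    have [measurable]: "(\<lambda>q. f (snd (fst q)) (snd q)) \<in> borel_measurable ((borel \<Otimes>\<^sub>M borel) \<Otimes>\<^sub>M borel)"
      using measurable_compose[OF _ f, of "\<lambda>q. (snd (fst q), snd q)" "(borel \<Otimes>\<^sub>M borel) \<Otimes>\<^sub>M borel"] by simp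
    show ?thesis unfolding W_def by measurable
  qed
  have Wm' [measurable (raw)]: "(\<lambda>w. W (a w) (b w) (c w)) \<in> borel_measurable L"
    if "a \<in> borel_measurable L" "b \<in> borel_measurable L" "c \<in> borel_measurable L" for a b c and L :: "'z measure"
    using measurable_compose[OF _ Wm, of "\<lambda>w. ((a w, b w), c w)" L] that by simp
  define R where "R \<rho> = ennreal ?A * (\<integral>\<^sup>+\<phi>. (\<integral>\<^sup>+t. W \<rho> t \<phi> \<partial>lborel) \<partial>lborel)" for \<rho>
  have Rm [measurable]: "R \<in> borel_measurable borel" unfolding R_def by measurable
  \<comment> \<open>The inner integral, with the direction of \<open>y\<close> as axis, depends on
    \<open>y\<close> only through its norm, so the outer integral is radial.\<close>
  have inner: "(\<integral>\<^sup>+x. p x y * indicator {..norm y} (norm x) \<partial>lborel) = R (norm y)" if y: "y \<noteq> 0" for y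
  proof -
    define e where "e = y /\<^sub>R norm y"
    have e: "norm e = 1" using y by (simp add: e_def)
    have ny: "norm y > 0" using y by simp
    define g where "g = (\<lambda>q. ennreal (exp (- (K * (norm y powr r * f (fst q / norm y) (snd q))))) * indicator {..norm y} (fst q))"
    have gm [measurable]: "g \<in> borel_measurable (borel \<Otimes>\<^sub>M borel)"
    proof -
      have [measurable]: "(\<lambda>q. f (fst q / norm y) (snd q)) \<in> borel_measurable (borel \<Otimes>\<^sub>M borel)"
        using measurable_compose[OF _ f, of "\<lambda>q. (fst q / norm y, snd q)" "borel \<Otimes>\<^sub>M borel"] by simp
      show ?thesis unfolding g_def by measurable
    qed
    have "(\<integral>\<^sup>+x. p x y * indicator {..norm y} (norm x) \<partial>lborel) = (\<integral>\<^sup>+x. g (norm x, arccos (x \<bullet> e / norm x)) \<partial>lborel)"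
    proof (rule nn_integral_cong_AE)
      show "AE x in lborel. p x y * indicator {..norm y} (norm x) = g (norm x, arccos (x \<bullet> e / norm x))"
        using AE_angle[OF n y]
      proof eventually_elim
        case (elim x)
        have "x \<bullet> e / norm x = x \<bullet> y / (norm x * norm y)" by (simp add: e_def field_simps)
        then show ?case using elim pf[of x y "arccos (x \<bullet> y / (norm x * norm y))"] y by (simp add: g_def)
      qed
    qed
    also have "\<dots> = ennreal ?A * (\<integral>\<^sup>+\<phi>. (\<integral>\<^sup>+s. g (s, \<phi>) * ennreal (s ^ (?n - 1)) * indicator {0<..} s \<partial>lborel) * ennreal (sin \<phi> ^ (?n - 2)) * indicator {0<..<pi} \<phi> \<partial>lborel)"
      by (rule nn_integral_polar[OF n e gm])
    also have "(\<integral>\<^sup>+\<phi>. (\<integral>\<^sup>+s. g (s, \<phi>) * ennreal (s ^ (?n - 1)) * indicator {0<..} s \<partial>lborel) * ennreal (sin \<phi> ^ (?n - 2)) * indicator {0<..<pi} \<phi> \<partial>lborel) =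
      (\<integral>\<^sup>+\<phi>. (\<integral>\<^sup>+t. W (norm y) t \<phi> \<partial>lborel) \<partial>lborel)"
    proof (rule nn_integral_cong)
      fix \<phi>
      have "(\<integral>\<^sup>+s. g (s, \<phi>) * ennreal (s ^ (?n - 1)) * indicator {0<..} s \<partial>lborel) =
        ennreal \<bar>norm y\<bar> * (\<integral>\<^sup>+t. g (0 + norm y * t, \<phi>) * ennreal ((0 + norm y * t) ^ (?n - 1)) * indicator {0<..} (0 + norm y * t) \<partial>lborel)"
        using ny by (intro nn_integral_real_affine) auto
      also have "\<dots> = (\<integral>\<^sup>+t. ennreal (norm y) * (g (norm y * t, \<phi>) * ennreal ((norm y * t) ^ (?n - 1)) * indicator {0<..} (norm y * t)) \<partial>lborel)"
        by (subst nn_integral_cmult) auto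
      also have "\<dots> = (\<integral>\<^sup>+t. ennreal (norm y ^ ?n * exp (- (K * norm y powr r * f t \<phi>))) * ennreal (t ^ (?n - 1)) * indicator {0<..1} t \<partial>lborel)"
      proof (rule nn_integral_cong)
        fix t
        have i1: "indicator {0<..} (norm y * t) = (indicator {0<..} t :: ennreal)" using ny by (auto simp: indicator_def zero_less_mult_iff)
        have i2: "indicator {..norm y} (norm y * t) = (indicator {..1} t :: ennreal)" using ny by (auto simp: indicator_def)
        show "ennreal (norm y) * (g (norm y * t, \<phi>) * ennreal ((norm y * t) ^ (?n - 1)) * indicator {0<..} (norm y * t)) =
          ennreal (norm y ^ ?n * exp (- (K * norm y powr r * f t \<phi>))) * ennreal (t ^ (?n - 1)) * indicator {0<..1} t"
        proof (cases "0 < t \<and> t \<le> 1")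
          case True
          have "norm y * (exp (- (K * (norm y powr r * f t \<phi>))) * (norm y * t) ^ (?n - 1)) =
            (norm y ^ (?n - 1) * norm y) * exp (- (K * norm y powr r * f t \<phi>)) * t ^ (?n - 1)"
            by (simp add: power_mult_distrib mult_ac)
          also have "norm y ^ (?n - 1) * norm y = norm y ^ ?n" using n by (intro power_minus_mult) auto
          finally have "norm y * (exp (- (K * (norm y powr r * f t \<phi>))) * (norm y * t) ^ (?n - 1)) =
            norm y ^ ?n * exp (- (K * norm y powr r * f t \<phi>)) * t ^ (?n - 1)" .
          from arg_cong[where f=ennreal, OF this] show ?thesis
            using True ny unfolding i1 by (simp add: g_def i2 ennreal_mult mult.assoc)
        next
          case False
          then show ?thesis unfolding i1 by (auto simp: g_def i2 indicator_def)
        qed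
      qed
      finally have 1: "(\<integral>\<^sup>+s. g (s, \<phi>) * ennreal (s ^ (?n - 1)) * indicator {0<..} s \<partial>lborel) =
        (\<integral>\<^sup>+t. ennreal (norm y ^ ?n * exp (- (K * norm y powr r * f t \<phi>))) * ennreal (t ^ (?n - 1)) * indicator {0<..1} t \<partial>lborel)" .
      have fm [measurable]: "(\<lambda>t. f t \<phi>) \<in> borel_measurable borel"
        using measurable_compose[OF _ f, of "\<lambda>t. (t, \<phi>)" borel] by simp
      show "(\<integral>\<^sup>+s. g (s, \<phi>) * ennreal (s ^ (?n - 1)) * indicator {0<..} s \<partial>lborel) * ennreal (sin \<phi> ^ (?n - 2)) * indicator {0<..<pi} \<phi> =
        (\<integral>\<^sup>+t. W (norm y) t \<phi> \<partial>lborel)"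
        unfolding W_def 1 by (subst nn_integral_multc) (auto simp: mult.assoc)
    qed
    finally show ?thesis by (simp add: R_def)
  qed
  have "(\<integral>\<^sup>+y. \<integral>\<^sup>+x. p x y \<partial>lborel \<partial>lborel) = 2 * (\<integral>\<^sup>+y. \<integral>\<^sup>+x. p x y * indicator {..norm y} (norm x) \<partial>lborel \<partial>lborel)"
    by (rule nn_integral_swap_le[OF p sym])
  also have "(\<integral>\<^sup>+y. \<integral>\<^sup>+x. p x y * indicator {..norm y} (norm x) \<partial>lborel \<partial>lborel) = (\<integral>\<^sup>+y. R (norm y) \<partial>(lborel :: (real^'n) measure))"
    using AE_lborel_singleton[of "0 :: real^'n"] by (intro nn_integral_cong_AE) (auto simp: inner elim!: eventually_mono)
  also have "\<dots> = (\<integral>\<^sup>+\<rho>. radial_density ?n \<rho> * R \<rho> \<partial>lborel)"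
    by (subst nn_integral_radial) auto
  also have "\<dots> = (\<integral>\<^sup>+\<rho>. (\<integral>\<^sup>+\<phi>. (\<integral>\<^sup>+t. ennreal ?A * radial_density ?n \<rho> * W \<rho> t \<phi> \<partial>lborel) \<partial>lborel) \<partial>lborel)"
  proof (rule nn_integral_cong)
    fix \<rho>
    let ?c = "ennreal ?A * radial_density ?n \<rho>"
    have "(\<integral>\<^sup>+t. ?c * W \<rho> t \<phi> \<partial>lborel) = ?c * (\<integral>\<^sup>+t. W \<rho> t \<phi> \<partial>lborel)" for \<phi>
      by (rule nn_integral_cmult) measurable
    then have "(\<integral>\<^sup>+\<phi>. \<integral>\<^sup>+t. ?c * W \<rho> t \<phi> \<partial>lborel \<partial>lborel) = ?c * (\<integral>\<^sup>+\<phi>. \<integral>\<^sup>+t. W \<rho> t \<phi> \<partial>lborel \<partial>lborel)"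
      by (simp only:, intro nn_integral_cmult) measurable
    then show "radial_density ?n \<rho> * R \<rho> = (\<integral>\<^sup>+\<phi>. \<integral>\<^sup>+t. ?c * W \<rho> t \<phi> \<partial>lborel \<partial>lborel)"
      by (simp only: R_def mult_ac)
  qed
  \<comment> \<open>Two exchanges bring \<rho> to the innermost position, where it yields a Gamma
    integral for fixed \<open>t\<close> and \<phi>.\<close>
  also have "\<dots> = (\<integral>\<^sup>+\<phi>. (\<integral>\<^sup>+\<rho>. (\<integral>\<^sup>+t. ennreal ?A * radial_density ?n \<rho> * W \<rho> t \<phi> \<partial>lborel) \<partial>lborel) \<partial>lborel)"
    by (rule lborel_pair.Fubini') measurable
  also have "\<dots> = (\<integral>\<^sup>+\<phi>. (\<integral>\<^sup>+t. (\<integral>\<^sup>+\<rho>. ennreal ?A * radial_density ?n \<rho> * W \<rho> t \<phi> \<partial>lborel) \<partial>lborel) \<partial>lborel)"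
    by (intro nn_integral_cong lborel_pair.Fubini') measurable
  also have "\<dots> = (\<integral>\<^sup>+\<phi>. ennreal (?A * sphere_area ?n * (Gamma ?z / r) * (1 / K) powr ?z) * ((\<integral>\<^sup>+t. ennreal (t ^ (?n - 1) / f t \<phi> powr ?z) * indicator {0<..1} t \<partial>lborel) *
      ennreal (sin \<phi> ^ (?n - 2)) * indicator {0<..<pi} \<phi>) \<partial>lborel)"
  proof (rule nn_integral_cong)
    fix \<phi>
    let ?C = "?A * sphere_area ?n * (Gamma ?z / r) * (1 / K) powr ?z"
    have z0: "?z > 0" using r by simp
    have C0: "?C \<ge> 0" using Gamma_real_pos[OF z0] r by (simp add: sphere_area_def)
    show "(\<integral>\<^sup>+t. (\<integral>\<^sup>+\<rho>. ennreal ?A * radial_density ?n \<rho> * W \<rho> t \<phi> \<partial>lborel) \<partial>lborel) =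
      ennreal ?C * ((\<integral>\<^sup>+t. ennreal (t ^ (?n - 1) / f t \<phi> powr ?z) * indicator {0<..1} t \<partial>lborel) * ennreal (sin \<phi> ^ (?n - 2)) * indicator {0<..<pi} \<phi>)"
    proof (cases "0 < \<phi> \<and> \<phi> < pi")
      case False
      then have "W \<rho> t \<phi> = 0" for \<rho> t by (auto simp: W_def)
      then show ?thesis using False by simp
    next
      case True
      have sp: "sin \<phi> > 0" using True by (intro sin_gt_zero) auto
      have fm [measurable]: "(\<lambda>t. f t \<phi>) \<in> borel_measurable borel"
        using measurable_compose[OF _ f, of "\<lambda>t. (t, \<phi>)" borel] by simp
      have "(\<integral>\<^sup>+\<rho>. ennreal ?A * radial_density ?n \<rho> * W \<rho> t \<phi> \<partial>lborel) =
        ennreal ?C * (ennreal (t ^ (?n - 1) / f t \<phi> powr ?z) * indicator {0<..1} t) * ennreal (sin \<phi> ^ (?n - 2))" for t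
      proof (cases "0 < t \<and> t \<le> 1")
        case False
        then have "W \<rho> t \<phi> = 0" for \<rho> by (auto simp: W_def)
        then show ?thesis using False by simp
      next
        case t: True
        \<comment> \<open>Makes \<open>K * f t \<phi>\<close> positive, as required of the rate in
          the Gamma integral, and lets its power be split into a constant and
          \<open>f t \<phi>\<close>.\<close>
        have ft: "f t \<phi> \<ge> 1" using f1[of t \<phi>] t True by auto
        have "(\<integral>\<^sup>+\<rho>. ennreal ?A * radial_density ?n \<rho> * W \<rho> t \<phi> \<partial>lborel) =
          (\<integral>\<^sup>+\<rho>. ennreal (?A * sphere_area ?n * t ^ (?n - 1) * sin \<phi> ^ (?n - 2)) * (indicator {0..} \<rho> * ennreal (\<rho> ^ (?n - 1) * \<rho> ^ ?n * exp (- (K * f t \<phi> * \<rho> powr r)))) \<partial>lborel)"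
        proof (rule nn_integral_cong)
          fix \<rho> :: real
          show "ennreal ?A * radial_density ?n \<rho> * W \<rho> t \<phi> =
            ennreal (?A * sphere_area ?n * t ^ (?n - 1) * sin \<phi> ^ (?n - 2)) * (indicator {0..} \<rho> * ennreal (\<rho> ^ (?n - 1) * \<rho> ^ ?n * exp (- (K * f t \<phi> * \<rho> powr r))))"
          proof (cases "\<rho> \<ge> 0")
            case rho: True
            have "ennreal ?A * radial_density ?n \<rho> * W \<rho> t \<phi> =
              ennreal (?A * (sphere_area ?n * \<rho> ^ (?n - 1)) * (\<rho> ^ ?n * exp (- (K * \<rho> powr r * f t \<phi>)) * t ^ (?n - 1) * sin \<phi> ^ (?n - 2)))"
              using rho t True sp by (simp add: W_def radial_density_def sphere_area_def ennreal_mult[symmetric])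
            also have "?A * (sphere_area ?n * \<rho> ^ (?n - 1)) * (\<rho> ^ ?n * exp (- (K * \<rho> powr r * f t \<phi>)) * t ^ (?n - 1) * sin \<phi> ^ (?n - 2)) =
              (?A * sphere_area ?n * t ^ (?n - 1) * sin \<phi> ^ (?n - 2)) * (\<rho> ^ (?n - 1) * \<rho> ^ ?n * exp (- (K * f t \<phi> * \<rho> powr r)))"
              by (simp add: mult_ac)
            also have "ennreal \<dots> = ennreal (?A * sphere_area ?n * t ^ (?n - 1) * sin \<phi> ^ (?n - 2)) * ennreal (\<rho> ^ (?n - 1) * \<rho> ^ ?n * exp (- (K * f t \<phi> * \<rho> powr r)))"
              using rho t sp by (intro ennreal_mult) (auto simp: sphere_area_nonneg)
            finally show ?thesis using rho by simp
          qed (simp add: radial_density_def)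
        qed
        also have "\<dots> = ennreal (?A * sphere_area ?n * t ^ (?n - 1) * sin \<phi> ^ (?n - 2)) * (\<integral>\<^sup>+\<rho>. indicator {0..} \<rho> * ennreal (\<rho> ^ (?n - 1) * \<rho> ^ ?n * exp (- (K * f t \<phi> * \<rho> powr r))) \<partial>lborel)"
          by (subst nn_integral_cmult) auto
        also have "\<dots> = ennreal (?A * sphere_area ?n * t ^ (?n - 1) * sin \<phi> ^ (?n - 2)) * ennreal (Gamma ?z / r * (1 / (K * f t \<phi>)) powr ?z)"
          using r K ft n by (subst nn_integral_power_exp_powr) auto
        also have "\<dots> = ennreal (?A * sphere_area ?n * t ^ (?n - 1) * sin \<phi> ^ (?n - 2) * (Gamma ?z / r * (1 / (K * f t \<phi>)) powr ?z))"
          using t sp r Gamma_real_pos[OF z0] by (subst ennreal_mult) (auto simp: sphere_area_nonneg)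
        also have "(1 / (K * f t \<phi>)) powr ?z = (1 / K) powr ?z * (1 / f t \<phi> powr ?z)"
          using K ft by (simp add: powr_mult powr_divide)
        also have "?A * sphere_area ?n * t ^ (?n - 1) * sin \<phi> ^ (?n - 2) * (Gamma ?z / r * ((1 / K) powr ?z * (1 / f t \<phi> powr ?z))) =
          ?C * (t ^ (?n - 1) / f t \<phi> powr ?z) * sin \<phi> ^ (?n - 2)" by simp
        also have "ennreal \<dots> = ennreal ?C * ennreal (t ^ (?n - 1) / f t \<phi> powr ?z) * ennreal (sin \<phi> ^ (?n - 2))"
          using C0 t sp by (simp add: ennreal_mult del: times_divide_eq_right times_divide_eq_left)
        finally show ?thesis using t by simp
      qed
      then have "(\<integral>\<^sup>+t. (\<integral>\<^sup>+\<rho>. ennreal ?A * radial_density ?n \<rho> * W \<rho> t \<phi> \<partial>lborel) \<partial>lborel) =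
        (\<integral>\<^sup>+t. ennreal ?C * (ennreal (t ^ (?n - 1) / f t \<phi> powr ?z) * indicator {0<..1} t) * ennreal (sin \<phi> ^ (?n - 2)) \<partial>lborel)" by simp
      also have "\<dots> = ennreal ?C * (\<integral>\<^sup>+t. ennreal (t ^ (?n - 1) / f t \<phi> powr ?z) * indicator {0<..1} t \<partial>lborel) * ennreal (sin \<phi> ^ (?n - 2))"
        by (subst nn_integral_multc, measurable, subst nn_integral_cmult) auto
      finally show ?thesis using True by (simp add: mult.assoc)
    qed
  qed
  also have "\<dots> = ennreal (?A * sphere_area ?n * (Gamma ?z / r) * (1 / K) powr ?z) * (\<integral>\<^sup>+\<phi>. (\<integral>\<^sup>+t. ennreal (t ^ (?n - 1) / f t \<phi> powr ?z) * indicator {0<..1} t \<partial>lborel) *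
      ennreal (sin \<phi> ^ (?n - 2)) * indicator {0<..<pi} \<phi> \<partial>lborel)"
  proof (rule nn_integral_cmult)
    have [measurable]: "(\<lambda>q. f (snd q) (fst q)) \<in> borel_measurable (borel \<Otimes>\<^sub>M borel)"
      using measurable_compose[OF _ f, of "\<lambda>q. (snd q, fst q)" "borel \<Otimes>\<^sub>M borel"] by simp
    have "(\<lambda>(\<phi>, t). ennreal (t ^ (?n - 1) / f t \<phi> powr ?z) * indicator {0<..1} t) \<in> borel_measurable (borel \<Otimes>\<^sub>M lborel)"
      unfolding case_prod_beta' by measurable
    from lborel.borel_measurable_nn_integral[OF this]
    have [measurable]: "(\<lambda>\<phi>. \<integral>\<^sup>+t. ennreal (t ^ (?n - 1) / f t \<phi> powr ?z) * indicator {0<..1} t \<partial>lborel) \<in> borel_measurable borel" .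
    show "(\<lambda>\<phi>. (\<integral>\<^sup>+t. ennreal (t ^ (?n - 1) / f t \<phi> powr ?z) * indicator {0<..1} t \<partial>lborel) * ennreal (sin \<phi> ^ (?n - 2)) * indicator {0<..<pi} \<phi>) \<in> borel_measurable lborel"
      by measurable
  qed
  also have "2 * (ennreal (?A * sphere_area ?n * (Gamma ?z / r) * (1 / K) powr ?z) * I) =
    ennreal (2 * ?A * sphere_area ?n / r * Gamma ?z * (1 / K) powr ?z) * I" for I
  proof -
    have "ennreal (2 * ?A * sphere_area ?n / r * Gamma ?z * (1 / K) powr ?z) = ennreal (2 * (?A * sphere_area ?n * (Gamma ?z / r) * (1 / K) powr ?z))"
      by (simp add: mult_ac)
    also have "\<dots> = 2 * ennreal (?A * sphere_area ?n * (Gamma ?z / r) * (1 / K) powr ?z)"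
      using r Gamma_real_pos[of ?z] n by (subst ennreal_mult) (auto simp: sphere_area_nonneg)
    finally show ?thesis by (simp add: mult.assoc)
  qed
  finally show ?thesis .
qed

text \<open>A function with values between 0 and 1 on a bounded rectangle has finite integrals in
  either sense. The bounds are assumed away from \<open>t = 0\<close>, \<open>\<phi> = 0\<close> and
  \<open>\<phi> = pi\<close>, where \<open>h\<close> is not controlled; these sets are null.\<close>

lemma iterated_integral_unit_bounded:
  fixes h :: "real \<Rightarrow> real \<Rightarrow> real"
  assumes h: "(\<lambda>q. h (fst q) (snd q)) \<in> borel_measurable (borel \<Otimes>\<^sub>M borel)"
    and bd: "\<And>t \<phi>. 0 < t \<Longrightarrow> t \<le> 1 \<Longrightarrow> 0 < \<phi> \<Longrightarrow> \<phi> < pi \<Longrightarrow> 0 \<le> h t \<phi> \<and> h t \<phi> \<le> 1"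
  shows "\<And>\<phi>. 0 < \<phi> \<Longrightarrow> \<phi> < pi \<Longrightarrow> set_integrable lborel {0..1} (\<lambda>t. h t \<phi>)"
    and "set_integrable lborel {0..pi} (\<lambda>\<phi>. LBINT t:{0..1}. h t \<phi>)"
    and "(\<integral>\<^sup>+\<phi>. (\<integral>\<^sup>+t. ennreal (h t \<phi>) * indicator {0<..1} t \<partial>lborel) * indicator {0<..<pi} \<phi> \<partial>lborel) =
      ennreal (LBINT \<phi>:{0..pi}. LBINT t:{0..1}. h t \<phi>)"
    and "0 \<le> (LBINT \<phi>:{0..pi}. LBINT t:{0..1}. h t \<phi>)"
proof -
  have hm [measurable]: "(\<lambda>t. h t \<phi>) \<in> borel_measurable borel" for \<phi>
    using measurable_compose[OF _ h, of "\<lambda>t. (t, \<phi>)" borel] by simp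
  have [measurable]: "(\<lambda>q. h (snd q) (fst q)) \<in> borel_measurable (borel \<Otimes>\<^sub>M borel)"
    using measurable_compose[OF _ h, of "\<lambda>q. (snd q, fst q)" "borel \<Otimes>\<^sub>M borel"] by simp
  have AE0: "AE t in lborel. t \<noteq> (0::real)" by (rule AE_lborel_singleton)
  show int: "set_integrable lborel {0..1} (\<lambda>t. h t \<phi>)" if p: "0 < \<phi>" "\<phi> < pi" for \<phi>
    unfolding set_integrable_def
  proof (rule Bochner_Integration.integrable_bound)
    show "integrable lborel (\<lambda>t :: real. indicator {0..1} t :: real)"
      by (rule integrable_real_indicator) (simp_all add: emeasure_lborel_Icc_eq)
    show "AE t in lborel. norm (indicator {0..1} t *\<^sub>R h t \<phi>) \<le> norm (indicator {0..1} t :: real)"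
      using AE0 by eventually_elim (use bd p in \<open>auto simp: indicator_def\<close>)
  qed measurable
  define H where "H \<phi> = (LBINT t:{0..1}. h t \<phi>)" for \<phi>
  have Hm [measurable]: "H \<in> borel_measurable borel"
  proof -
    have "(\<lambda>(\<phi>, t). indicator {0..1} t *\<^sub>R h t \<phi>) \<in> borel_measurable (borel \<Otimes>\<^sub>M lborel)"
      unfolding case_prod_beta' by measurable
    from lborel.borel_measurable_lebesgue_integral[OF this] show ?thesis
      unfolding H_def set_lebesgue_integral_def .
  qed
  have nn: "(\<integral>\<^sup>+t. ennreal (h t \<phi>) * indicator {0<..1} t \<partial>lborel) = ennreal (H \<phi>)" "0 \<le> H \<phi>" "H \<phi> \<le> 1"
    if p: "0 < \<phi>" "\<phi> < pi" for \<phi>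
  proof -
    have nonneg: "AE t in lborel. 0 \<le> indicator {0..1} t *\<^sub>R h t \<phi>"
      using AE0 by eventually_elim (use bd p in \<open>auto simp: indicator_def\<close>)
    have "(\<integral>\<^sup>+t. ennreal (h t \<phi>) * indicator {0<..1} t \<partial>lborel) = (\<integral>\<^sup>+t. ennreal (indicator {0..1} t *\<^sub>R h t \<phi>) \<partial>lborel)"
      using AE0 by (intro nn_integral_cong_AE) (auto simp: indicator_def elim!: eventually_mono)
    also have "\<dots> = ennreal (H \<phi>)"
      unfolding H_def set_lebesgue_integral_def
      using int[OF p] nonneg by (intro nn_integral_eq_integral) (auto simp: set_integrable_def)
    finally show eq: "(\<integral>\<^sup>+t. ennreal (h t \<phi>) * indicator {0<..1} t \<partial>lborel) = ennreal (H \<phi>)" .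
    show H0: "0 \<le> H \<phi>" unfolding H_def set_lebesgue_integral_def using nonneg by (rule integral_nonneg_AE)
    have "ennreal (H \<phi>) \<le> (\<integral>\<^sup>+t. indicator {0..1} (t :: real) \<partial>lborel)"
      unfolding eq[symmetric] using bd p by (intro nn_integral_mono) (auto simp: indicator_def)
    also have "\<dots> = 1" by simp
    finally show "H \<phi> \<le> 1" by simp
  qed
  have AEp: "AE \<phi> in lborel. \<phi> \<noteq> 0 \<and> \<phi> \<noteq> pi"
    using AE_lborel_singleton[of "0::real"] AE_lborel_singleton[of pi] by eventually_elim auto
  show Hint: "set_integrable lborel {0..pi} (\<lambda>\<phi>. LBINT t:{0..1}. h t \<phi>)"
    unfolding set_integrable_def H_def[symmetric]
  proof (rule Bochner_Integration.integrable_bound)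
    show "integrable lborel (\<lambda>t. indicator {0..pi} t :: real)"
      by (rule integrable_real_indicator) (simp_all add: emeasure_lborel_Icc_eq)
    show "AE t in lborel. norm (indicator {0..pi} t *\<^sub>R H t) \<le> norm (indicator {0..pi} t :: real)"
      using AEp by eventually_elim (use nn(2,3) in \<open>auto simp: indicator_def\<close>)
  qed measurable
  have nonneg: "AE \<phi> in lborel. 0 \<le> indicator {0..pi} \<phi> *\<^sub>R H \<phi>"
    using AEp by eventually_elim (use nn(2) in \<open>auto simp: indicator_def\<close>)
  have "(\<integral>\<^sup>+\<phi>. (\<integral>\<^sup>+t. ennreal (h t \<phi>) * indicator {0<..1} t \<partial>lborel) * indicator {0<..<pi} \<phi> \<partial>lborel) =
    (\<integral>\<^sup>+\<phi>. ennreal (indicator {0..pi} \<phi> *\<^sub>R H \<phi>) \<partial>lborel)"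
  proof (rule nn_integral_cong_AE)
    show "AE \<phi> in lborel. (\<integral>\<^sup>+t. ennreal (h t \<phi>) * indicator {0<..1} t \<partial>lborel) * indicator {0<..<pi} \<phi> = ennreal (indicator {0..pi} \<phi> *\<^sub>R H \<phi>)"
      using AEp
    proof eventually_elim
      case (elim \<phi>)
      show ?case
      proof (cases "0 < \<phi> \<and> \<phi> < pi")
        case True
        then show ?thesis by (simp add: nn(1))
      next
        case False
        then show ?thesis using elim by (auto simp: indicator_def)
      qed
    qed
  qed
  also have "\<dots> = ennreal (LBINT \<phi>:{0..pi}. LBINT t:{0..1}. h t \<phi>)"
    unfolding H_def[symmetric] set_lebesgue_integral_def[of lborel "{0..pi}"]
    using Hint nonneg unfolding H_def[symmetric] by (intro nn_integral_eq_integral) (auto simp: set_integrable_def)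
  finally show "(\<integral>\<^sup>+\<phi>. (\<integral>\<^sup>+t. ennreal (h t \<phi>) * indicator {0<..1} t \<partial>lborel) * indicator {0<..<pi} \<phi> \<partial>lborel) =
    ennreal (LBINT \<phi>:{0..pi}. LBINT t:{0..1}. h t \<phi>)" .
  show "0 \<le> (LBINT \<phi>:{0..pi}. LBINT t:{0..1}. h t \<phi>)"
    unfolding H_def[symmetric] set_lebesgue_integral_def[of lborel "{0..pi}"] using nonneg by (rule integral_nonneg_AE)
qed

text \<open>An integral with variable limits is the integral of a jointly measurable indicator times
  the integrand, hence measurable in the limits.\<close>

lemma F_measurable: "(\<lambda>q. F r (fst q) (snd q)) \<in> borel_measurable (borel \<Otimes>\<^sub>M borel)"
proof -
  have am [measurable]: "(\<lambda>q. alpha (fst q) (snd q)) \<in> borel_measurable (borel \<Otimes>\<^sub>M borel)"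
    unfolding alpha_def by measurable
  have *: "(\<lambda>q. LBINT \<theta>:{a q..b q}. cos \<theta> powr r) \<in> borel_measurable (borel \<Otimes>\<^sub>M borel)"
    if ab [measurable]: "a \<in> borel_measurable (borel \<Otimes>\<^sub>M borel)" "b \<in> borel_measurable (borel \<Otimes>\<^sub>M borel)" for a b :: "real \<times> real \<Rightarrow> real"
  proof -
    have "(\<lambda>(q, \<theta>). indicator {a q..b q} \<theta> *\<^sub>R cos \<theta> powr r) \<in> borel_measurable ((borel \<Otimes>\<^sub>M borel) \<Otimes>\<^sub>M lborel)"
      unfolding case_prod_beta' indicator_def atLeastAtMost_iff by measurable
    from lborel.borel_measurable_lebesgue_integral[OF this] show ?thesis
      unfolding set_lebesgue_integral_def .
  qed
  have [measurable]: "(\<lambda>q. LBINT \<theta>:{- (pi / 2)..alpha (fst q) (snd q)}. cos \<theta> powr r) \<in> borel_measurable (borel \<Otimes>\<^sub>M borel)"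
    "(\<lambda>q. LBINT \<theta>:{alpha (fst q) (snd q) - snd q..pi / 2}. cos \<theta> powr r) \<in> borel_measurable (borel \<Otimes>\<^sub>M borel)"
    by (rule *; measurable)+
  show ?thesis unfolding F_def by measurable
qed

text \<open>The lower bound \<open>f \<ge> 1\<close> keeps the weight \<open>h\<close> between 0 and
  1, which turns the extended nonnegative integrals into real iterated ones. The integrability
  statements are what the subtraction in the variance needs.\<close>

lemma pair_volume_formula:
  fixes p :: "real^'n \<Rightarrow> real^'n \<Rightarrow> ennreal" and f :: "real \<Rightarrow> real \<Rightarrow> real"
  assumes n: "CARD('n) \<ge> 2" and K: "K > 0" and r: "r > 0"
    and f [measurable]: "(\<lambda>q. f (fst q) (snd q)) \<in> borel_measurable (borel \<Otimes>\<^sub>M borel)"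
    and f1: "\<And>t \<phi>. 0 \<le> t \<Longrightarrow> 0 < \<phi> \<Longrightarrow> \<phi> < pi \<Longrightarrow> 1 \<le> f t \<phi>"
    and p: "(\<lambda>(x, y). p x y) \<in> borel_measurable (borel \<Otimes>\<^sub>M borel)"
    and sym: "\<And>x y. p x y = p y x"
    and pf: "\<And>x y \<phi>. x \<noteq> 0 \<Longrightarrow> y \<noteq> 0 \<Longrightarrow> \<phi> = arccos (x \<bullet> y / (norm x * norm y)) \<Longrightarrow> 0 < \<phi> \<Longrightarrow> \<phi> < pi \<Longrightarrow>
      p x y = ennreal (exp (- (K * (norm y powr r * f (norm x / norm y) \<phi>))))"
  defines "z \<equiv> 2 * real CARD('n) / r"
  defines "h \<equiv> \<lambda>t \<phi>. t ^ (CARD('n) - 1) / f t \<phi> powr z * sin \<phi> ^ (CARD('n) - 2)"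
  shows "(\<integral>\<^sup>+y. \<integral>\<^sup>+x. p x y \<partial>lborel \<partial>lborel) =
    ennreal (2 * sphere_area (CARD('n) - 1) * sphere_area CARD('n) / r * Gamma z * (1 / K) powr z * (LBINT \<phi>:{0..pi}. LBINT t:{0..1}. h t \<phi>))"
    and "\<And>\<phi>. 0 < \<phi> \<Longrightarrow> \<phi> < pi \<Longrightarrow> set_integrable lborel {0..1} (\<lambda>t. h t \<phi>)"
    and "set_integrable lborel {0..pi} (\<lambda>\<phi>. LBINT t:{0..1}. h t \<phi>)"
    and "0 \<le> (LBINT \<phi>:{0..pi}. LBINT t:{0..1}. h t \<phi>)"
proof -
  let ?n = "CARD('n)"
  let ?A = "2 * sphere_area (?n - 1) * sphere_area ?n / r * Gamma z * (1 / K) powr z"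
  have z: "z > 0" using r by (simp add: z_def)
  have hm: "(\<lambda>q. h (fst q) (snd q)) \<in> borel_measurable (borel \<Otimes>\<^sub>M borel)" unfolding h_def by measurable
  have bd: "0 \<le> h t \<phi> \<and> h t \<phi> \<le> 1" if t: "0 < t" "t \<le> 1" "0 < \<phi>" "\<phi> < pi" for t \<phi>
  proof -
    have sp: "0 \<le> sin \<phi>" using t by (intro sin_ge_zero) auto
    have "1 \<le> f t \<phi> powr z" using f1[of t \<phi>] t z by (intro ge_one_powr_ge_zero) auto
    then have "t ^ (?n - 1) / f t \<phi> powr z \<le> 1 / 1" using t by (intro frac_le) (auto intro: power_le_one)
    moreover have "sin \<phi> ^ (?n - 2) \<le> 1" using sp by (intro power_le_one) auto
    ultimately have "h t \<phi> \<le> 1 * 1" unfolding h_def using t sp by (intro mult_mono) auto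
    moreover have "0 \<le> h t \<phi>" unfolding h_def using t sp by simp
    ultimately show ?thesis by simp
  qed
  note I = iterated_integral_unit_bounded[OF hm bd]
  show "\<And>\<phi>. 0 < \<phi> \<Longrightarrow> \<phi> < pi \<Longrightarrow> set_integrable lborel {0..1} (\<lambda>t. h t \<phi>)" by (rule I(1)) auto
  show "set_integrable lborel {0..pi} (\<lambda>\<phi>. LBINT t:{0..1}. h t \<phi>)" by (rule I(2)) auto
  show I0: "0 \<le> (LBINT \<phi>:{0..pi}. LBINT t:{0..1}. h t \<phi>)" by (rule I(4)) auto
  have "(\<integral>\<^sup>+y. \<integral>\<^sup>+x. p x y \<partial>lborel \<partial>lborel) = ennreal ?A *
    (\<integral>\<^sup>+\<phi>. (\<integral>\<^sup>+t. ennreal (t ^ (?n - 1) / f t \<phi> powr z) * indicator {0<..1} t \<partial>lborel) * ennreal (sin \<phi> ^ (?n - 2)) * indicator {0<..<pi} \<phi> \<partial>lborel)"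
    unfolding z_def by (rule nn_integral_pair_polar[OF n K r f f1 p sym pf])
  also have "(\<integral>\<^sup>+\<phi>. (\<integral>\<^sup>+t. ennreal (t ^ (?n - 1) / f t \<phi> powr z) * indicator {0<..1} t \<partial>lborel) * ennreal (sin \<phi> ^ (?n - 2)) * indicator {0<..<pi} \<phi> \<partial>lborel) =
    (\<integral>\<^sup>+\<phi>. (\<integral>\<^sup>+t. ennreal (h t \<phi>) * indicator {0<..1} t \<partial>lborel) * indicator {0<..<pi} \<phi> \<partial>lborel)"
  proof (rule nn_integral_cong)
    fix \<phi>
    have fm [measurable]: "(\<lambda>t. f t \<phi>) \<in> borel_measurable borel"
      using measurable_compose[OF _ f, of "\<lambda>t. (t, \<phi>)" borel] by simp
    show "(\<integral>\<^sup>+t. ennreal (t ^ (?n - 1) / f t \<phi> powr z) * indicator {0<..1} t \<partial>lborel) * ennreal (sin \<phi> ^ (?n - 2)) * indicator {0<..<pi} \<phi> =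
      (\<integral>\<^sup>+t. ennreal (h t \<phi>) * indicator {0<..1} t \<partial>lborel) * indicator {0<..<pi} \<phi>"
    proof (cases "0 < \<phi> \<and> \<phi> < pi")
      case True
      then have sp: "0 \<le> sin \<phi>" by (intro sin_ge_zero) auto
      have "(\<integral>\<^sup>+t. ennreal (t ^ (?n - 1) / f t \<phi> powr z) * indicator {0<..1} t \<partial>lborel) * ennreal (sin \<phi> ^ (?n - 2)) =
        (\<integral>\<^sup>+t. ennreal (t ^ (?n - 1) / f t \<phi> powr z) * indicator {0<..1} t * ennreal (sin \<phi> ^ (?n - 2)) \<partial>lborel)"
        by (subst nn_integral_multc) auto
      also have "\<dots> = (\<integral>\<^sup>+t. ennreal (h t \<phi>) * indicator {0<..1} t \<partial>lborel)"
      proof (rule nn_integral_cong)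
        fix t :: real
        show "ennreal (t ^ (?n - 1) / f t \<phi> powr z) * indicator {0<..1} t * ennreal (sin \<phi> ^ (?n - 2)) = ennreal (h t \<phi>) * indicator {0<..1} t"
        proof (cases "0 < t \<and> t \<le> 1")
          case True
          then have "ennreal (h t \<phi>) = ennreal (t ^ (?n - 1) / f t \<phi> powr z) * ennreal (sin \<phi> ^ (?n - 2))"
            unfolding h_def using sp by (intro ennreal_mult) auto
          then show ?thesis using True by simp
        qed auto
      qed
      finally show ?thesis by simp
    qed auto
  qed
  also have "\<dots> = ennreal (LBINT \<phi>:{0..pi}. LBINT t:{0..1}. h t \<phi>)" by (rule I(3)) auto
  also have "ennreal ?A * \<dots> = ennreal (?A * (LBINT \<phi>:{0..pi}. LBINT t:{0..1}. h t \<phi>))"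
    using r Gamma_real_pos[OF z] I0 by (intro ennreal_mult[symmetric]) (auto simp: sphere_area_nonneg)
  finally show "(\<integral>\<^sup>+y. \<integral>\<^sup>+x. p x y \<partial>lborel \<partial>lborel) = ennreal (?A * (LBINT \<phi>:{0..pi}. LBINT t:{0..1}. h t \<phi>))" .
qed

subsection \<open>Moments of the volume of the zero cell\<close>

lemma zero_cell_indicator_measurable:
  assumes X: "hyperplane_process M X"
  shows "(\<lambda>p. indicator (zero_cell (X (fst p))) (snd p) :: ennreal) \<in> borel_measurable (M \<Otimes>\<^sub>M borel)"
proof -
  let ?Q = "{p \<in> space (M \<Otimes>\<^sub>M borel). snd p \<in> zero_cell (X (fst p))}"
  have "indicator ?Q \<in> borel_measurable (M \<Otimes>\<^sub>M borel)"
    using zero_cell_pair_measurable[OF X] by (rule borel_measurable_indicator)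
  then show ?thesis by (rule measurable_cong[THEN iffD1, rotated]) (simp add: indicator_def)
qed

lemma zero_cell_borel:
  assumes X: "hyperplane_process M X" and w: "\<omega> \<in> space M"
  shows "zero_cell (X \<omega>) \<in> sets borel"
proof -
  let ?Q = "{p \<in> space (M \<Otimes>\<^sub>M borel). snd p \<in> zero_cell (X (fst p))}"
  have "Pair \<omega> -` ?Q \<in> sets borel" using zero_cell_pair_measurable[OF X] by (rule sets_Pair1)
  moreover have "Pair \<omega> -` ?Q = zero_cell (X \<omega>)" using w by (auto simp: space_pair_measure)
  ultimately show ?thesis by simp
qed

text \<open>The squared volume is the double integral of a product of two indicators, and joint
  measurability of the random set permits the exchange with the expectation. The mean uses the same
  kernel on the diagonal.\<close>

proposition second_moment_integral:
  fixes X :: "'w \<Rightarrow> (real^'n) set measure"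
  assumes M: "prob_space M" and X: "hyperplane_process M X"
  defines "p \<equiv> \<lambda>x y. ennreal (measure M {\<omega> \<in> space M. x \<in> zero_cell (X \<omega>) \<and> y \<in> zero_cell (X \<omega>)})"
  shows "(\<lambda>\<omega>. emeasure lborel (zero_cell (X \<omega>))) \<in> borel_measurable M"
    and "(\<lambda>(x, y). p x y) \<in> borel_measurable (borel \<Otimes>\<^sub>M borel)"
    and "(\<integral>\<^sup>+\<omega>. (emeasure lborel (zero_cell (X \<omega>)))\<^sup>2 \<partial>M) = (\<integral>\<^sup>+y. \<integral>\<^sup>+x. p x y \<partial>lborel \<partial>lborel)"
    and "(\<integral>\<^sup>+\<omega>. emeasure lborel (zero_cell (X \<omega>)) \<partial>M) = (\<integral>\<^sup>+x. p x x \<partial>lborel)"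
proof -
  interpret M: prob_space M by fact
  interpret MP: pair_sigma_finite M "lborel :: (real^'n) measure" ..
  define i :: "'w \<Rightarrow> real^'n \<Rightarrow> ennreal" where "i \<omega> x = indicator (zero_cell (X \<omega>)) x" for \<omega> x
  have im0: "(\<lambda>p. i (fst p) (snd p)) \<in> borel_measurable (M \<Otimes>\<^sub>M borel)"
    unfolding i_def by (rule zero_cell_indicator_measurable[OF X])
  have im [measurable (raw)]: "(\<lambda>w. i (a w) (b w)) \<in> borel_measurable L"
    if "a \<in> measurable L M" "b \<in> borel_measurable L" for a b and L :: "'z measure"
    using measurable_compose[OF _ im0, of "\<lambda>w. (a w, b w)" L] that by simp
  have V: "emeasure lborel (zero_cell (X \<omega>)) = (\<integral>\<^sup>+x. i \<omega> x \<partial>lborel)" if "\<omega> \<in> space M" for \<omega>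
    unfolding i_def using zero_cell_borel[OF X that] by simp
  have Vm [measurable]: "(\<lambda>\<omega>. \<integral>\<^sup>+x. i \<omega> x \<partial>lborel) \<in> borel_measurable M" by measurable
  then show "(\<lambda>\<omega>. emeasure lborel (zero_cell (X \<omega>))) \<in> borel_measurable M"
    by (rule measurable_cong[THEN iffD1, rotated]) (simp add: V)
  have p: "p x y = (\<integral>\<^sup>+\<omega>. i \<omega> x * i \<omega> y \<partial>M)" for x y
  proof -
    have "{\<omega> \<in> space M. i \<omega> x * i \<omega> y \<noteq> 0} \<in> sets M" by measurable
    moreover have eq: "{\<omega> \<in> space M. i \<omega> x * i \<omega> y \<noteq> 0} = {\<omega> \<in> space M. x \<in> zero_cell (X \<omega>) \<and> y \<in> zero_cell (X \<omega>)}"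
      by (auto simp: i_def indicator_eq_0_iff)
    ultimately have S: "{\<omega> \<in> space M. x \<in> zero_cell (X \<omega>) \<and> y \<in> zero_cell (X \<omega>)} \<in> sets M" by (simp only: eq)
    have "(\<integral>\<^sup>+\<omega>. i \<omega> x * i \<omega> y \<partial>M) = (\<integral>\<^sup>+\<omega>. indicator {\<omega> \<in> space M. x \<in> zero_cell (X \<omega>) \<and> y \<in> zero_cell (X \<omega>)} \<omega> \<partial>M)"
      by (intro nn_integral_cong) (auto simp: i_def indicator_def)
    also have "\<dots> = emeasure M {\<omega> \<in> space M. x \<in> zero_cell (X \<omega>) \<and> y \<in> zero_cell (X \<omega>)}" using S by simp
    finally show ?thesis by (simp add: p_def M.emeasure_eq_measure)
  qed
  have "(\<lambda>q. \<integral>\<^sup>+\<omega>. i \<omega> (fst q) * i \<omega> (snd q) \<partial>M) \<in> borel_measurable (borel \<Otimes>\<^sub>M borel)" by measurable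
  then show "(\<lambda>(x, y). p x y) \<in> borel_measurable (borel \<Otimes>\<^sub>M borel)" by (simp add: p case_prod_beta')
  have "(\<integral>\<^sup>+\<omega>. (emeasure lborel (zero_cell (X \<omega>)))\<^sup>2 \<partial>M) = (\<integral>\<^sup>+\<omega>. (\<integral>\<^sup>+y. (\<integral>\<^sup>+x. i \<omega> x * i \<omega> y \<partial>lborel) \<partial>lborel) \<partial>M)"
  proof (rule nn_integral_cong)
    fix \<omega> assume w [measurable]: "\<omega> \<in> space M"
    have [measurable]: "i \<omega> \<in> borel_measurable borel" unfolding i_def using zero_cell_borel[OF X w] by simp
    have "(\<integral>\<^sup>+y. (\<integral>\<^sup>+x. i \<omega> x * i \<omega> y \<partial>lborel) \<partial>lborel) = (\<integral>\<^sup>+y. (\<integral>\<^sup>+x. i \<omega> x \<partial>lborel) * i \<omega> y \<partial>lborel)"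
      by (intro nn_integral_cong nn_integral_multc) auto
    also have "\<dots> = (\<integral>\<^sup>+x. i \<omega> x \<partial>lborel) * (\<integral>\<^sup>+x. i \<omega> x \<partial>lborel)"
      by (intro nn_integral_cmult) auto
    finally show "(emeasure lborel (zero_cell (X \<omega>)))\<^sup>2 = (\<integral>\<^sup>+y. (\<integral>\<^sup>+x. i \<omega> x * i \<omega> y \<partial>lborel) \<partial>lborel)"
      by (simp add: V[OF w] power2_eq_square)
  qed
  also have "\<dots> = (\<integral>\<^sup>+y. (\<integral>\<^sup>+\<omega>. (\<integral>\<^sup>+x. i \<omega> x * i \<omega> y \<partial>lborel) \<partial>M) \<partial>lborel)"
    by (rule MP.Fubini'[symmetric]) measurable
  also have "\<dots> = (\<integral>\<^sup>+y. (\<integral>\<^sup>+x. (\<integral>\<^sup>+\<omega>. i \<omega> x * i \<omega> y \<partial>M) \<partial>lborel) \<partial>lborel)"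
    by (intro nn_integral_cong MP.Fubini'[symmetric]) measurable
  finally show "(\<integral>\<^sup>+\<omega>. (emeasure lborel (zero_cell (X \<omega>)))\<^sup>2 \<partial>M) = (\<integral>\<^sup>+y. \<integral>\<^sup>+x. p x y \<partial>lborel \<partial>lborel)"
    by (simp add: p)
  have "(\<integral>\<^sup>+\<omega>. emeasure lborel (zero_cell (X \<omega>)) \<partial>M) = (\<integral>\<^sup>+\<omega>. (\<integral>\<^sup>+x. i \<omega> x \<partial>lborel) \<partial>M)"
    by (intro nn_integral_cong V)
  also have "\<dots> = (\<integral>\<^sup>+x. (\<integral>\<^sup>+\<omega>. i \<omega> x \<partial>M) \<partial>lborel)" by (rule MP.Fubini'[symmetric]) measurable
  also have "\<dots> = (\<integral>\<^sup>+x. p x x \<partial>lborel)"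
    unfolding p by (intro nn_integral_cong) (auto simp: i_def indicator_def)
  finally show "(\<integral>\<^sup>+\<omega>. emeasure lborel (zero_cell (X \<omega>)) \<partial>M) = (\<integral>\<^sup>+x. p x x \<partial>lborel)" .
qed

section \<open>Second moment and variance\<close>

theorem theorem1:
  fixes M :: "'w measure" and X :: "'w \<Rightarrow> (real^'n) set measure"
    and \<gamma> r :: real and n :: nat
  assumes "n = CARD('n)" and "n \<ge> 2" and "\<gamma> > 0" and "r > 0"
    and "poisson_hyperplane_process M X (hyperplane_intensity \<gamma> r)"
  shows "(\<lambda>\<omega>. emeasure lborel (zero_cell (X \<omega>))) \<in> borel_measurable M \<and>
    (\<integral>\<^sup>+ \<omega>. (emeasure lborel (zero_cell (X \<omega>)))\<^sup>2 \<partial>M) = ennreal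
      (8 * pi * b2 n / r * Gamma (2 * n / r) *
       (n * unit_ball_vol n * r / (2 * \<gamma> * c_const TYPE(real^'n) r)) powr (2 * n / r) *
       (LBINT \<phi>:{0..pi}. LBINT t:{0..1}.
          t ^ (n - 1) / F r t \<phi> powr (2 * n / r) * sin \<phi> ^ (n - 2))) \<and>
    prob_space.variance M (\<lambda>\<omega>. measure lborel (zero_cell (X \<omega>))) =
      8 * pi * b2 n / r * Gamma (2 * n / r) *
      (n * unit_ball_vol n * r / (2 * \<gamma> * c_const TYPE(real^'n) r)) powr (2 * n / r) *
      (LBINT \<phi>:{0..pi}. LBINT t:{0..1}.
         (1 / F r t \<phi> powr (2 * n / r) - 1 / (t powr r + 1) powr (2 * n / r)) *
         t ^ (n - 1) * sin \<phi> ^ (n - 2))"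
proof -
  note P = assms(5)
  have n: "CARD('n) \<ge> 2" and r: "r > 0" and \<gamma>: "\<gamma> > 0" using assms by auto
  have M: "prob_space M" and X: "hyperplane_process M X" using P by (auto simp: poisson_hyperplane_process_def)
  interpret M: prob_space M by (rule M)
  define K where "K = rate TYPE('n) \<gamma> r"
  have K: "K > 0" unfolding K_def using n \<gamma> r by (rule rate_pos)
  define z where "z = 2 * real n / r"
  define V where "V \<omega> = emeasure lborel (zero_cell (X \<omega>))" for \<omega>
  define p where "p x y = ennreal (measure M {\<omega> \<in> space M. x \<in> zero_cell (X \<omega>) \<and> y \<in> zero_cell (X \<omega>)})" for x y
  note mom = second_moment_integral[OF M X, folded p_def V_def]
  have Vm [measurable]: "V \<in> borel_measurable M" using mom(1) by (simp add: V_def[abs_def])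
  define A where "A = 2 * sphere_area (CARD('n) - 1) * sphere_area CARD('n) / r * Gamma (2 * real CARD('n) / r) * (1 / K) powr (2 * real CARD('n) / r)"
  have A0: "A \<ge> 0" unfolding A_def using r n Gamma_real_pos[of "2 * real CARD('n) / r"] by (simp add: sphere_area_nonneg)
  define h where "h f t \<phi> = t ^ (CARD('n) - 1) / f t \<phi> powr (2 * real CARD('n) / r) * sin \<phi> ^ (CARD('n) - 2)"
    for f :: "real \<Rightarrow> real \<Rightarrow> real" and t \<phi>
  define S where "S f = (LBINT \<phi>:{0..pi}. LBINT t:{0..1}. h f t \<phi>)" for f
  have pF: "p x y = ennreal (exp (- (K * (norm y powr r * F r (norm x / norm y) \<phi>))))"
    if "x \<noteq> 0" "y \<noteq> 0" "\<phi> = arccos (x \<bullet> y / (norm x * norm y))" "0 < \<phi>" "\<phi> < pi" for x y \<phi>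
  proof -
    have "1 \<le> F r (norm x / norm y) \<phi>" using that r by (intro F_ge_1) auto
    then show ?thesis unfolding p_def K_def
      using sphere_integral_max[OF r that] prob_pair_in_zero_cell[OF P \<gamma> r, of x y "norm y powr r * F r (norm x / norm y) \<phi>"]
      by (simp add: mult.assoc)
  qed
  note resF = pair_volume_formula[OF n K r F_measurable F_ge_1[OF _ _ _ r] mom(2) _ pF, folded h_def S_def A_def]
  have symp: "p x y = p y x" for x y unfolding p_def by (metis conj_commute)
  have F1: "(\<integral>\<^sup>+y. \<integral>\<^sup>+x. p x y \<partial>lborel \<partial>lborel) = ennreal (A * S (F r))"
    and F2: "\<And>\<phi>. 0 < \<phi> \<Longrightarrow> \<phi> < pi \<Longrightarrow> set_integrable lborel {0..1} (\<lambda>t. h (F r) t \<phi>)"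
    and F3: "set_integrable lborel {0..pi} (\<lambda>\<phi>. LBINT t:{0..1}. h (F r) t \<phi>)"
    and F4: "0 \<le> S (F r)"
    using resF symp by blast+
  \<comment> \<open>On the diagonal the angle is 0, outside the range of the pair formula, so the
    integral of a single linear form is used.\<close>
  have px: "p x x = ennreal (exp (- (K * norm x powr r)))" for x
    unfolding p_def K_def
    using prob_pair_in_zero_cell[OF P \<gamma> r, of x x "norm x powr r"] sphere_integral_single[OF r, of x] by simp
  \<comment> \<open>The kernel of the squared mean. Its exponent is
    \<open>norm x powr r + norm y powr r\<close>, which is \<open>norm y powr r\<close> times
    \<open>t powr r + 1\<close>, of the shape required by the polar formula.\<close>
  define p' where "p' x y = p x x * p y y" for x y
  define G where "G t (\<phi>::real) = t powr r + 1" for t \<phi>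
  have pG: "p' x y = ennreal (exp (- (K * (norm y powr r * G (norm x / norm y) \<phi>))))"
    if "x \<noteq> 0" "y \<noteq> 0" for x y :: "real^'n" and \<phi>
  proof -
    have "norm y powr r * G (norm x / norm y) \<phi> = norm x powr r + norm y powr r"
      using that by (simp add: G_def powr_divide field_simps)
    then show ?thesis unfolding p'_def px
      by (simp add: ennreal_mult[symmetric] exp_add[symmetric] algebra_simps)
  qed
  have pxm [measurable]: "(\<lambda>x. p x x) \<in> borel_measurable borel" unfolding px by measurable
  have p'm: "(\<lambda>(x, y). p' x y) \<in> borel_measurable (borel \<Otimes>\<^sub>M borel)" unfolding p'_def case_prod_beta' by measurable
  have Gm: "(\<lambda>q. G (fst q) (snd q)) \<in> borel_measurable (borel \<Otimes>\<^sub>M borel)" unfolding G_def by measurable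
  have G1: "1 \<le> G t \<phi>" for t \<phi> by (simp add: G_def)
  have sym': "p' x y = p' y x" for x y by (simp add: p'_def mult.commute)
  note resG = pair_volume_formula[OF n K r Gm G1 p'm sym' pG, folded h_def S_def A_def]
  have S1: "(\<integral>\<^sup>+y. \<integral>\<^sup>+x. p' x y \<partial>lborel \<partial>lborel) = ennreal (A * S G)"
    and S2: "\<And>\<phi>. 0 < \<phi> \<Longrightarrow> \<phi> < pi \<Longrightarrow> set_integrable lborel {0..1} (\<lambda>t. h G t \<phi>)"
    and S3: "set_integrable lborel {0..pi} (\<lambda>\<phi>. LBINT t:{0..1}. h G t \<phi>)"
    and S4: "0 \<le> S G"
    using resG by blast+
  have EV2: "(\<integral>\<^sup>+\<omega>. (V \<omega>)\<^sup>2 \<partial>M) = ennreal (A * S (F r))"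
    using mom(3) F1 by (simp add: V_def)
  have EV: "(\<integral>\<^sup>+\<omega>. V \<omega> \<partial>M)\<^sup>2 = ennreal (A * S G)"
  proof -
    have "(\<integral>\<^sup>+y. \<integral>\<^sup>+x. p' x y \<partial>lborel \<partial>lborel) = (\<integral>\<^sup>+y. (\<integral>\<^sup>+x. p x x \<partial>lborel) * p y y \<partial>lborel)"
      unfolding p'_def by (intro nn_integral_cong nn_integral_multc) auto
    also have "\<dots> = (\<integral>\<^sup>+x. p x x \<partial>lborel) * (\<integral>\<^sup>+x. p x x \<partial>lborel)"
      by (intro nn_integral_cmult) auto
    finally show ?thesis using mom(4) S1 by (simp add: power2_eq_square V_def)
  qed
  let ?v = "\<lambda>\<omega>. measure lborel (zero_cell (X \<omega>))"
  have v: "?v \<omega> = enn2real (V \<omega>)" for \<omega> by (simp add: V_def measure_def)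
  have vm [measurable]: "?v \<in> borel_measurable M" unfolding v by measurable
  \<comment> \<open>A finite second moment makes the volume finite almost surely, so that the
    real-valued \<open>measure\<close> agrees with \<open>emeasure\<close>, whose moments were
    computed.\<close>
  have "(\<integral>\<^sup>+\<omega>. (V \<omega>)\<^sup>2 \<partial>M) \<noteq> \<infinity>" by (simp add: EV2)
  then have "AE \<omega> in M. (V \<omega>)\<^sup>2 \<noteq> \<infinity>" by (intro nn_integral_noteq_infinite) measurable
  then have fin: "AE \<omega> in M. V \<omega> = ennreal (?v \<omega>)"
    by eventually_elim (auto simp: v less_top power2_eq_square ennreal_mult_eq_top_iff)
  have nn2: "(\<integral>\<^sup>+\<omega>. ennreal ((?v \<omega>)\<^sup>2) \<partial>M) = ennreal (A * S (F r))"
    unfolding EV2[symmetric]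
    by (intro nn_integral_cong_AE) (use fin in eventually_elim, simp add: ennreal_power)
  have i2: "integrable M (\<lambda>\<omega>. (?v \<omega>)\<^sup>2)"
    by (rule integrableI_nn_integral_finite[OF _ _ nn2]) (use A0 F4 in auto)
  have e2: "M.expectation (\<lambda>\<omega>. (?v \<omega>)\<^sup>2) = A * S (F r)"
    using nn2 A0 F4 by (subst integral_eq_nn_integral) auto
  have i1: "integrable M ?v" by (rule M.square_integrable_imp_integrable[OF vm i2])
  have "(\<integral>\<^sup>+\<omega>. V \<omega> \<partial>M) = (\<integral>\<^sup>+\<omega>. ennreal (?v \<omega>) \<partial>M)" using fin by (rule nn_integral_cong_AE)
  also have "\<dots> = ennreal (M.expectation ?v)" using i1 by (intro nn_integral_eq_integral) auto
  finally have "ennreal ((M.expectation ?v)\<^sup>2) = ennreal (A * S G)" using EV by (simp add: ennreal_power)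
  then have e1: "(M.expectation ?v)\<^sup>2 = A * S G" using A0 S4 by (subst (asm) ennreal_inj) auto
  have "M.variance ?v = A * S (F r) - A * S G" using M.variance_eq[OF i1 i2] e2 e1 by simp
  also have "\<dots> = A * (S (F r) - S G)" by (simp add: algebra_simps)
  also have "S (F r) - S G = (LBINT \<phi>:{0..pi}. (LBINT t:{0..1}. h (F r) t \<phi>) - (LBINT t:{0..1}. h G t \<phi>))"
    unfolding S_def by (rule set_integral_diff(2)[OF F3 S3, symmetric])
  also have "\<dots> = (LBINT \<phi>:{0..pi}. LBINT t:{0..1}.
         (1 / F r t \<phi> powr (2 * n / r) - 1 / (t powr r + 1) powr (2 * n / r)) * t ^ (n - 1) * sin \<phi> ^ (n - 2))"
    unfolding set_lebesgue_integral_def[of lborel "{0..pi}"]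
  proof (rule integral_cong_AE)
    let ?d = "\<lambda>t \<phi>. (1 / F r t \<phi> powr (2 * n / r) - 1 / (t powr r + 1) powr (2 * n / r)) * t ^ (n - 1) * sin \<phi> ^ (n - 2)"
    have d: "?d t \<phi> = h (F r) t \<phi> - h G t \<phi>" for t \<phi>
      by (simp add: h_def G_def assms(1) algebra_simps)
    show "(\<lambda>\<phi>. indicator {0..pi} \<phi> *\<^sub>R ((LBINT t:{0..1}. h (F r) t \<phi>) - (LBINT t:{0..1}. h G t \<phi>))) \<in> borel_measurable lborel"
      using set_integral_diff(1)[OF F3 S3] by (simp add: set_integrable_def)
    have "(\<lambda>(\<phi>, t). indicator {0..1} t *\<^sub>R ?d t \<phi>) \<in> borel_measurable (borel \<Otimes>\<^sub>M lborel)"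
    proof -
      have [measurable]: "(\<lambda>q. F r (snd q) (fst q)) \<in> borel_measurable (borel \<Otimes>\<^sub>M borel)"
        using measurable_compose[OF _ F_measurable, of "\<lambda>q. (snd q, fst q)" "borel \<Otimes>\<^sub>M borel"] by simp
      show ?thesis unfolding case_prod_beta' by measurable
    qed
    from lborel.borel_measurable_lebesgue_integral[OF this]
    show "(\<lambda>\<phi>. indicator {0..pi} \<phi> *\<^sub>R (LBINT t:{0..1}. ?d t \<phi>)) \<in> borel_measurable lborel"
      unfolding set_lebesgue_integral_def by measurable
    \<comment> \<open>Integrability in \<open>t\<close> of the two parts is known for angles
      strictly between 0 and pi, so the inner integrals are subtracted outside the two boundary
      angles.\<close>
    show "AE \<phi> in lborel. indicator {0..pi} \<phi> *\<^sub>R ((LBINT t:{0..1}. h (F r) t \<phi>) - (LBINT t:{0..1}. h G t \<phi>)) =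
      indicator {0..pi} \<phi> *\<^sub>R (LBINT t:{0..1}. ?d t \<phi>)"
      using AE_lborel_singleton[of "0::real"] AE_lborel_singleton[of pi]
    proof eventually_elim
      case (elim \<phi>)
      show ?case
      proof (cases "0 < \<phi> \<and> \<phi> < pi")
        case True
        then show ?thesis unfolding d using set_integral_diff(2)[OF F2 S2, of \<phi> \<phi>] by simp
      next
        case False
        then show ?thesis using elim by (auto simp: indicator_def)
      qed
    qed
  qed
  finally have var: "M.variance ?v = A * (LBINT \<phi>:{0..pi}. LBINT t:{0..1}.
         (1 / F r t \<phi> powr (2 * n / r) - 1 / (t powr r + 1) powr (2 * n / r)) * t ^ (n - 1) * sin \<phi> ^ (n - 2))" .
  \<comment> \<open>The factor \<open>8 * pi * b2 n\<close> equals twice the product of the two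
    sphere areas, and the base of the power is the reciprocal of \<open>rate\<close>.\<close>
  have A: "8 * pi * b2 n / r * Gamma (2 * n / r) * (n * unit_ball_vol n * r / (2 * \<gamma> * c_const TYPE(real^'n) r)) powr (2 * n / r) = A"
    by (simp add: A_def b2_def K_def rate_def assms(1))
  have SF: "S (F r) = (LBINT \<phi>:{0..pi}. LBINT t:{0..1}. t ^ (n - 1) / F r t \<phi> powr (2 * n / r) * sin \<phi> ^ (n - 2))"
    by (simp add: S_def h_def assms(1))
  show ?thesis
    using mom(1) EV2 var unfolding A SF V_def by blast
qed

end
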